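(* Consider the Latent Block Model of the context under the standing assumptions (H1), (H2), (H3), and assume that $n,d\to\infty$ with $\log(d)/n\to0$ and $\log(n)/d\to0$. Let $\widehat{\boldsymbol\theta}_{MLE}=(\widehat{\boldsymbol\pi}_{MLE},\widehat{\boldsymbol\rho}_{MLE},\widehat{\boldsymbol\alpha}_{MLE})$ be the maximum likelihood estimator, i.e. a maximizer over $\boldsymbol\theta\in\boldsymbol\Theta$ of the observed likelihood $p(\mathbf x;\boldsymbol\theta)$. Then there exist permutations $s$ of $\{1,\dots,g\}$ and $t$ of $\{1,\dots,m\}$ such that $$\widehat{\boldsymbol\pi}(\mathbf z^\star)-\widehat{\boldsymbol\pi}_{MLE}^{\,s}=o_P(n^{-1/2}),\qquad \widehat{\boldsymbol\rho}(\mathbf w^\star)-\widehat{\boldsymbol\rho}_{MLE}^{\,t}=o_P(d^{-1/2}),$$ $$\widehat{\boldsymbol\alpha}(\mathbf z^\star,\mathbf w^\star)-\widehat{\boldsymbol\alpha}_{MLE}^{\,s,t}=o_P\bigl((nd)^{-1/2}\bigr).$$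
   Context: Latent Block Model (LBM). Integers $g,m\ge1$ are fixed and known. $\mathcal Z$ is the set of row assignments $\mathbf z=(z_{ik})\in\{0,1\}^{n\times g}$ with exactly one $1$ in each row; $\mathcal W$ is the set of column assignments $\mathbf w=(w_{j\ell})\in\{0,1\}^{d\times m}$ with exactly one $1$ in each row. A parameter is $\boldsymbol\theta=(\boldsymbol\pi,\boldsymbol\rho,\boldsymbol\alpha)\in\boldsymbol\Theta$ with $\boldsymbol\pi=(\pi_k)_{k\le g}$ and $\boldsymbol\rho=(\rho_\ell)_{\ell\le m}$ probability vectors and $\boldsymbol\alpha=(\alpha_{k\ell})$ a $g\times m$ matrix. Under $\boldsymbol\theta$, the rows of $\mathbf z$ are i.i.d. multinomial $\mathcal M(1,\boldsymbol\pi)$, the rows of $\mathbf w$ are i.i.d. multinomial $\mathcal M(1,\boldsymbol\rho)$, $\mathbf z$ and $\mathbf w$ are independent, and conditionally on $(\mathbf z,\mathbf w)$ the entries $x_{ij}$ of the $n\times d$ data matrix $\mathbf x$ are independent with $x_{ij}\sim\varphi(\cdot,\alpha_{k\ell})$ when $z_{ik}w_{j\ell}=1$. Here $\varphi(x,\alpha)=b(x)\exp(\alpha x-\psi(\alpha))$ is a regular univariate exponential family in canonical form with canonical parameter space $\mathcal A\subset\mathbb R$ (interior $\mathring{\mathcal A}$). The complete likelihood is $p(\mathbf x,\mathbf z,\mathbf w;\boldsymbol\theta)=\prod_{i,k}\pi_k^{z_{ik}}\prod_{j,\ell}\rho_\ell^{w_{j\ell}}\prod_{i,j,k,\ell}\varphi(x_{ij};\alpha_{k\ell})^{z_{ik}w_{j\ell}}$,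 and the observed likelihood is $p(\mathbf x;\boldsymbol\theta)=\sum_{\mathbf z\in\mathcal Z,\mathbf w\in\mathcal W}p(\mathbf x,\mathbf z,\mathbf w;\boldsymbol\theta)$. The data are generated under the true parameter $\boldsymbol\theta^\star=(\boldsymbol\pi^\star,\boldsymbol\rho^\star,\boldsymbol\alpha^\star)$, with true assignments $(\mathbf z^\star,\mathbf w^\star)$; $o_P$ is with respect to $\mathbb P_{\boldsymbol\theta^\star}$ as $n,d\to\infty$. Standing assumptions: (H1) there are a constant $c>0$ and a compact $C_\alpha\subset\mathring{\mathcal A}$ with $\boldsymbol\Theta\subset[c,1-c]^g\times[c,1-c]^m\times C_\alpha^{g\times m}$; (H2) $\boldsymbol\theta^\star$ lies in the relative interior of $\boldsymbol\Theta$; (H3) $\boldsymbol\theta^\star$ is identifiable up to a permutation of the row-labels and column-labels (in particular $\alpha\mapsto\varphi(\cdot,\alpha)$ is injective and each row and each column of $\boldsymbol\alpha^\star$ is unique). Complete-data estimators: $\widehat\pi_k(\mathbf z)=\frac1n\sum_i z_{ik}$, $\widehat\rho_\ell(\mathbf w)=\frac1d\sum_j w_{j\ell}$, $\widehat x_{k\ell}(\mathbf z,\mathbf w)=\dfrac{\sum_{i,j}x_{ij}z_{ik}w_{j\ell}}{(\sum_i z_{ik})(\sum_j w_{j\ell})}$, $\widehat\alpha_{k\ell}(\mathbf z,\mathbf w)=(\psi')^{-1}(\widehat x_{k\ell}(\mathbf z,\mathbf w))$; bold symbols denote the corresponding vectors/matrices. Permutations: $\boldsymbol\pi^s=(\pi_{s(k)})_k$,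 $\boldsymbol\rho^t=(\rho_{t(\ell)})_\ell$, $\boldsymbol\alpha^{s,t}=(\alpha_{s(k)t(\ell)})_{k,\ell}$.
   Formalization: (H3) also requires that no non-trivial relabelling (s,t) fixes θ*, since the claim fails at symmetric θ* such as π*=ρ*=(1/2,1/2), α*=((u,v),(v,u)); (H2) means interior relative to all (π,ρ,α) with π,ρ probability vectors, as it fails for lower-dimensional Θ. *)

theory Defs
  imports "HOL-Probability.Probability"
begin

text \<open>
  A parameter is a triple \<open>(pi, rho, alpha)\<close>. The row labels are the elements of the finite type
  \<open>'g\<close> and the column labels those of \<open>'m\<close>, so \<open>alpha $ k $ l\<close> belongs to row
  label \<open>k\<close> and column label \<open>l\<close>.
\<close>

type_synonym ('g, 'm) param = "(real ^ 'g) \<times> (real ^ 'm) \<times> (real ^ 'm ^ 'g)"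

definition prob_vector :: "real ^ 'g::finite \<Rightarrow> bool" where
  "prob_vector p \<longleftrightarrow> (\<forall>k. 0 \<le> p $ k) \<and> (\<Sum>k\<in>UNIV. p $ k) = 1"

definition param_space :: "('g::finite, 'm::finite) param set" where
  "param_space = {(p, r, a). prob_vector p \<and> prob_vector r}"

text \<open>
  The exponential family with base function \<open>b\<close> and dominating measure \<open>\<nu>\<close>.
\<close>

definition canonical_space :: "real measure \<Rightarrow> (real \<Rightarrow> real) \<Rightarrow> real set" where
  "canonical_space \<nu> b = {\<alpha>. integrable \<nu> (\<lambda>x. b x * exp (\<alpha> * x))}"

definition psi :: "real measure \<Rightarrow> (real \<Rightarrow> real) \<Rightarrow> real \<Rightarrow> real" where
  "psi \<nu> b \<alpha> = ln (\<integral>x. b x * exp (\<alpha> * x) \<partial>\<nu>)"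

definition phi :: "real measure \<Rightarrow> (real \<Rightarrow> real) \<Rightarrow> real \<Rightarrow> real \<Rightarrow> real" where
  "phi \<nu> b x \<alpha> = b x * exp (\<alpha> * x - psi \<nu> b \<alpha>)"

definition phi_law :: "real measure \<Rightarrow> (real \<Rightarrow> real) \<Rightarrow> real \<Rightarrow> real measure" where
  "phi_law \<nu> b \<alpha> = density \<nu> (\<lambda>x. ennreal (phi \<nu> b x \<alpha>))"

text \<open>
  The canonical parameter space is only required to have non-empty interior, not to be open, so
  families that are regular in the sense of an open canonical space are included.
\<close>

definition regular_exp_family :: "real measure \<Rightarrow> (real \<Rightarrow> real) \<Rightarrow> bool" where
  "regular_exp_family \<nu> b \<longleftrightarrow>
     sigma_finite_measure \<nu> \<and> sets \<nu> = sets borel \<and>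
     b \<in> borel_measurable borel \<and> (\<forall>x. 0 \<le> b x) \<and> \<not> (AE x in \<nu>. b x = 0) \<and>
     interior (canonical_space \<nu> b) \<noteq> {}"

text \<open>
  An assignment matrix with exactly one 1 in each row is encoded by the function sending a row
  index to the position of that 1: \<open>z\<^sub>i\<^sub>k = 1\<close> iff \<open>z i = k\<close>. Rows and columns of the data
  are indexed by \<open>{..<n}\<close> and \<open>{..<d}\<close>; outside this range assignments are
  \<open>undefined\<close>.
\<close>

definition label_pmf :: "nat \<Rightarrow> real ^ 'g::finite \<Rightarrow> (nat \<Rightarrow> 'g) pmf" where
  "label_pmf n p = Pi_pmf {..<n} undefined (\<lambda>_. embed_pmf (\<lambda>k. p $ k))"

definition data_space :: "nat \<Rightarrow> nat \<Rightarrow> (nat \<times> nat \<Rightarrow> real) measure" where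
  "data_space n d = (\<Pi>\<^sub>M ij\<in>{..<n} \<times> {..<d}. borel)"

definition data_law_given :: "real measure \<Rightarrow> (real \<Rightarrow> real) \<Rightarrow> nat \<Rightarrow> nat \<Rightarrow> real ^ 'm ^ 'g
    \<Rightarrow> (nat \<Rightarrow> 'g::finite) \<Rightarrow> (nat \<Rightarrow> 'm::finite) \<Rightarrow> (nat \<times> nat \<Rightarrow> real) measure" where
  "data_law_given \<nu> b n d a z w =
     (\<Pi>\<^sub>M ij\<in>{..<n} \<times> {..<d}. phi_law \<nu> b (a $ z (fst ij) $ w (snd ij)))"

text \<open>The joint law of \<open>(x, z, w)\<close>.\<close>

definition lbm_law :: "real measure \<Rightarrow> (real \<Rightarrow> real) \<Rightarrow> nat \<Rightarrow> nat \<Rightarrow> ('g::finite, 'm::finite) param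
    \<Rightarrow> ((nat \<times> nat \<Rightarrow> real) \<times> (nat \<Rightarrow> 'g) \<times> (nat \<Rightarrow> 'm)) measure" where
  "lbm_law \<nu> b n d \<theta> = (case \<theta> of (p, r, a) \<Rightarrow>
     measure_pmf (pair_pmf (label_pmf n p) (label_pmf d r)) \<bind> (\<lambda>(z, w).
       distr (data_law_given \<nu> b n d a z w)
         (data_space n d \<Otimes>\<^sub>M (count_space UNIV \<Otimes>\<^sub>M count_space UNIV)) (\<lambda>x. (x, z, w))))"

definition observed_law :: "real measure \<Rightarrow> (real \<Rightarrow> real) \<Rightarrow> nat \<Rightarrow> nat
    \<Rightarrow> ('g::finite, 'm::finite) param \<Rightarrow> (nat \<times> nat \<Rightarrow> real) measure" where
  "observed_law \<nu> b n d \<theta> = distr (lbm_law \<nu> b n d \<theta>) (data_space n d) fst"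

definition complete_likelihood :: "real measure \<Rightarrow> (real \<Rightarrow> real) \<Rightarrow> nat \<Rightarrow> nat
    \<Rightarrow> ('g::finite, 'm::finite) param
    \<Rightarrow> (nat \<times> nat \<Rightarrow> real) \<Rightarrow> (nat \<Rightarrow> 'g) \<Rightarrow> (nat \<Rightarrow> 'm) \<Rightarrow> real" where
  "complete_likelihood \<nu> b n d \<theta> x z w = (case \<theta> of (p, r, a) \<Rightarrow>
     (\<Prod>i<n. p $ z i) * (\<Prod>j<d. r $ w j) *
     (\<Prod>i<n. \<Prod>j<d. phi \<nu> b (x (i, j)) (a $ z i $ w j)))"

definition observed_likelihood :: "real measure \<Rightarrow> (real \<Rightarrow> real) \<Rightarrow> nat \<Rightarrow> nat
    \<Rightarrow> ('g::finite, 'm::finite) param \<Rightarrow> (nat \<times> nat \<Rightarrow> real) \<Rightarrow> real" where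
  "observed_likelihood \<nu> b n d \<theta> x =
     (\<Sum>z\<in>{..<n} \<rightarrow>\<^sub>E UNIV. \<Sum>w\<in>{..<d} \<rightarrow>\<^sub>E UNIV. complete_likelihood \<nu> b n d \<theta> x z w)"

definition is_mle :: "real measure \<Rightarrow> (real \<Rightarrow> real) \<Rightarrow> ('g::finite, 'm::finite) param set
    \<Rightarrow> nat \<Rightarrow> nat \<Rightarrow> (nat \<times> nat \<Rightarrow> real) \<Rightarrow> ('g, 'm) param \<Rightarrow> bool" where
  "is_mle \<nu> b \<Theta> n d x \<theta> \<longleftrightarrow> \<theta> \<in> \<Theta> \<and>
     (\<forall>\<theta>'\<in>\<Theta>. observed_likelihood \<nu> b n d \<theta>' x \<le> observed_likelihood \<nu> b n d \<theta> x)"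

definition perm_vec :: "('g \<Rightarrow> 'g) \<Rightarrow> real ^ 'g::finite \<Rightarrow> real ^ 'g" where
  "perm_vec s p = (\<chi> k. p $ s k)"

definition perm_mat :: "('g \<Rightarrow> 'g) \<Rightarrow> ('m \<Rightarrow> 'm) \<Rightarrow> real ^ 'm::finite ^ 'g::finite \<Rightarrow> real ^ 'm ^ 'g" where
  "perm_mat s t a = (\<chi> k l. a $ s k $ t l)"

definition perm_param :: "('g \<Rightarrow> 'g) \<Rightarrow> ('m \<Rightarrow> 'm) \<Rightarrow> ('g::finite, 'm::finite) param
    \<Rightarrow> ('g, 'm) param" where
  "perm_param s t \<theta> = (case \<theta> of (p, r, a) \<Rightarrow> (perm_vec s p, perm_vec t r, perm_mat s t a))"

text \<open>
  Identifiability of \<open>\<theta>\<close> within \<open>\<Theta>\<close> up to relabelling: a parameter of \<open>\<Theta>\<close>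
  that induces the same law of the data for all sample sizes is obtained from \<open>\<theta>\<close> by exactly
  one pair of permutations. Uniqueness of the pair, applied to \<open>\<theta>\<close> itself, says that no
  non-trivial relabelling fixes \<open>\<theta>\<close>. Otherwise the complete-data and the observed-data
  estimators are not equivalent. For instance at \<open>pi = rho = (1/2, 1/2)\<close> and
  \<open>alpha = ((u, v), (v, u))\<close> the local likelihood is asymptotically a sum of two Gaussian
  bumps exchanged by the simultaneous swap of the row and column labels, and when the bumps are
  close its maximum is midway between the two centres.
\<close>

definition identifiable_up_to_labels :: "real measure \<Rightarrow> (real \<Rightarrow> real)
    \<Rightarrow> ('g::finite, 'm::finite) param set \<Rightarrow> ('g, 'm) param \<Rightarrow> bool" where
  "identifiable_up_to_labels \<nu> b \<Theta> \<theta> \<longleftrightarrow>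
     (\<forall>\<theta>'\<in>\<Theta>. (\<forall>n d. observed_law \<nu> b n d \<theta>' = observed_law \<nu> b n d \<theta>) \<longrightarrow>
        (\<exists>!(s, t). bij s \<and> bij t \<and> \<theta>' = perm_param s t \<theta>)) \<and>
     inj_on (phi_law \<nu> b) (canonical_space \<nu> b) \<and>
     (case \<theta> of (p, r, a) \<Rightarrow>
        (\<forall>k k'. k \<noteq> k' \<longrightarrow> row k a \<noteq> row k' a) \<and>
        (\<forall>l l'. l \<noteq> l' \<longrightarrow> column l a \<noteq> column l' a))"

definition prop_hat :: "nat \<Rightarrow> (nat \<Rightarrow> 'g::finite) \<Rightarrow> real ^ 'g" where
  "prop_hat n z = (\<chi> k. (\<Sum>i<n. of_bool (z i = k)) / real n)"

definition x_hat :: "nat \<Rightarrow> nat \<Rightarrow> (nat \<times> nat \<Rightarrow> real) \<Rightarrow> (nat \<Rightarrow> 'g::finite) \<Rightarrow> (nat \<Rightarrow> 'm::finite)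
    \<Rightarrow> real ^ 'm ^ 'g" where
  "x_hat n d x z w = (\<chi> k l.
     (\<Sum>i<n. \<Sum>j<d. x (i, j) * of_bool (z i = k) * of_bool (w j = l)) /
     ((\<Sum>i<n. of_bool (z i = k)) * (\<Sum>j<d. of_bool (w j = l))))"

text \<open>
  The inverse of \<open>\<psi>'\<close> is taken on the interior of the canonical space; where
  \<open>x_hat\<close> is not in the range of \<open>\<psi>'\<close> the estimator has an unspecified constant value.
\<close>

definition alpha_hat :: "real measure \<Rightarrow> (real \<Rightarrow> real) \<Rightarrow> nat \<Rightarrow> nat
    \<Rightarrow> (nat \<times> nat \<Rightarrow> real) \<Rightarrow> (nat \<Rightarrow> 'g::finite) \<Rightarrow> (nat \<Rightarrow> 'm::finite) \<Rightarrow> real ^ 'm ^ 'g" where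
  "alpha_hat \<nu> b n d x z w = (\<chi> k l.
     inv_into (interior (canonical_space \<nu> b)) (deriv (psi \<nu> b)) (x_hat n d x z w $ k $ l))"

text \<open>
  \<open>X\<^sub>i = o\<^sub>P(c\<^sub>i)\<close> for random vectors \<open>X\<^sub>i\<close> on possibly different spaces \<open>P\<^sub>i\<close>.
  Measurability is part of the definition because \<open>measure\<close> is 0 on non-measurable sets.
\<close>

definition small_o_P :: "(nat \<Rightarrow> 'w measure) \<Rightarrow> (nat \<Rightarrow> 'w \<Rightarrow> 'e::euclidean_space) \<Rightarrow> (nat \<Rightarrow> real)
    \<Rightarrow> bool" where
  "small_o_P P X c \<longleftrightarrow>
     (\<forall>i. X i \<in> borel_measurable (P i)) \<and>
     (\<forall>\<epsilon>>0. (\<lambda>i. measure (P i) {\<omega> \<in> space (P i). norm (X i \<omega>) > \<epsilon> * c i}) \<longlonglongrightarrow> 0)"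

end

theory Submission
  imports Defs
begin

text \<open>
  Fix typical assignments \<open>(y, v)\<close> and let \<open>\<theta>c\<close> be the complete-data estimator. For an assignment
  \<open>(z, w)\<close> at Hamming distances \<open>h1, h2\<close> from the relabellings of \<open>(y, v)\<close>, and any \<open>\<alpha>\<close>, the mean
  of the square root of the conditional likelihood ratio against \<open>(y, v, \<alpha>*)\<close> is a product of
  Bhattacharyya coefficients. The strong convexity of \<open>\<psi>\<close> and the distinctness of the rows and columns
  of \<open>\<alpha>*\<close> bound it by \<open>exp (- e * (d * h1 + n * h2))\<close>. Since \<open>ln n = o(d)\<close> and \<open>ln d = o(n)\<close>, the
  sum over all assignments other than relabellings tends to 0, even after a union bound over a
  grid of polynomially many \<open>\<alpha>\<close>. So, uniformly in \<open>\<theta>\<close>, the observed likelihood is at most the sum of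
  the complete likelihoods of the relabellings of \<open>\<theta>\<close> plus a small multiple of the maximum of the
  complete likelihood. That maximum is attained at \<open>\<theta>c\<close> and is itself at most the observed
  likelihood at \<open>\<theta>c\<close>; away from \<open>\<theta>c\<close> the complete likelihood decays like
  \<open>exp (- k * (n * |\<pi> - \<pi>c|^2 + d * |\<rho> - \<rho>c|^2 + n * d * |\<alpha> - \<alpha>c|^2))\<close>. As \<open>\<theta>*\<close> has no symmetry, only one
  relabelling of the maximiser contributes, and its exponent must tend to 0.
\<close>

section \<open>One-parameter exponential families\<close>

text \<open>The obstacle is that the maximiser depends on the data, so the observed likelihood must
  be bounded for all parameters at once. The label probabilities can be handled deterministically:
  the empirical frequencies maximise the label likelihood, and each changed label costs at most a
  factor \<open>1 / c\<close>. For \<open>\<alpha>\<close>, the grid has mesh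
  \<open>(b0 - a0) / (n * d)\<close>. Once the absolute values of the data sum to
  \<open>O(n * d)\<close>, the log-likelihood has slope \<open>O(n * d)\<close>, so rounding costs a
  constant factor and the union bound a power of \<open>n * d\<close>. Separation of the assignments
  holds for every competing matrix with one constant, which gives the same exponential rate at each
  grid point. Comparing the maximiser with \<open>\<theta>c\<close> requires
  \<open>\<theta>c\<close> to be an admissible parameter; this is where the relative interior
  enters. Consistency and rates then come out of the same inequality, since the exponent weights the
  three squared errors by \<open>n\<close>, \<open>d\<close> and \<open>n * d\<close>.\<close>

lemma power_le_exp_abs:
  fixes x t :: real
  assumes "t > 0"
  shows "\<bar>x\<bar> ^ k \<le> fact k / t ^ k * (exp (t * x) + exp (- t * x))"
proof -
  have "(t * \<bar>x\<bar>) ^ k / fact k \<le> exp (t * \<bar>x\<bar>)"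
  proof -
    have "(\<Sum>i\<in>{k}. (t * \<bar>x\<bar>) ^ i /\<^sub>R fact i) \<le> (\<Sum>i. (t * \<bar>x\<bar>) ^ i /\<^sub>R fact i)"
      using assms summable_exp_generic[of "t * \<bar>x\<bar>"] by (intro sum_le_suminf) auto
    then show ?thesis by (simp add: exp_def divide_inverse mult.commute)
  qed
  also have "exp (t * \<bar>x\<bar>) \<le> exp (t * x) + exp (- t * x)"
    by (cases "x \<ge> 0") (auto simp: add_increasing add_increasing2)
  finally have "(t * \<bar>x\<bar>) ^ k / fact k \<le> exp (t * x) + exp (- t * x)" .
  then show ?thesis
    using assms by (simp add: power_mult_distrib field_simps)
qed

lemma exp_taylor1:
  fixes u :: real
  shows "\<bar>exp u - 1 - u\<bar> \<le> u\<^sup>2 * exp \<bar>u\<bar>"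
  using Taylor_exp_field[of u 1] by (simp add: power2_eq_square algebra_simps)

text \<open>Injectivity of the parametrisation belongs to the locale because it rules out a
  vanishing variance and so makes \<open>\<psi>\<close> strictly convex.\<close>

locale exp_family =
  fixes \<nu> :: "real measure" and b :: "real \<Rightarrow> real"
  assumes reg: "regular_exp_family \<nu> b"
    and inj: "inj_on (phi_law \<nu> b) (canonical_space \<nu> b)"
begin

abbreviation "K \<equiv> canonical_space \<nu> b"
abbreviation "\<psi> \<equiv> psi \<nu> b"
abbreviation "I \<equiv> interior K"

text \<open>Moments are left unnormalised so that differentiation in \<open>\<alpha>\<close> is just
  the shift from \<open>k\<close> to \<open>Suc k\<close>; on \<open>K\<close>, \<open>mom 0\<close>
  is the exponential of \<open>\<psi>\<close>.\<close>

definition mom :: "nat \<Rightarrow> real \<Rightarrow> real" where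
  "mom k \<alpha> = (\<integral>x. x ^ k * (b x * exp (\<alpha> * x)) \<partial>\<nu>)"

lemma sets_nu [measurable_cong]: "sets \<nu> = sets borel"
  and b_meas [measurable]: "b \<in> borel_measurable borel"
  and b_nonneg [simp]: "0 \<le> b x"
  and b_nonzero: "\<not> (AE x in \<nu>. b x = 0)"
  using reg by (auto simp: regular_exp_family_def)

lemma I_K: "\<alpha> \<in> I \<Longrightarrow> \<alpha> \<in> K"
  using interior_subset by auto

lemma K_integrable: "\<alpha> \<in> K \<Longrightarrow> integrable \<nu> (\<lambda>x. b x * exp (\<alpha> * x))"
  by (simp add: canonical_space_def)

text \<open>The sign of the integration variable decides which of the two endpoint exponentials
  dominates, so their sum always does.\<close>

lemma K_between:
  assumes "x \<in> K" "y \<in> K" "x \<le> z" "z \<le> y"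
  shows "z \<in> K"
proof -
  have "integrable \<nu> (\<lambda>u. b u * exp (z * u))"
  proof (rule Bochner_Integration.integrable_bound)
    show "integrable \<nu> (\<lambda>u. b u * exp (x * u) + b u * exp (y * u))"
      using assms K_integrable by auto
    have "b u * exp (z * u) \<le> b u * exp (x * u) + b u * exp (y * u)" for u
    proof -
      have "exp (z * u) \<le> exp (x * u) + exp (y * u)"
      proof (cases "u \<ge> 0")
        case True
        then have "exp (z * u) \<le> exp (y * u)" using assms by (simp add: mult_right_mono)
        then show ?thesis by (simp add: add_increasing)
      next
        case False
        then have "exp (z * u) \<le> exp (x * u)" using assms by (simp add: mult_right_mono_neg)
        then show ?thesis by (simp add: add_increasing2)
      qed
      then show ?thesis by (metis b_nonneg distrib_left mult_left_mono)
    qed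
    then show "AE u in \<nu>. norm (b u * exp (z * u)) \<le> norm (b u * exp (x * u) + b u * exp (y * u))"
      by simp
  qed measurable
  then show ?thesis by (simp add: canonical_space_def)
qed

lemma convex_K: "convex K"
  unfolding is_interval_convex_1[symmetric] is_interval_1
  using K_between by blast

lemma convex_I: "convex I"
  using convex_interior[OF convex_K] .

lemma I_between: "x \<in> I \<Longrightarrow> y \<in> I \<Longrightarrow> x \<le> z \<Longrightarrow> z \<le> y \<Longrightarrow> z \<in> I"
  using convex_I unfolding is_interval_convex_1[symmetric] is_interval_1 by blast

lemma I_ball:
  assumes "\<alpha> \<in> I"
  obtains t where "t > 0" "\<And>s. \<bar>s\<bar> \<le> t \<Longrightarrow> \<alpha> + s \<in> I"
proof -
  obtain e where e: "e > 0" "ball \<alpha> e \<subseteq> I"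
    using assms open_contains_ball open_interior by metis
  show thesis
    by (rule that[of "e/2"]) (use e in \<open>auto simp: dist_real_def subset_iff\<close>)
qed

text \<open>In the interior there is room to tilt by \<open>t\<close> in both directions, and the
  two tilts together absorb any power of \<open>\<bar>x\<bar>\<close>.\<close>

lemma integrable_abs_mom:
  assumes "\<alpha> \<in> I"
  shows "integrable \<nu> (\<lambda>x. \<bar>x\<bar> ^ k * (b x * exp (\<alpha> * x)))"
proof -
  obtain t where t: "t > 0" "\<And>s. \<bar>s\<bar> \<le> t \<Longrightarrow> \<alpha> + s \<in> I"
    using I_ball[OF assms] by blast
  have K: "\<alpha> + t \<in> K" "\<alpha> - t \<in> K"
    using t(2)[of t] t(2)[of "-t"] t(1) I_K by auto
  show ?thesis
  proof (rule Bochner_Integration.integrable_bound)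
    show "integrable \<nu> (\<lambda>x. fact k / t ^ k * (b x * exp ((\<alpha> + t) * x) + b x * exp ((\<alpha> - t) * x)))"
      using K K_integrable by auto
    have "\<bar>x\<bar> ^ k * (b x * exp (\<alpha> * x))
        \<le> fact k / t ^ k * (b x * exp ((\<alpha> + t) * x) + b x * exp ((\<alpha> - t) * x))" for x
    proof -
      have "\<bar>x\<bar> ^ k * (b x * exp (\<alpha> * x))
          \<le> fact k / t ^ k * (exp (t * x) + exp (- t * x)) * (b x * exp (\<alpha> * x))"
        by (intro mult_right_mono power_le_exp_abs t) simp
      also have "\<dots> = fact k / t ^ k * (b x * (exp (t * x + \<alpha> * x)) + b x * exp (- t * x + \<alpha> * x))"
        unfolding exp_add by (simp add: algebra_simps)
      finally show ?thesis by (simp add: algebra_simps)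
    qed
    then show "AE x in \<nu>. norm (\<bar>x\<bar> ^ k * (b x * exp (\<alpha> * x)))
        \<le> norm (fact k / t ^ k * (b x * exp ((\<alpha> + t) * x) + b x * exp ((\<alpha> - t) * x)))"
      using t(1) by simp
  qed measurable
qed

lemma integrable_mom:
  assumes "\<alpha> \<in> I"
  shows "integrable \<nu> (\<lambda>x. x ^ k * (b x * exp (\<alpha> * x)))"
  by (rule Bochner_Integration.integrable_bound[OF integrable_abs_mom[OF assms, of k]])
    (auto simp: power_abs abs_mult)

text \<open>A quantitative remainder takes the place of a limit under the integral: for all
  \<open>\<bar>h\<bar> \<le> t\<close> at once, the second-order error of the exponential at
  \<open>h * x\<close> is dominated by \<open>h\<^sup>2\<close> times absolute moments of order
  \<open>k + 2\<close> at the tilted parameters \<open>\<alpha> + t\<close> and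
  \<open>\<alpha> - t\<close>.\<close>

lemma mom_deriv:
  assumes "\<alpha> \<in> I"
  shows "(mom k has_real_derivative mom (Suc k) \<alpha>) (at \<alpha>)"
proof -
  obtain t where t: "t > 0" "\<And>s. \<bar>s\<bar> \<le> t \<Longrightarrow> \<alpha> + s \<in> I"
    using I_ball[OF assms] by blast
  define C where "C = (\<integral>x. \<bar>x\<bar> ^ (k + 2) * (b x * exp ((\<alpha> + t) * x)) \<partial>\<nu>)
      + (\<integral>x. \<bar>x\<bar> ^ (k + 2) * (b x * exp ((\<alpha> - t) * x)) \<partial>\<nu>)"
  have It: "\<alpha> + t \<in> I" "\<alpha> - t \<in> I"
    using t(2)[of t] t(2)[of "-t"] t(1) by auto
  have bound: "\<bar>mom k (\<alpha> + h) - mom k \<alpha> - h * mom (Suc k) \<alpha>\<bar> \<le> h\<^sup>2 * C" if h: "\<bar>h\<bar> \<le> t" for h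
  proof -
    let ?f = "\<lambda>x. x ^ k * (b x * exp ((\<alpha> + h) * x)) - x ^ k * (b x * exp (\<alpha> * x))
        - h * (x ^ Suc k * (b x * exp (\<alpha> * x)))"
    let ?g = "\<lambda>x. h\<^sup>2 * (\<bar>x\<bar> ^ (k + 2) * (b x * exp ((\<alpha> + t) * x))
        + \<bar>x\<bar> ^ (k + 2) * (b x * exp ((\<alpha> - t) * x)))"
    have int: "integrable \<nu> ?f" "integrable \<nu> ?g"
      by (intro Bochner_Integration.integrable_diff Bochner_Integration.integrable_add
          integrable_mult_right integrable_mom integrable_abs_mom assms t(2) h It)+
    have "integral\<^sup>L \<nu> ?f = mom k (\<alpha> + h) - mom k \<alpha> - h * mom (Suc k) \<alpha>"
      unfolding mom_def
      by (subst Bochner_Integration.integral_diff Bochner_Integration.integral_diff,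
          intro Bochner_Integration.integrable_diff integrable_mom assms t(2) h,
          intro integrable_mult_right integrable_mom assms)
        (simp add: Bochner_Integration.integral_diff integrable_mom assms t(2) h del: power_Suc)
    moreover have "integral\<^sup>L \<nu> ?g = h\<^sup>2 * C"
      unfolding C_def
      by (simp add: Bochner_Integration.integral_add integrable_abs_mom It del: power_Suc power_add_numeral2 add_2_eq_Suc')
    moreover
    have "\<bar>?f x\<bar> \<le> ?g x" for x
    proof -
      have "?f x = x ^ k * (b x * exp (\<alpha> * x)) * (exp (h * x) - 1 - h * x)"
        by (simp add: algebra_simps exp_add)
      then have "\<bar>?f x\<bar> = \<bar>x\<bar> ^ k * (b x * exp (\<alpha> * x)) * \<bar>exp (h * x) - 1 - h * x\<bar>"
        by (simp add: abs_mult power_abs)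
      also have "\<dots> \<le> \<bar>x\<bar> ^ k * (b x * exp (\<alpha> * x)) * ((h * x)\<^sup>2 * exp \<bar>h * x\<bar>)"
        by (intro mult_left_mono exp_taylor1) simp
      also have "exp \<bar>h * x\<bar> \<le> exp (t * x) + exp (- t * x)"
      proof -
        have "exp \<bar>h * x\<bar> \<le> exp (t * \<bar>x\<bar>)" using h by (simp add: abs_mult mult_right_mono)
        also have "exp (t * \<bar>x\<bar>) \<le> exp (t * x) + exp (- t * x)"
          by (cases "x \<ge> 0") (auto simp: add_increasing add_increasing2)
        finally show ?thesis .
      qed
      also have "\<bar>x\<bar> ^ k * (b x * exp (\<alpha> * x)) * ((h * x)\<^sup>2 * (exp (t * x) + exp (- t * x))) = ?g x"
        by (simp add: algebra_simps exp_add exp_diff exp_minus power2_eq_square[of x]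
            power2_abs[of x, symmetric] power_mult_distrib power_add divide_inverse)
      finally show ?thesis by (simp add: mult_left_mono)
    qed
    then have "\<bar>integral\<^sup>L \<nu> ?f\<bar> \<le> integral\<^sup>L \<nu> ?g"
      by (intro integral_abs_bound_integral[OF int])
    ultimately show ?thesis by (simp only:)
  qed
  have "(\<lambda>h. (mom k (\<alpha> + h) - mom k \<alpha>) / h) \<midarrow>0\<rightarrow> mom (Suc k) \<alpha>"
  proof (rule LIM_I)
    have "C \<ge> 0" unfolding C_def by (intro add_nonneg_nonneg integral_nonneg_AE) auto
    fix r :: real assume r: "r > 0"
    show "\<exists>s>0. \<forall>h. h \<noteq> 0 \<and> norm (h - 0) < s \<longrightarrow>
        norm ((mom k (\<alpha> + h) - mom k \<alpha>) / h - mom (Suc k) \<alpha>) < r"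
    \<comment> \<open>\<open>C\<close> may be 0, so the radius divides by
      \<open>C + 1\<close>.\<close>
    proof (intro exI[of _ "min t (r / (C + 1))"] conjI allI impI)
      show "min t (r / (C + 1)) > 0" using t(1) r \<open>C \<ge> 0\<close> by simp
      fix h :: real assume h: "h \<noteq> 0 \<and> norm (h - 0) < min t (r / (C + 1))"
      have "\<bar>(mom k (\<alpha> + h) - mom k \<alpha>) / h - mom (Suc k) \<alpha>\<bar>
          = \<bar>mom k (\<alpha> + h) - mom k \<alpha> - h * mom (Suc k) \<alpha>\<bar> / \<bar>h\<bar>"
        using h by (simp add: field_simps flip: abs_divide)
      also have "\<dots> \<le> h\<^sup>2 * C / \<bar>h\<bar>"
        using bound[of h] h by (intro divide_right_mono) auto
      also have "\<dots> = \<bar>h\<bar> * C"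
      proof -
        have "u * u * C / u = u * C" if "u \<noteq> 0" for u using that by simp
        from this[of "\<bar>h\<bar>"] show ?thesis using h by (simp add: power2_eq_square)
      qed
      also have "\<dots> \<le> \<bar>h\<bar> * (C + 1)" by (intro mult_left_mono) auto
      also have "\<dots> < r" using h \<open>C \<ge> 0\<close> by (auto simp: field_simps)
      finally show "norm ((mom k (\<alpha> + h) - mom k \<alpha>) / h - mom (Suc k) \<alpha>) < r" by simp
    qed
  qed
  then show ?thesis unfolding DERIV_def .
qed


lemma mom0_pos:
  assumes "\<alpha> \<in> K"
  shows "mom 0 \<alpha> > 0"
proof -
  have "mom 0 \<alpha> \<ge> 0" unfolding mom_def by (intro integral_nonneg_AE) auto
  moreover have "mom 0 \<alpha> \<noteq> 0"
  proof
    assume "mom 0 \<alpha> = 0"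
    then have "AE x in \<nu>. b x * exp (\<alpha> * x) = 0"
      using integral_nonneg_eq_0_iff_AE[OF K_integrable[OF assms]] by (simp add: mom_def)
    then show False using b_nonzero by simp
  qed
  ultimately show ?thesis by simp
qed

lemma psi_eq: "\<psi> \<alpha> = ln (mom 0 \<alpha>)"
  by (simp add: psi_def mom_def)

lemma exp_psi: "\<alpha> \<in> K \<Longrightarrow> exp (\<psi> \<alpha>) = mom 0 \<alpha>"
  by (simp add: psi_eq mom0_pos)

text \<open>\<open>\<mu>\<close> and \<open>V\<close> are the mean and the variance of the law with
  parameter \<open>\<alpha>\<close>; on the interior they are the first two derivatives of
  \<open>\<psi>\<close>.\<close>

definition \<mu> :: "real \<Rightarrow> real" where "\<mu> \<alpha> = mom 1 \<alpha> / mom 0 \<alpha>"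
definition V :: "real \<Rightarrow> real" where "V \<alpha> = mom 2 \<alpha> / mom 0 \<alpha> - (\<mu> \<alpha>)\<^sup>2"

lemma psi_deriv:
  assumes "\<alpha> \<in> I"
  shows "(\<psi> has_real_derivative \<mu> \<alpha>) (at \<alpha>)"
proof -
  have "((\<lambda>\<alpha>. ln (mom 0 \<alpha>)) has_real_derivative \<mu> \<alpha>) (at \<alpha>)"
    using mom_deriv[OF assms, of 0] mom0_pos[OF I_K[OF assms]]
    by (auto intro!: derivative_eq_intros simp: \<mu>_def)
  moreover have "\<psi> = (\<lambda>\<alpha>. ln (mom 0 \<alpha>))" by (auto simp: psi_eq)
  ultimately show ?thesis by simp
qed

lemma deriv_psi: "\<alpha> \<in> I \<Longrightarrow> deriv \<psi> \<alpha> = \<mu> \<alpha>"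
  using psi_deriv DERIV_imp_deriv by blast

lemma mu_deriv:
  assumes "\<alpha> \<in> I"
  shows "(\<mu> has_real_derivative V \<alpha>) (at \<alpha>)"
proof -
  have "((\<lambda>\<alpha>. mom 1 \<alpha> / mom 0 \<alpha>) has_real_derivative
      (mom 2 \<alpha> * mom 0 \<alpha> - mom 1 \<alpha> * mom 1 \<alpha>) / (mom 0 \<alpha> * mom 0 \<alpha>)) (at \<alpha>)"
    using mom_deriv[OF assms, of 0] mom_deriv[OF assms, of 1] mom0_pos[OF I_K[OF assms]]
    by (intro DERIV_divide) (simp_all add: numeral_2_eq_2)
  moreover have "(mom 2 \<alpha> * mom 0 \<alpha> - mom 1 \<alpha> * mom 1 \<alpha>) / (mom 0 \<alpha> * mom 0 \<alpha>) = V \<alpha>"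
    using mom0_pos[OF I_K[OF assms]] by (simp add: V_def \<mu>_def field_simps power2_eq_square)
  moreover have "\<mu> = (\<lambda>\<alpha>. mom 1 \<alpha> / mom 0 \<alpha>)" by (auto simp: \<mu>_def)
  ultimately show ?thesis by simp
qed

lemma V_cont: "\<alpha> \<in> I \<Longrightarrow> isCont V \<alpha>"
  unfolding V_def \<mu>_def
  using mom_deriv[THEN DERIV_isCont] mom0_pos[OF I_K]
  by (intro continuous_intros) (auto simp: less_imp_neq[symmetric])

lemma phi_meas [measurable]: "(\<lambda>x. phi \<nu> b x \<alpha>) \<in> borel_measurable borel"
  unfolding phi_def by measurable

lemma phi_nonneg: "phi \<nu> b x \<alpha> \<ge> 0"
  unfolding phi_def by simp

text \<open>If the variance vanished at some parameter, the base measure would be a point mass and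
  all members of the family would coincide.\<close>
lemma V_pos:
  assumes "\<alpha> \<in> I"
  shows "V \<alpha> > 0"
proof -
  let ?g = "\<lambda>x. (x - \<mu> \<alpha>)\<^sup>2 * (b x * exp (\<alpha> * x))"
  have geq: "?g x = x ^ 2 * (b x * exp (\<alpha> * x)) - (2 * \<mu> \<alpha>) * (x ^ 1 * (b x * exp (\<alpha> * x)))
      + (\<mu> \<alpha>)\<^sup>2 * (x ^ 0 * (b x * exp (\<alpha> * x)))" for x
    by (simp add: power2_eq_square algebra_simps)
  have ing: "integrable \<nu> ?g"
    unfolding geq by (intro Bochner_Integration.integrable_diff Bochner_Integration.integrable_add
          integrable_mult_right integrable_mom assms)
  have p: "mom 0 \<alpha> > 0" using mom0_pos[OF I_K[OF assms]] .
  have "integral\<^sup>L \<nu> ?g = mom 2 \<alpha> - 2 * \<mu> \<alpha> * mom 1 \<alpha> + (\<mu> \<alpha>)\<^sup>2 * mom 0 \<alpha>"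
  proof -
    let ?h = "\<lambda>k x. x ^ k * (b x * exp (\<alpha> * x))"
    have "integral\<^sup>L \<nu> ?g = (\<integral>x. ?h 2 x - 2 * \<mu> \<alpha> * ?h 1 x \<partial>\<nu>) + (\<integral>x. (\<mu> \<alpha>)\<^sup>2 * ?h 0 x \<partial>\<nu>)"
      unfolding geq by (intro Bochner_Integration.integral_add Bochner_Integration.integrable_diff
          integrable_mult_right integrable_mom assms)
    also have "(\<integral>x. ?h 2 x - 2 * \<mu> \<alpha> * ?h 1 x \<partial>\<nu>) = integral\<^sup>L \<nu> (?h 2) - (\<integral>x. 2 * \<mu> \<alpha> * ?h 1 x \<partial>\<nu>)"
      by (intro Bochner_Integration.integral_diff integrable_mult_right integrable_mom assms)
    finally show ?thesis
      unfolding mom_def by (simp only: integral_mult_right_zero)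
  qed
  also have "\<dots> = mom 0 \<alpha> * V \<alpha>"
    using p by (simp add: V_def \<mu>_def field_simps power2_eq_square)
  finally have eq: "integral\<^sup>L \<nu> ?g = mom 0 \<alpha> * V \<alpha>" .
  have "integral\<^sup>L \<nu> ?g \<ge> 0" by (intro integral_nonneg_AE) auto
  then have "V \<alpha> \<ge> 0" using eq p by (simp add: zero_le_mult_iff)
  moreover have "V \<alpha> \<noteq> 0"
  proof
    assume "V \<alpha> = 0"
    then have "AE x in \<nu>. ?g x = 0"
      using integral_nonneg_eq_0_iff_AE[OF ing] eq by simp
    then have ae: "AE x in \<nu>. b x = 0 \<or> x = \<mu> \<alpha>" by eventually_elim auto
    obtain t where t: "t > 0" "\<And>s. \<bar>s\<bar> \<le> t \<Longrightarrow> \<alpha> + s \<in> I"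
      using I_ball[OF assms] by blast
    \<comment> \<open>All mass of \<open>b\<close> sits at the point \<open>\<mu> \<alpha>\<close>,
      where the tilt by \<open>\<beta>\<close> is a constant that cancels against the
      normaliser.\<close>
    have "AE x in \<nu>. phi \<nu> b x \<beta> = b x / (\<integral>x. b x \<partial>\<nu>)" if "\<beta> \<in> K" for \<beta>
    proof -
      have "mom 0 \<beta> = (\<integral>x. exp (\<beta> * \<mu> \<alpha>) * b x \<partial>\<nu>)"
        unfolding mom_def by (intro integral_cong_AE) (use ae in auto)
      also have "\<dots> = exp (\<beta> * \<mu> \<alpha>) * (\<integral>x. b x \<partial>\<nu>)" by simp
      finally have m: "mom 0 \<beta> = exp (\<beta> * \<mu> \<alpha>) * (\<integral>x. b x \<partial>\<nu>)" .
      show ?thesis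
        using ae
      proof eventually_elim
        case (elim x)
        then show ?case
          using m exp_psi[OF that] mom0_pos[OF that] by (auto simp: phi_def exp_diff)
      qed
    qed
    note const = this
    have "\<alpha> + t \<in> K" using t(2)[of t] t(1) I_K by auto
    from const[OF I_K[OF assms]] const[OF this]
    have "AE x in \<nu>. phi \<nu> b x \<alpha> = phi \<nu> b x (\<alpha> + t)"
      by eventually_elim simp
    then have "phi_law \<nu> b \<alpha> = phi_law \<nu> b (\<alpha> + t)"
      unfolding phi_law_def by (intro density_cong) auto
    then show False
      using inj_onD[OF inj, of \<alpha> "\<alpha> + t"] t(2)[of t] t(1) I_K assms by auto
  qed
  ultimately show ?thesis by simp
qed

end

lemma borel_measurable_restrict_cover:
  fixes f :: "'a::topological_space \<Rightarrow> 'b::topological_space"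
  assumes "J \<in> sets borel" "f \<in> borel_measurable (restrict_space borel J)"
    "f \<in> borel_measurable (restrict_space borel (- J))"
  shows "f \<in> borel_measurable borel"
  by (rule measurable_piecewise_restrict[of "{J, - J}"]) (use assms in auto)

section \<open>Strong convexity of \<open>\<psi>\<close> and inversion of its derivative\<close>

context exp_family begin

lemma mu_strict_mono:
  assumes "x \<in> I" "y \<in> I" "x < y"
  shows "\<mu> x < \<mu> y"
proof (rule DERIV_pos_imp_increasing[OF assms(3)])
  fix z assume "x \<le> z" "z \<le> y"
  then have "z \<in> I" using I_between[OF assms(1,2)] by blast
  then show "\<exists>l. (\<mu> has_real_derivative l) (at z) \<and> l > 0"
    using mu_deriv V_pos by blast
qed

text \<open>By compactness the continuous positive function \<open>V\<close> has a positive minimum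
  on the interval, and half of it bounds the coefficient of the second-order Taylor
  remainder.\<close>

lemma strong_convex:
  assumes "a0 \<in> I" "b0 \<in> I" "a0 \<le> b0"
  obtains \<kappa> where "\<kappa> > 0"
    "\<And>x y. x \<in> {a0..b0} \<Longrightarrow> y \<in> {a0..b0} \<Longrightarrow> \<psi> y \<ge> \<psi> x + \<mu> x * (y - x) + \<kappa> * (y - x)\<^sup>2"
proof -
  have sub: "{a0..b0} \<subseteq> I" using I_between[OF assms(1,2)] by auto
  have "continuous_on {a0..b0} V"
    using sub V_cont by (intro continuous_at_imp_continuous_on) auto
  then obtain z where z: "z \<in> {a0..b0}" "\<And>y. y \<in> {a0..b0} \<Longrightarrow> V z \<le> V y"
    using continuous_attains_inf[of "{a0..b0}" V] assms(3) by auto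
  show thesis
  proof (rule that[of "V z / 2"])
    show "V z / 2 > 0" using V_pos z(1) sub by auto
    fix x y assume xy: "x \<in> {a0..b0}" "y \<in> {a0..b0}"
    have ivt: "u \<in> {a0..b0}" if "min x y \<le> u" "u \<le> max x y" for u using that xy by auto
    then have inI: "u \<in> I" if "min x y \<le> u" "u \<le> max x y" for u using that sub by blast
    define df where "df = (\<lambda>m::nat. if m = 0 then \<psi> else if m = 1 then \<mu> else V)"
    show "\<psi> y \<ge> \<psi> x + \<mu> x * (y - x) + V z / 2 * (y - x)\<^sup>2"
    proof (cases "x = y")
      case False
      have "\<exists>t. (if y < x then y < t \<and> t < x else x < t \<and> t < y) \<and>
          \<psi> y = (\<Sum>m<2. df m x / fact m * (y - x) ^ m) + df 2 t / fact 2 * (y - x) ^ 2"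
        by (rule Taylor[of 2 df \<psi> "min x y" "max x y" x y])
          (use False inI psi_deriv mu_deriv in \<open>auto simp: df_def less_2_cases_iff\<close>)
      then obtain t where t0: "if y < x then y < t \<and> t < x else x < t \<and> t < y"
        "\<psi> y = (\<Sum>m<2. df m x / fact m * (y - x) ^ m) + df 2 t / fact 2 * (y - x) ^ 2"
        by blast
      then have t: "min x y \<le> t" "t \<le> max x y"
        "\<psi> y = (\<Sum>m<2. df m x / fact m * (y - x) ^ m) + df 2 t / fact 2 * (y - x) ^ 2"
        by (simp_all split: if_splits)
      have "\<psi> y = \<psi> x + \<mu> x * (y - x) + V t / 2 * (y - x)\<^sup>2"
        using t(3) by (simp add: df_def numeral_2_eq_2)
      moreover have "V z / 2 * (y - x)\<^sup>2 \<le> V t / 2 * (y - x)\<^sup>2"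
        using z(2)[OF ivt[OF t(1,2)]] by (intro mult_right_mono) auto
      ultimately show ?thesis by simp
    qed simp
  qed
qed

text \<open>The left side is the logarithm of the Bhattacharyya coefficient of the laws with
  parameters \<open>x\<close> and \<open>y\<close>. Strong convexity is applied twice at the
  midpoint, once towards each end; the linear terms cancel and each distance is half of
  \<open>x - y\<close>, hence the quarter.\<close>

lemma psi_midpoint:
  assumes "\<And>x y. x \<in> {a0..b0} \<Longrightarrow> y \<in> {a0..b0} \<Longrightarrow> \<psi> y \<ge> \<psi> x + \<mu> x * (y - x) + \<kappa> * (y - x)\<^sup>2"
    and "x \<in> {a0..b0}" "y \<in> {a0..b0}"
  shows "\<psi> ((x + y) / 2) - \<psi> x / 2 - \<psi> y / 2 \<le> - (\<kappa> / 4) * (x - y)\<^sup>2"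
proof -
  define m where "m = (x + y) / 2"
  have d: "x - m = (x - y) / 2" "y - m = - ((x - y) / 2)" by (auto simp: m_def field_simps)
  have "m \<in> {a0..b0}" using assms by (auto simp: m_def)
  from assms(1)[OF this assms(2)] assms(1)[OF this assms(3)]
  show ?thesis unfolding d m_def[symmetric] by (simp add: power2_eq_square field_simps)
qed

text \<open>The derivative \<open>\<mu>\<close> is increasing, so its absolute value on the interval
  is bounded by its values at the ends.\<close>

lemma psi_lipschitz:
  assumes "a0 \<in> I" "b0 \<in> I" "a0 \<le> b0"
  obtains L where "L \<ge> 0"
    "\<And>x y. x \<in> {a0..b0} \<Longrightarrow> y \<in> {a0..b0} \<Longrightarrow> \<bar>\<psi> x - \<psi> y\<bar> \<le> L * \<bar>x - y\<bar>"
proof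
  define L where "L = max \<bar>\<mu> a0\<bar> \<bar>\<mu> b0\<bar>"
  show "L \<ge> 0" by (simp add: L_def)
  have mub: "\<bar>\<mu> u\<bar> \<le> L" if "u \<in> {a0..b0}" for u
  proof -
    have "u \<in> I" using that I_between[OF assms(1,2)] by auto
    then have "\<mu> a0 \<le> \<mu> u" "\<mu> u \<le> \<mu> b0"
      using mu_strict_mono[of a0 u] mu_strict_mono[of u b0] that assms by force+
    then show ?thesis by (auto simp: L_def)
  qed
  show "\<bar>\<psi> x - \<psi> y\<bar> \<le> L * \<bar>x - y\<bar>" if "x \<in> {a0..b0}" "y \<in> {a0..b0}" for x y
  proof -
    have "norm (\<psi> x - \<psi> y) \<le> L * norm (x - y)"
    proof (rule field_differentiable_bound[of "{a0..b0}" \<psi> \<mu>])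
      show "(\<psi> has_field_derivative \<mu> z) (at z within {a0..b0})" if "z \<in> {a0..b0}" for z
        using that I_between[OF assms(1,2)] by (auto intro: has_field_derivative_at_within[OF psi_deriv])
    qed (use that mub in auto)
    then show ?thesis by simp
  qed
qed

text \<open>This turns concentration of a block mean into closeness of the estimator. The
  intermediate value theorem puts \<open>u\<close> in the range of \<open>\<mu>\<close>, so
  \<open>inv_into\<close> returns a genuine preimage; strict monotonicity then confines that
  preimage.\<close>

lemma inv_mu_near:
  assumes "x \<in> I" "x - \<eta> \<in> I" "x + \<eta> \<in> I" "\<eta> > 0" "\<mu> (x - \<eta>) < u" "u < \<mu> (x + \<eta>)"
  defines "v \<equiv> inv_into I (deriv \<psi>) u"
  shows "v \<in> I" "\<mu> v = u" "\<bar>v - x\<bar> < \<eta>"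
proof -
  have "continuous_on {x - \<eta>..x + \<eta>} \<mu>"
    using mu_deriv[THEN DERIV_isCont] I_between[OF assms(2,3)]
    by (intro continuous_at_imp_continuous_on) auto
  then obtain y where y: "x - \<eta> \<le> y" "y \<le> x + \<eta>" "\<mu> y = u"
    using IVT'[of \<mu> "x - \<eta>" u "x + \<eta>"] assms by auto
  have yI: "y \<in> I" using y I_between[OF assms(2,3)] by blast
  have "deriv \<psi> y = u" using yI y deriv_psi by simp
  then have "v \<in> I" "deriv \<psi> v = u"
    unfolding v_def using yI inv_into_into[of u "deriv \<psi>" I] f_inv_into_f[of u "deriv \<psi>" I] by auto
  then have v: "v \<in> I" "\<mu> v = u" by (simp_all add: deriv_psi)
  then show "v \<in> I" "\<mu> v = u" .
  have "v > x - \<eta>"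
  proof (rule ccontr)
    assume "\<not> v > x - \<eta>"
    then have "v = x - \<eta> \<or> v < x - \<eta>" by auto
    then show False using v assms mu_strict_mono[of v "x - \<eta>"] by auto
  qed
  moreover have "v < x + \<eta>"
  proof (rule ccontr)
    assume "\<not> v < x + \<eta>"
    then have "v = x + \<eta> \<or> v > x + \<eta>" by auto
    then show False using v assms mu_strict_mono[of "x + \<eta>" v] by auto
  qed
  ultimately show "\<bar>v - x\<bar> < \<eta>" by auto
qed

text \<open>On the image of \<open>I\<close>, an interval by connectedness, the inverse is monotone.
  Off the image \<open>inv_into\<close> chooses from an empty predicate, so there it is
  constant.\<close>

lemma inv_mu_meas [measurable]: "inv_into I (deriv \<psi>) \<in> borel_measurable borel"
proof -
  let ?J = "deriv \<psi> ` I"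
  have J: "?J = \<mu> ` I" using deriv_psi by auto
  have "connected ?J"
    unfolding J using convex_connected[OF convex_I] mu_deriv[THEN DERIV_isCont]
    by (intro connected_continuous_image continuous_at_imp_continuous_on) auto
  then have "?J \<in> sets borel"
    by (simp add: is_interval_connected_1 real_interval_borel_measurable)
  moreover have "mono_on ?J (inv_into I (deriv \<psi>))"
  proof (rule mono_onI)
    fix r s assume rs: "r \<in> ?J" "s \<in> ?J" "r \<le> s"
    let ?x = "inv_into I (deriv \<psi>) r" and ?y = "inv_into I (deriv \<psi>) s"
    have "?x \<in> I" "?y \<in> I" "\<mu> ?x = r" "\<mu> ?y = s"
      using rs by (simp_all add: inv_into_into f_inv_into_f flip: deriv_psi)
    then show "?x \<le> ?y" using mu_strict_mono[of ?y ?x] rs(3) by force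
  qed
  then have "inv_into I (deriv \<psi>) \<in> borel_measurable (restrict_space borel ?J)"
    by (rule borel_measurable_mono_on_fnc)
  moreover have "inv_into I (deriv \<psi>) \<in> borel_measurable (restrict_space borel (- ?J))"
  proof -
    have "inv_into I (deriv \<psi>) u = (SOME y. False)" if "u \<in> - ?J" for u
    proof -
      have "(\<lambda>y. y \<in> I \<and> deriv \<psi> y = u) = (\<lambda>y. False)" using that by auto
      then show ?thesis by (simp add: inv_into_def)
    qed
    then show ?thesis
      by (subst measurable_cong[of _ _ "\<lambda>_. SOME y. False"]) (auto simp: space_restrict_space)
  qed
  ultimately show ?thesis
    by (rule borel_measurable_restrict_cover)
qed

end

section \<open>Confusion counts and separation of assignments\<close>

definition ham :: "nat \<Rightarrow> (nat \<Rightarrow> 'a) \<Rightarrow> (nat \<Rightarrow> 'a) \<Rightarrow> nat" where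
  "ham n z y = card {i. i < n \<and> z i \<noteq> y i}"

definition cnt :: "nat \<Rightarrow> (nat \<Rightarrow> 'a) \<Rightarrow> 'a \<Rightarrow> nat" where
  "cnt n z k = card {i. i < n \<and> z i = k}"

text \<open>The distance from \<open>z\<close> to the orbit of \<open>y\<close> under permutations
  of the label values. It vanishes exactly when \<open>z\<close> is, on the first \<open>n\<close>
  indices, a relabelling of \<open>y\<close>.\<close>

definition hmin :: "nat \<Rightarrow> (nat \<Rightarrow> 'a::finite) \<Rightarrow> (nat \<Rightarrow> 'a) \<Rightarrow> nat" where
  "hmin n y z = Min ((\<lambda>s. ham n z (s \<circ> y)) ` {s. bij s})"

lemma finite_bij [simp]: "finite {s :: 'a::finite \<Rightarrow> 'a. bij s}"
  by (rule finite_subset[OF subset_UNIV]) simp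

lemma hmin_le: "bij s \<Longrightarrow> hmin n y z \<le> ham n z (s \<circ> y)"
  unfolding hmin_def by (intro Min_le) auto

lemma hmin_attained:
  obtains s where "bij s" "hmin n y z = ham n z (s \<circ> y)"
proof -
  have "hmin n y z \<in> (\<lambda>s. ham n z (s \<circ> y)) ` {s. bij s}"
    unfolding hmin_def by (intro Min_in) (auto intro: exI[of _ id])
  then show thesis using that by auto
qed

lemma ham_le: "ham n z y \<le> n"
  unfolding ham_def by (rule order_trans[OF card_mono[of "{..<n}"]]) auto

lemma ham_0_iff: "ham n z y = 0 \<longleftrightarrow> (\<forall>i<n. z i = y i)"
  unfolding ham_def by auto

lemma power_ham_prod: "(q::'b::comm_semiring_1) ^ ham n z y = (\<Prod>i<n. if z i \<noteq> y i then q else 1)"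
  unfolding ham_def by (simp add: prod.If_cases Int_def)

text \<open>The generating function of the Hamming distance factorises over the coordinates:
  agreement contributes 1 and each of the other labels \<open>q\<close>. At \<open>q = 0\<close> it
  equals 1, because \<open>0 ^ ham n z y\<close> is the indicator of agreement below
  \<open>n\<close> and exactly one extensional function agrees with \<open>y\<close> there.\<close>

lemma sum_power_ham_PiE:
  fixes y :: "nat \<Rightarrow> 'a::finite" and q :: real
  shows "(\<Sum>z\<in>{..<n} \<rightarrow>\<^sub>E UNIV. q ^ ham n z y) = (1 + (real CARD('a) - 1) * q) ^ n"
proof -
  have s: "(\<Sum>k\<in>UNIV. if k \<noteq> x then q else 1) = 1 + (real CARD('a) - 1) * q" for x :: 'a
  proof -
    have "(\<Sum>k\<in>UNIV. if k \<noteq> x then q else 1) = (\<Sum>k\<in>UNIV. q + (if k = x then 1 - q else 0))"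
      by (intro sum.cong) auto
    then show ?thesis by (simp add: sum.distrib algebra_simps)
  qed
  have "(\<Sum>z\<in>{..<n} \<rightarrow>\<^sub>E UNIV. q ^ ham n z y)
      = (\<Sum>z\<in>{..<n} \<rightarrow>\<^sub>E UNIV. \<Prod>i<n. if z i \<noteq> y i then q else 1)"
    by (simp add: power_ham_prod)
  also have "\<dots> = (\<Prod>i<n. \<Sum>k\<in>UNIV. if k \<noteq> y i then q else 1)"
    by (rule prod_sum_PiE[symmetric]) auto
  finally show ?thesis by (simp add: s)
qed

lemma sum_cnt: "(\<Sum>i<n. f (z i)) = (\<Sum>k\<in>UNIV. real (cnt n z k) * f k)"
  for z :: "nat \<Rightarrow> 'a::finite" and f :: "'a \<Rightarrow> real"
proof -
  have "(\<Sum>i<n. f (z i)) = (\<Sum>k\<in>UNIV. \<Sum>i\<in>{i\<in>{..<n}. z i = k}. f (z i))"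
    by (intro sum.group[symmetric]) auto
  also have "\<dots> = (\<Sum>k\<in>UNIV. real (cnt n z k) * f k)"
    by (intro sum.cong) (auto simp: cnt_def)
  finally show ?thesis .
qed

text \<open>Pigeonhole over the labels of \<open>w\<close> within one class of
  \<open>v\<close>.\<close>

lemma majority_label:
  fixes v :: "nat \<Rightarrow> 'a" and w :: "nat \<Rightarrow> 'm::finite"
  shows "\<exists>l'. real (cnt d v l) / real CARD('m) \<le> real (card {j. j < d \<and> v j = l \<and> w j = l'})"
proof (rule ccontr)
  assume "\<not> ?thesis"
  then have "\<And>l'. real (card {j. j < d \<and> v j = l \<and> w j = l'}) < real (cnt d v l) / real CARD('m)"
    by (auto simp: not_le)
  then have "(\<Sum>l'\<in>UNIV. real (card {j. j < d \<and> v j = l \<and> w j = l'}))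
      < (\<Sum>l'\<in>(UNIV::'m set). real (cnt d v l) / real CARD('m))"
    by (intro sum_strict_mono) auto
  also have "\<dots> = real (cnt d v l)" by simp
  also have "\<dots> = (\<Sum>l'\<in>UNIV. real (card {j. j < d \<and> v j = l \<and> w j = l'}))"
  proof -
    have "(\<Sum>l'\<in>UNIV. \<Sum>j\<in>{j\<in>{j. j < d \<and> v j = l}. w j = l'}. 1) = (\<Sum>j\<in>{j. j < d \<and> v j = l}. 1::real)"
      by (intro sum.group) auto
    then show ?thesis by (simp add: cnt_def conj_assoc)
  qed
  finally show False by simp
qed

text \<open>Each column label \<open>l\<close> of \<open>v\<close> is matched with its majority label \<open>t l\<close> under \<open>w\<close>. A row \<open>i\<close>
  then fits well only if the row of \<open>a\<close> attached to \<open>z i\<close> is close to the row of \<open>A\<close> attached to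
  \<open>y i\<close>; as the rows of \<open>A\<close> are separated, this forces \<open>z i = s (y i)\<close> for a fixed \<open>s\<close>.\<close>
lemma row_separation:
  fixes z y :: "nat \<Rightarrow> 'g::finite" and w v :: "nat \<Rightarrow> 'm::finite" and a A :: "'g \<Rightarrow> 'm \<Rightarrow> real"
  assumes \<gamma>: "0 \<le> \<gamma>" "\<gamma> \<le> 1"
    and cz: "\<And>k. \<gamma> * real n \<le> real (cnt n y k)" and cw: "\<And>l. \<gamma> * real d \<le> real (cnt d v l)"
    and \<Delta>: "\<Delta> > 0" "\<And>k k'. k \<noteq> k' \<Longrightarrow> \<Delta> \<le> (\<Sum>l\<in>UNIV. (A k l - A k' l)\<^sup>2)"
  shows "\<gamma> * real d / real CARD('m) * (\<Delta> / 4 * (\<gamma> * real (hmin n y z)))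
    \<le> (\<Sum>i<n. \<Sum>j<d. (a (z i) (w j) - A (y i) (v j))\<^sup>2)"
proof -
  obtain t where t: "\<And>l. real (cnt d v l) / real CARD('m) \<le> real (card {j. j < d \<and> v j = l \<and> w j = t l})"
    using majority_label[of d v _ w] by metis
  \<comment> \<open>\<open>D k' k\<close> compares row \<open>k'\<close> of \<open>a\<close>, read
    through the matching \<open>t\<close>, with row \<open>k\<close> of \<open>A\<close>.\<close>
  define D where "D = (\<lambda>k' k. \<Sum>l\<in>UNIV. (a k' (t l) - A k l)\<^sup>2)"
  have row: "\<gamma> * real d / real CARD('m) * D (z i) (y i) \<le> (\<Sum>j<d. (a (z i) (w j) - A (y i) (v j))\<^sup>2)" for i
  proof -
    have "\<gamma> * real d / real CARD('m) * D (z i) (y i)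
        \<le> (\<Sum>l\<in>UNIV. real (card {j. j < d \<and> v j = l \<and> w j = t l}) * (a (z i) (t l) - A (y i) l)\<^sup>2)"
      unfolding D_def sum_distrib_left
    proof (intro sum_mono mult_right_mono)
      fix l
      have "\<gamma> * real d / real CARD('m) \<le> real (cnt d v l) / real CARD('m)"
        by (intro divide_right_mono cw) simp
      also note t
      finally show "\<gamma> * real d / real CARD('m) \<le> real (card {j. j < d \<and> v j = l \<and> w j = t l})" .
    qed simp
    also have "\<dots> = (\<Sum>l\<in>UNIV. \<Sum>j\<in>{j. j < d \<and> v j = l \<and> w j = t l}. (a (z i) (w j) - A (y i) (v j))\<^sup>2)"
      by (intro sum.cong refl) (simp add: sum.cong)
    also have "\<dots> \<le> (\<Sum>l\<in>UNIV. \<Sum>j\<in>{j\<in>{..<d}. v j = l}. (a (z i) (w j) - A (y i) (v j))\<^sup>2)"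
      by (intro sum_mono sum_mono2) auto
    also have "\<dots> = (\<Sum>j<d. (a (z i) (w j) - A (y i) (v j))\<^sup>2)"
      by (intro sum.group) auto
    finally show ?thesis .
  qed
  define Bad where "Bad = {i. i < n \<and> \<Delta> / 4 \<le> D (z i) (y i)}"
  \<comment> \<open>A row of \<open>a\<close> cannot be near two rows of \<open>A\<close>: since
    \<open>(u - v)^2 \<le> 2 * u^2 + 2 * v^2\<close>, the threshold \<open>\<Delta> / 4\<close>
    would put those two rows closer than \<open>\<Delta>\<close>.\<close>
  have unique: "k = k2" if "D k' k < \<Delta> / 4" "D k' k2 < \<Delta> / 4" for k' k k2
  proof (rule ccontr)
    assume "k \<noteq> k2"
    have "(\<Sum>l\<in>UNIV. (A k l - A k2 l)\<^sup>2) \<le> (\<Sum>l\<in>UNIV. 2 * (a k' (t l) - A k l)\<^sup>2 + 2 * (a k' (t l) - A k2 l)\<^sup>2)"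
    proof (intro sum_mono)
      fix l
      have "0 \<le> ((a k' (t l) - A k l) + (a k' (t l) - A k2 l))\<^sup>2" by simp
      then show "(A k l - A k2 l)\<^sup>2 \<le> 2 * (a k' (t l) - A k l)\<^sup>2 + 2 * (a k' (t l) - A k2 l)\<^sup>2"
        by (simp add: power2_eq_square algebra_simps)
    qed
    also have "\<dots> = 2 * D k' k + 2 * D k' k2" by (simp add: D_def sum.distrib sum_distrib_left)
    also have "\<dots> < \<Delta>" using that by simp
    finally show False using \<Delta>(2)[OF \<open>k \<noteq> k2\<close>] by simp
  qed
  have "\<gamma> * real (hmin n y z) \<le> real (card Bad)"
  \<comment> \<open>If at least a proportion \<open>\<gamma>\<close> of the rows is bad,
    \<open>hmin n y z \<le> n\<close> is enough. Otherwise no class of \<open>y\<close> can consist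
    of bad rows only, so every label \<open>k\<close> finds a row of \<open>a\<close> close to it,
    and this defines \<open>s\<close>.\<close>
  proof (cases "\<gamma> * real n \<le> real (card Bad)")
    case True
    have "hmin n y z \<le> n" using hmin_le[of id n y z] ham_le[of n z "id \<circ> y"] by simp
    then have "\<gamma> * real (hmin n y z) \<le> \<gamma> * real n" using \<gamma> by (intro mult_left_mono) auto
    then show ?thesis using True by simp
  next
    case False
    have "\<exists>k'. D k' k < \<Delta> / 4" for k
    proof (rule ccontr)
      assume no: "\<nexists>k'. D k' k < \<Delta> / 4"
      have "cnt n y k \<le> card Bad"
        unfolding cnt_def Bad_def using no by (intro card_mono) (auto simp: not_less)
      then have "\<gamma> * real n \<le> real (card Bad)" using cz[of k] by linarith
      then show False using False by simp
    qed
    then obtain s where s: "\<And>k. D (s k) k < \<Delta> / 4" by metis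
    have "inj s" using unique s by (metis injI)
    then have "bij s" using finite_UNIV_inj_surj[of s] by (auto simp: bij_def)
    have "ham n z (s \<circ> y) \<le> card Bad"
      unfolding ham_def
    proof (intro card_mono subsetI)
      fix i assume i: "i \<in> {i. i < n \<and> z i \<noteq> (s \<circ> y) i}"
      show "i \<in> Bad"
      proof (rule ccontr)
        assume "i \<notin> Bad"
        then have "D (z i) (y i) < \<Delta> / 4" using i by (auto simp: Bad_def)
        moreover obtain k where "z i = s k" using \<open>bij s\<close> by (metis bij_pointE)
        ultimately have "k = y i" using unique s by metis
        then show False using i \<open>z i = s k\<close> by auto
      qed
    qed (auto simp: Bad_def)
    then have "hmin n y z \<le> card Bad" using hmin_le[OF \<open>bij s\<close>] order_trans by blast
    then have "\<gamma> * real (hmin n y z) \<le> 1 * real (card Bad)"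
      using \<gamma> by (intro mult_mono) auto
    then show ?thesis by simp
  qed
  then have "\<Delta> / 4 * (\<gamma> * real (hmin n y z)) \<le> \<Delta> / 4 * real (card Bad)"
    using \<Delta> by (intro mult_left_mono) auto
  also have "\<dots> = (\<Sum>i\<in>Bad. \<Delta> / 4)" by simp
  also have "\<dots> \<le> (\<Sum>i\<in>Bad. D (z i) (y i))" by (intro sum_mono) (auto simp: Bad_def)
  also have "\<dots> \<le> (\<Sum>i<n. D (z i) (y i))"
    by (intro sum_mono2) (auto simp: Bad_def D_def intro: sum_nonneg)
  finally have "\<Delta> / 4 * (\<gamma> * real (hmin n y z)) \<le> (\<Sum>i<n. D (z i) (y i))" .
  then have "\<gamma> * real d / real CARD('m) * (\<Delta> / 4 * (\<gamma> * real (hmin n y z)))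
      \<le> \<gamma> * real d / real CARD('m) * (\<Sum>i<n. D (z i) (y i))"
    using \<gamma> by (intro mult_left_mono) auto
  also have "\<dots> \<le> (\<Sum>i<n. \<Sum>j<d. (a (z i) (w j) - A (y i) (v j))\<^sup>2)"
    unfolding sum_distrib_left by (intro sum_mono row)
  finally show ?thesis .
qed

text \<open>Row separation is applied to the matrices and to their transposes, with the roles of the
  two assignments exchanged. Averaging the two bounds costs the factor 2 that turns 4 into 8. The
  constant does not involve \<open>a\<close>, so the separation is uniform over all competing
  matrices.\<close>

lemma block_separation:
  fixes z y :: "nat \<Rightarrow> 'g::finite" and w v :: "nat \<Rightarrow> 'm::finite" and a A :: "'g \<Rightarrow> 'm \<Rightarrow> real"
  assumes \<gamma>: "0 \<le> \<gamma>" "\<gamma> \<le> 1"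
    and cz: "\<And>k. \<gamma> * real n \<le> real (cnt n y k)" and cw: "\<And>l. \<gamma> * real d \<le> real (cnt d v l)"
    and \<Delta>: "\<Delta> > 0" "\<And>k k'. k \<noteq> k' \<Longrightarrow> \<Delta> \<le> (\<Sum>l\<in>UNIV. (A k l - A k' l)\<^sup>2)"
      "\<And>l l'. l \<noteq> l' \<Longrightarrow> \<Delta> \<le> (\<Sum>k\<in>UNIV. (A k l - A k l')\<^sup>2)"
  shows "\<gamma>\<^sup>2 * \<Delta> / (8 * real CARD('g) * real CARD('m)) * (real d * hmin n y z + real n * hmin d v w)
    \<le> (\<Sum>i<n. \<Sum>j<d. (a (z i) (w j) - A (y i) (v j))\<^sup>2)" (is "?c * _ \<le> ?S")
proof -
  have g: "real CARD('g) \<ge> 1" "real CARD('m) \<ge> 1"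
    using card_gt_0_iff[of "UNIV::'g set"] card_gt_0_iff[of "UNIV::'m set"] by (auto simp: Suc_le_eq)
  have le: "2 * ?c * (real e * real h) \<le> \<gamma> * real e / K * (\<Delta> / 4 * (\<gamma> * real h))"
    if "K \<ge> 1" "K * K' = real CARD('g) * real CARD('m)" "K' \<ge> 1" for K K' and e h :: nat
  proof -
    have "2 * ?c * (real e * real h) = (\<gamma> * real e / K * (\<Delta> / 4 * (\<gamma> * real h))) / K'"
      unfolding mult.assoc that(2)[symmetric] by (simp add: power2_eq_square mult_ac)
    also have "\<dots> \<le> (\<gamma> * real e / K * (\<Delta> / 4 * (\<gamma> * real h))) / 1"
      using that \<gamma> \<Delta> by (intro divide_left_mono) auto
    finally show ?thesis by simp
  qed
  have h1: "2 * ?c * (real d * hmin n y z) \<le> ?S"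
    using order_trans[OF le[of "real CARD('m)" "real CARD('g)"] row_separation[OF \<gamma> cz cw \<Delta>(1,2)]] g
    by (simp add: mult.commute)
  have h2: "2 * ?c * (real n * hmin d v w) \<le> (\<Sum>j<d. \<Sum>i<n. (a (z i) (w j) - A (y i) (v j))\<^sup>2)"
    using order_trans[OF le[of "real CARD('g)" "real CARD('m)"]
        row_separation[where A = "\<lambda>l k. A k l" and a = "\<lambda>l k. a k l", OF \<gamma> cw cz \<Delta>(1) \<Delta>(3)]] g
    by simp
  have swap: "(\<Sum>j<d. \<Sum>i<n. (a (z i) (w j) - A (y i) (v j))\<^sup>2) = ?S" by (rule sum.swap)
  have avg: "C * (X + Y) \<le> S" if "2 * C * X \<le> S" "2 * C * Y \<le> S" for C X Y S :: real
    using that by (simp add: algebra_simps)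
  show ?thesis by (rule avg[OF h1 h2[unfolded swap]])
qed

text \<open>All probabilities lie between \<open>c\<close> and 1, so an index with a changed label
  costs a factor of at most \<open>1 / c\<close>.\<close>

lemma prod_le_relabel:
  fixes p :: "'a::finite \<Rightarrow> real"
  assumes c: "c > 0" "\<And>k. c \<le> p k" "\<And>k. p k \<le> 1"
  shows "(\<Prod>i<n. p (z i)) \<le> (1 / c) ^ ham n z y * (\<Prod>i<n. p (y i))"
proof -
  have p0: "0 \<le> p k" for k using c(1) c(2)[of k] by linarith
  have "(\<Prod>i<n. p (z i)) \<le> (\<Prod>i<n. (if z i \<noteq> y i then 1 / c else 1) * p (y i))"
  proof (intro prod_mono conjI)
    fix i
    show "p (z i) \<le> (if z i \<noteq> y i then 1 / c else 1) * p (y i)"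
      using c(1) c(2)[of "y i"] c(3)[of "z i"] by (auto simp: field_simps intro: order_trans mult_left_le)
        (smt (verit) mult_left_le)
  qed (rule p0)
  then show ?thesis by (simp add: prod.distrib power_ham_prod)
qed

text \<open>The Kullback--Leibler divergence is bounded below by the squared Hellinger distance,
  using only \<open>u \<le> exp (u - 1)\<close>.\<close>
lemma prod_le_empirical:
  fixes p :: "'a::finite \<Rightarrow> real" and y :: "nat \<Rightarrow> 'a"
  assumes p: "\<And>k. 0 \<le> p k" "(\<Sum>k\<in>UNIV. p k) = 1" and n: "n > 0"
  defines "q \<equiv> \<lambda>k. real (cnt n y k) / real n"
  shows "(\<Prod>i<n. p (y i)) \<le> (\<Prod>i<n. q (y i)) * exp (- real n / 4 * (\<Sum>k\<in>UNIV. (p k - q k)\<^sup>2))"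
proof -
  have q0: "q k \<ge> 0" for k by (simp add: q_def)
  have qs: "(\<Sum>k\<in>UNIV. q k) = 1"
    using sum_cnt[of "\<lambda>_. 1" y n] n by (simp add: q_def sum_divide_distrib[symmetric])
  have q1: "q k \<le> 1" for k using qs member_le_sum[of k UNIV q] q0 by simp
  have p1: "p k \<le> 1" for k using p member_le_sum[of k UNIV p] by simp
  have qpos: "q (y i) > 0" if "i < n" for i
    using that n by (auto simp: q_def cnt_def card_gt_0_iff intro!: divide_pos_pos)
  have "(\<Prod>i<n. sqrt (p (y i) / q (y i))) \<le> (\<Prod>i<n. exp (sqrt (p (y i) / q (y i)) - 1))"
  proof (intro prod_mono conjI)
    fix i
    show "sqrt (p (y i) / q (y i)) \<le> exp (sqrt (p (y i) / q (y i)) - 1)"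
      using exp_ge_add_one_self[of "sqrt (p (y i) / q (y i)) - 1"] by simp
  qed (simp add: p q0)
  also have "\<dots> = exp (\<Sum>i<n. sqrt (p (y i) / q (y i)) - 1)" by (simp add: exp_sum)
  also have "(\<Sum>i<n. sqrt (p (y i) / q (y i)) - 1) = (\<Sum>k\<in>UNIV. real (cnt n y k) * (sqrt (p k / q k) - 1))"
    by (rule sum_cnt[where f = "\<lambda>k. sqrt (p k / q k) - 1"])
  \<comment> \<open>After grouping by label, \<open>q * sqrt (p / q)\<close> becomes
    \<open>sqrt p * sqrt q\<close>, also for a label that does not occur (\<open>q = 0\<close>,
    where division by zero yields 0). The terms \<open>p k - q k\<close> will sum to 0 because both
    vectors have total mass 1.\<close>
  also have "\<dots> = (\<Sum>k\<in>UNIV. - real n / 2 * (sqrt (p k) - sqrt (q k))\<^sup>2 + real n / 2 * (p k - q k))"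
  proof (intro sum.cong refl)
    fix k
    have e: "real (cnt n y k) = real n * q k" using n by (simp add: q_def)
    have f: "q k * sqrt (p k / q k) = sqrt (p k) * sqrt (q k)"
      using q0[of k] by (cases "q k = 0") (auto simp: real_sqrt_divide field_simps)
    show "real (cnt n y k) * (sqrt (p k / q k) - 1)
        = - real n / 2 * (sqrt (p k) - sqrt (q k))\<^sup>2 + real n / 2 * (p k - q k)"
      unfolding e using f p(1)[of k] q0[of k]
      by (simp add: power2_diff algebra_simps) (simp add: field_simps)
  qed
  also have "\<dots> = - real n / 2 * (\<Sum>k\<in>UNIV. (sqrt (p k) - sqrt (q k))\<^sup>2)"
    by (simp only: sum.distrib sum_distrib_left[symmetric] sum_subtractf p qs) simp
  \<comment> \<open>The difference \<open>p - q\<close> factors through the square roots, whose sum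
    is at most 2; this gives the quarter. Squaring at the end doubles the resulting
    \<open>n / 8\<close> to \<open>n / 4\<close>.\<close>
  also have "\<dots> \<le> - real n / 2 * (\<Sum>k\<in>UNIV. (p k - q k)\<^sup>2 / 4)"
  proof (intro mult_left_mono_neg sum_mono)
    fix k
    have "p k - q k = (sqrt (p k) - sqrt (q k)) * (sqrt (p k) + sqrt (q k))"
      using p(1)[of k] q0[of k] by (simp add: algebra_simps)
    then have "(p k - q k)\<^sup>2 = (sqrt (p k) - sqrt (q k))\<^sup>2 * (sqrt (p k) + sqrt (q k))\<^sup>2"
      by (simp add: power_mult_distrib)
    also have "\<dots> \<le> (sqrt (p k) - sqrt (q k))\<^sup>2 * 2\<^sup>2"
      using p(1)[of k] q0[of k] p1[of k] q1[of k] real_sqrt_le_1_iff[of "p k"] real_sqrt_le_1_iff[of "q k"]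
      by (intro mult_left_mono power_mono) (auto simp del: real_sqrt_le_1_iff)
    finally show "(p k - q k)\<^sup>2 / 4 \<le> (sqrt (p k) - sqrt (q k))\<^sup>2" by simp
  qed simp
  also have "\<dots> = - real n / 8 * (\<Sum>k\<in>UNIV. (p k - q k)\<^sup>2)" by (simp add: sum_divide_distrib[symmetric])
  finally have "(\<Prod>i<n. sqrt (p (y i) / q (y i))) \<le> exp (- real n / 8 * (\<Sum>k\<in>UNIV. (p k - q k)\<^sup>2))"
    by simp
  then have "(\<Prod>i<n. sqrt (p (y i) / q (y i)))\<^sup>2 \<le> (exp (- real n / 8 * (\<Sum>k\<in>UNIV. (p k - q k)\<^sup>2)))\<^sup>2"
    by (intro power_mono prod_nonneg) (auto simp: p q0)
  moreover have "(\<Prod>i<n. sqrt (p (y i) / q (y i)))\<^sup>2 = (\<Prod>i<n. p (y i)) / (\<Prod>i<n. q (y i))"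
    by (simp add: prod_power_distrib p q0 flip: prod_dividef)
  moreover have "(exp (- real n / 8 * (\<Sum>k\<in>UNIV. (p k - q k)\<^sup>2)))\<^sup>2
      = exp (- real n / 4 * (\<Sum>k\<in>UNIV. (p k - q k)\<^sup>2))"
    by (simp add: exp_of_nat_mult[symmetric])
  moreover have "(\<Prod>i<n. q (y i)) > 0" by (intro prod_pos) (auto simp: qpos)
  ultimately show ?thesis by (simp add: field_simps)
qed

section \<open>Comparison of the observed with the complete likelihood\<close>

text \<open>The term of the minimising pair of permutations is bounded by a sum over all pairs,
  which turns the sum into products of two Hamming generating functions. Subtracting the terms with
  base 0 removes the relabelling itself: it produces the \<open>- 1\<close> without which the bound
  would not tend to 0.\<close>

lemma nonorbit_sum_le:
  fixes y :: "nat \<Rightarrow> 'g::finite" and v :: "nat \<Rightarrow> 'm::finite" and q1 q2 :: real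
  assumes q: "q1 \<ge> 0" "q2 \<ge> 0"
  shows "(\<Sum>z\<in>{..<n} \<rightarrow>\<^sub>E UNIV. \<Sum>w\<in>{..<d} \<rightarrow>\<^sub>E UNIV.
      if hmin n y z + hmin d v w > 0 then q1 ^ hmin n y z * q2 ^ hmin d v w else 0)
    \<le> real (card {s::'g\<Rightarrow>'g. bij s}) * real (card {t::'m\<Rightarrow>'m. bij t}) *
      (exp (real n * (real CARD('g) * q1) + real d * (real CARD('m) * q2)) - 1)"
proof -
  let ?Z = "{..<n} \<rightarrow>\<^sub>E (UNIV::'g set)" and ?W = "{..<d} \<rightarrow>\<^sub>E (UNIV::'m set)"
  let ?S = "{s::'g\<Rightarrow>'g. bij s}" and ?T = "{t::'m\<Rightarrow>'m. bij t}"
  define D :: "('g \<Rightarrow> 'g) \<Rightarrow> ('m \<Rightarrow> 'm) \<Rightarrow> (nat \<Rightarrow> 'g) \<Rightarrow> (nat \<Rightarrow> 'm) \<Rightarrow> real"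
    where "D = (\<lambda>s t z w. q1 ^ ham n z (s \<circ> y) * q2 ^ ham d w (t \<circ> v)
      - 0 ^ ham n z (s \<circ> y) * 0 ^ ham d w (t \<circ> v))"
  have D0: "D s t z w \<ge> 0" for s t z w
  proof -
    have "(0::real) ^ h \<le> q ^ h" if "q \<ge> 0" for q and h :: nat
      using that by (intro power_mono) auto
    then show ?thesis unfolding D_def using q by (simp add: mult_mono)
  qed
  have each: "(if hmin n y z + hmin d v w > 0 then q1 ^ hmin n y z * q2 ^ hmin d v w else 0)
      \<le> (\<Sum>s\<in>?S. \<Sum>t\<in>?T. D s t z w)" for z w
  proof (cases "hmin n y z + hmin d v w > 0")
    case True
    obtain s where s: "bij s" "hmin n y z = ham n z (s \<circ> y)" by (rule hmin_attained)
    obtain t where t: "bij t" "hmin d v w = ham d w (t \<circ> v)" by (rule hmin_attained)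
    have "q1 ^ hmin n y z * q2 ^ hmin d v w = D s t z w"
      using True unfolding D_def s t by (auto simp: power_0_left)
    also have "\<dots> \<le> (\<Sum>t\<in>?T. D s t z w)"
      using t D0 by (intro member_le_sum) auto
    also have "\<dots> \<le> (\<Sum>s\<in>?S. \<Sum>t\<in>?T. D s t z w)"
      using s D0 by (intro member_le_sum[where f = "\<lambda>s. \<Sum>t\<in>?T. D s t z w"] sum_nonneg) auto
    finally show ?thesis using True by simp
  qed (use D0 in \<open>simp add: sum_nonneg\<close>)
  have inner: "(\<Sum>z\<in>?Z. \<Sum>w\<in>?W. D s t z w)
      \<le> exp (real n * (real CARD('g) * q1) + real d * (real CARD('m) * q2)) - 1" for s t
  proof -
    have pw: "(1 + (real k - 1) * q) ^ e \<le> exp (real e * (real k * q))" if "q \<ge> 0" "k \<ge> 1" for k e q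
    proof -
      have "1 + (real k - 1) * q \<le> 1 + real k * q" using that by (simp add: algebra_simps)
      also have "\<dots> \<le> exp (real k * q)" by (rule exp_ge_add_one_self)
      finally have "(1 + (real k - 1) * q) ^ e \<le> exp (real k * q) ^ e"
        using that by (intro power_mono) auto
      then show ?thesis by (simp add: exp_of_nat_mult)
    qed
    have "(\<Sum>z\<in>?Z. \<Sum>w\<in>?W. D s t z w)
        = (\<Sum>z\<in>?Z. q1 ^ ham n z (s \<circ> y)) * (\<Sum>w\<in>?W. q2 ^ ham d w (t \<circ> v))
          - (\<Sum>z\<in>?Z. 0 ^ ham n z (s \<circ> y)) * (\<Sum>w\<in>?W. 0 ^ ham d w (t \<circ> v))"
      unfolding D_def sum_subtractf sum_product ..
    also have "\<dots> = (1 + (real CARD('g) - 1) * q1) ^ n * (1 + (real CARD('m) - 1) * q2) ^ d - 1"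
      by (simp add: sum_power_ham_PiE)
    also have "\<dots> \<le> exp (real n * (real CARD('g) * q1)) * exp (real d * (real CARD('m) * q2)) - 1"
      using q card_gt_0_iff[of "UNIV::'g set"] card_gt_0_iff[of "UNIV::'m set"]
      by (intro diff_mono mult_mono pw zero_le_power add_nonneg_nonneg mult_nonneg_nonneg)
        (auto simp: Suc_le_eq)
    finally show ?thesis by (simp add: exp_add)
  qed
  have "(\<Sum>z\<in>?Z. \<Sum>w\<in>?W.
      if hmin n y z + hmin d v w > 0 then q1 ^ hmin n y z * q2 ^ hmin d v w else 0)
    \<le> (\<Sum>z\<in>?Z. \<Sum>w\<in>?W. \<Sum>s\<in>?S. \<Sum>t\<in>?T. D s t z w)"
    by (intro sum_mono each)
  also have "\<dots> = (\<Sum>s\<in>?S. \<Sum>t\<in>?T. \<Sum>z\<in>?Z. \<Sum>w\<in>?W. D s t z w)"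
    unfolding sum.swap[of _ ?S ?W] sum.swap[of _ ?T ?W] sum.swap[of _ ?S ?Z] sum.swap[of _ ?T ?Z] ..
  also have "\<dots> \<le> (\<Sum>s\<in>?S. \<Sum>t\<in>?T. exp (real n * (real CARD('g) * q1) + real d * (real CARD('m) * q2)) - 1)"
    by (intro sum_mono inner)
  finally show ?thesis by (simp add: mult.assoc)
qed

lemma sum_power2_le_power2_sum:
  fixes f :: "'a \<Rightarrow> real"
  assumes "\<And>x. x \<in> S \<Longrightarrow> f x \<ge> 0" "finite S"
  shows "(\<Sum>x\<in>S. (f x)\<^sup>2) \<le> (\<Sum>x\<in>S. f x)\<^sup>2"
proof -
  have "(\<Sum>x\<in>S. (f x)\<^sup>2) \<le> (\<Sum>x\<in>S. f x * (\<Sum>x\<in>S. f x))"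
    unfolding power2_eq_square using assms by (intro sum_mono mult_left_mono member_le_sum) auto
  then show ?thesis by (simp add: power2_eq_square sum_distrib_right)
qed

lemma prop_hat_cnt: "prop_hat n z $ k = real (cnt n z k) / real n"
proof -
  have "(\<Sum>i<n. of_bool (z i = k)) = real (cnt n z k)"
    unfolding cnt_def by (simp add: of_bool_def sum.If_cases Int_def)
  then show ?thesis by (simp add: prop_hat_def)
qed

context exp_family begin

text \<open>The logarithm of the conditional likelihood given the labels, without the factor
  \<open>base\<close>, which involves neither labels nor parameter and cancels from every
  ratio.\<close>

definition energy :: "nat \<Rightarrow> nat \<Rightarrow> (nat \<times> nat \<Rightarrow> real) \<Rightarrow> real ^ 'm ^ 'g
    \<Rightarrow> (nat \<Rightarrow> 'g::finite) \<Rightarrow> (nat \<Rightarrow> 'm::finite) \<Rightarrow> real" where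
  "energy n d x a z w = (\<Sum>i<n. \<Sum>j<d. x (i, j) * a $ z i $ w j - \<psi> (a $ z i $ w j))"

definition base :: "nat \<Rightarrow> nat \<Rightarrow> (nat \<times> nat \<Rightarrow> real) \<Rightarrow> real" where
  "base n d x = (\<Prod>i<n. \<Prod>j<d. b (x (i, j)))"

lemma base_nonneg: "base n d x \<ge> 0"
  unfolding base_def by (intro prod_nonneg) auto

lemma complete_likelihood_eq:
  "complete_likelihood \<nu> b n d (p, r, a) x z w =
     base n d x * ((\<Prod>i<n. p $ z i) * (\<Prod>j<d. r $ w j) * exp (energy n d x a z w))"
  unfolding complete_likelihood_def energy_def base_def phi_def
  by (simp add: prod.distrib exp_sum mult_ac)

lemma complete_likelihood_perm:
  assumes "ham n z (s \<circ> y) = 0" "ham d w (t \<circ> v) = 0"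
  shows "complete_likelihood \<nu> b n d (p, r, a) x z w
    = complete_likelihood \<nu> b n d (perm_param s t (p, r, a)) x y v"
  using assms unfolding ham_0_iff complete_likelihood_def perm_param_def
  by (simp add: perm_vec_def perm_mat_def)

text \<open>The price of moving \<open>\<alpha>\<close> to a grid point. It involves the data only
  through the sum of absolute values, which \<open>abs_sum_tail\<close> controls with high
  probability.\<close>

lemma energy_lipschitz:
  assumes "\<And>x y. x \<in> {a0..b0} \<Longrightarrow> y \<in> {a0..b0} \<Longrightarrow> \<bar>\<psi> x - \<psi> y\<bar> \<le> L * \<bar>x - y\<bar>"
    and "\<And>k l. a $ k $ l \<in> {a0..b0}" "\<And>k l. a' $ k $ l \<in> {a0..b0}"
    and "\<And>k l. \<bar>a $ k $ l - a' $ k $ l\<bar> \<le> \<tau>" and "L \<ge> 0"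
  shows "energy n d x a z w \<le> energy n d x a' z w
    + \<tau> * ((\<Sum>i<n. \<Sum>j<d. \<bar>x (i, j)\<bar>) + L * (real n * real d))"
proof -
  have "energy n d x a z w \<le> (\<Sum>i<n. \<Sum>j<d.
      (x (i, j) * a' $ z i $ w j - \<psi> (a' $ z i $ w j)) + \<tau> * (\<bar>x (i, j)\<bar> + L))"
    unfolding energy_def
  proof (intro sum_mono)
    fix i j
    let ?u = "a $ z i $ w j" and ?u' = "a' $ z i $ w j"
    have "x (i, j) * (?u - ?u') \<le> \<bar>x (i, j)\<bar> * \<bar>?u - ?u'\<bar>"
      by (metis abs_ge_self abs_mult)
    also have "\<dots> \<le> \<bar>x (i, j)\<bar> * \<tau>" by (intro mult_left_mono assms) auto
    finally have 1: "x (i, j) * (?u - ?u') \<le> \<bar>x (i, j)\<bar> * \<tau>" .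
    have "\<bar>\<psi> ?u' - \<psi> ?u\<bar> \<le> L * \<bar>?u' - ?u\<bar>" by (intro assms)
    also have "\<dots> \<le> L * \<tau>"
      using assms(4)[of "z i" "w j"] assms(5) by (intro mult_left_mono) (auto simp: abs_minus_commute)
    finally show "x (i, j) * ?u - \<psi> ?u \<le> x (i, j) * ?u' - \<psi> ?u' + \<tau> * (\<bar>x (i, j)\<bar> + L)"
      using 1 by (simp add: algebra_simps)
  qed
  also have "\<dots> = energy n d x a' z w + \<tau> * ((\<Sum>i<n. \<Sum>j<d. \<bar>x (i, j)\<bar>) + L * (real n * real d))"
    unfolding energy_def by (simp only: sum.distrib sum_distrib_left[symmetric]) simp
  finally show ?thesis .
qed

text \<open>The square root of a likelihood ratio has an exponentially small mean, a product of
  Bhattacharyya coefficients, whereas the mean of the ratio itself is 1. The factor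
  \<open>sqrt (1 / c)\<close> per relabelled index pays for the label probabilities.\<close>
definition sqrt_ratio_sum :: "nat \<Rightarrow> nat \<Rightarrow> real \<Rightarrow> (nat \<Rightarrow> 'g::finite) \<Rightarrow> (nat \<Rightarrow> 'm::finite)
    \<Rightarrow> real ^ 'm ^ 'g \<Rightarrow> real ^ 'm ^ 'g \<Rightarrow> (nat \<times> nat \<Rightarrow> real) \<Rightarrow> real" where
  "sqrt_ratio_sum n d c y v A a x =
    (\<Sum>z\<in>{..<n} \<rightarrow>\<^sub>E UNIV. \<Sum>w\<in>{..<d} \<rightarrow>\<^sub>E UNIV. if hmin n y z + hmin d v w > 0
      then sqrt (1 / c) ^ (hmin n y z + hmin d v w)
        * exp ((energy n d x a z w - energy n d x A y v) / 2) else 0)"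

text \<open>Assignments that are relabellings of \<open>(y, v)\<close> contribute complete
  likelihoods of relabelled parameters. For all others, the label probabilities are replaced by the
  empirical ones and \<open>a\<close> by \<open>a'\<close>, which leaves a squared summand of
  \<open>sqrt_ratio_sum\<close>. The sum of squares is at most the square of the sum, so a
  first-moment bound on \<open>sqrt_ratio_sum\<close> will suffice.\<close>

lemma observed_likelihood_le:
  fixes y :: "nat \<Rightarrow> 'g::finite" and v :: "nat \<Rightarrow> 'm::finite" and a a' A :: "real ^ 'm ^ 'g"
  assumes lip: "\<And>x y. x \<in> {a0..b0} \<Longrightarrow> y \<in> {a0..b0} \<Longrightarrow> \<bar>\<psi> x - \<psi> y\<bar> \<le> L * \<bar>x - y\<bar>" "L \<ge> 0"
    and a: "\<And>k l. a $ k $ l \<in> {a0..b0}" "\<And>k l. a' $ k $ l \<in> {a0..b0}"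
      "\<And>k l. \<bar>a $ k $ l - a' $ k $ l\<bar> \<le> \<tau>"
    and c: "c > 0" and pv: "prob_vector p" "\<And>k. c \<le> p $ k" and rv: "prob_vector r" "\<And>l. c \<le> r $ l"
    and nd: "n > 0" "d > 0"
  shows "observed_likelihood \<nu> b n d (p, r, a) x \<le>
    (\<Sum>s | bij s. \<Sum>t | bij t. complete_likelihood \<nu> b n d (perm_param s t (p, r, a)) x y v)
    + complete_likelihood \<nu> b n d (prop_hat n y, prop_hat d v, A) x y v
      * (exp (\<tau> * ((\<Sum>i<n. \<Sum>j<d. \<bar>x (i, j)\<bar>) + L * (real n * real d)))
      * (sqrt_ratio_sum n d c y v A a' x)\<^sup>2)"
proof -
  let ?Z = "{..<n} \<rightarrow>\<^sub>E (UNIV::'g set)" and ?W = "{..<d} \<rightarrow>\<^sub>E (UNIV::'m set)"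
  let ?S = "{s::'g\<Rightarrow>'g. bij s}" and ?T = "{t::'m\<Rightarrow>'m. bij t}"
  let ?cl = "complete_likelihood \<nu> b n d"
  let ?e = "exp (\<tau> * ((\<Sum>i<n. \<Sum>j<d. \<bar>x (i, j)\<bar>) + L * (real n * real d)))"
  define P where "P = ?cl (prop_hat n y, prop_hat d v, A) x y v"
  define O1 where "O1 = (\<lambda>s t. ?cl (perm_param s t (p, r, a)) x y v)"
  define R where "R = (\<lambda>z w. if hmin n y z + hmin d v w > 0
      then sqrt (1 / c) ^ (hmin n y z + hmin d v w)
        * exp ((energy n d x a' z w - energy n d x A y v) / 2) else 0)"
  have p1: "p $ k \<le> 1" "0 \<le> p $ k" for k
    using pv(1) member_le_sum[of k UNIV "\<lambda>k. p $ k"] by (auto simp: prob_vector_def)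
  have r1: "r $ k \<le> 1" "0 \<le> r $ k" for k
    using rv(1) member_le_sum[of k UNIV "\<lambda>k. r $ k"] by (auto simp: prob_vector_def)
  have cl0: "?cl \<theta> x z w \<ge> 0" if "\<theta> = (p', r', a'')" "\<And>k. p' $ k \<ge> 0" "\<And>k. r' $ k \<ge> 0" for \<theta> z w p' r' a''
    using that base_nonneg by (auto simp: complete_likelihood_eq intro!: mult_nonneg_nonneg prod_nonneg)
  have O0: "O1 s t \<ge> 0" for s t
    unfolding O1_def perm_param_def prod.case by (rule cl0[OF refl]) (auto simp: perm_vec_def p1 r1)
  \<comment> \<open>Pass to the nearest relabelling at the price \<open>1 / c\<close> per index,
    then use that the empirical frequencies maximise the label likelihood.\<close>
  have prior: "(\<Prod>i<n. p $ z i) \<le> (1 / c) ^ hmin n y z * (\<Prod>i<n. prop_hat n y $ y i)"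
    if "c > 0" "prob_vector p" "\<And>k. c \<le> p $ k" "n > 0"
    for n and p :: "real ^ 'k::finite" and y z
  proof -
    obtain s where s: "bij s" "hmin n y z = ham n z (s \<circ> y)" by (rule hmin_attained)
    have p1: "p $ k \<le> 1" "0 \<le> p $ k" for k
      using that(2) member_le_sum[of k UNIV "\<lambda>k. p $ k"] by (auto simp: prob_vector_def)
    have "(\<Prod>i<n. p $ z i) \<le> (1 / c) ^ hmin n y z * (\<Prod>i<n. p $ ((s \<circ> y) i))"
      unfolding s by (intro prod_le_relabel that p1)
    also have "(\<Prod>i<n. p $ ((s \<circ> y) i)) = (\<Prod>i<n. (\<lambda>k. p $ s k) (y i))" by simp
    also have "\<dots> \<le> (\<Prod>i<n. real (cnt n y (y i)) / real n)
        * exp (- real n / 4 * (\<Sum>k\<in>UNIV. (p $ s k - real (cnt n y k) / real n)\<^sup>2))"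
    proof (intro prod_le_empirical \<open>n > 0\<close>)
      show "(\<Sum>k\<in>UNIV. p $ s k) = 1"
        using sum.reindex_bij_betw[OF s(1), of "\<lambda>k. p $ k"] that(2) by (simp add: prob_vector_def)
    qed (rule p1)
    also have "\<dots> \<le> (\<Prod>i<n. real (cnt n y (y i)) / real n) * 1"
      by (intro mult_left_mono prod_nonneg) (auto intro!: mult_nonneg_nonneg sum_nonneg)
    finally show ?thesis using \<open>c > 0\<close> by (simp add: prop_hat_cnt mult_left_mono)
  qed
  \<comment> \<open>The factors with base 0 are indicators that \<open>z\<close> and
    \<open>w\<close> are the relabellings by \<open>s\<close> and \<open>t\<close>.\<close>
  have each: "?cl (p, r, a) x z w \<le> (\<Sum>s\<in>?S. \<Sum>t\<in>?T. 0 ^ ham n z (s \<circ> y) * 0 ^ ham d w (t \<circ> v) * O1 s t)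
      + P * ?e * (R z w)\<^sup>2" for z w
  proof (cases "hmin n y z + hmin d v w > 0")
    case False
    obtain s where s: "bij s" "hmin n y z = ham n z (s \<circ> y)" by (rule hmin_attained)
    obtain t where t: "bij t" "hmin d v w = ham d w (t \<circ> v)" by (rule hmin_attained)
    have z: "ham n z (s \<circ> y) = 0" "ham d w (t \<circ> v) = 0" using s t False by auto
    have "?cl (p, r, a) x z w = 0 ^ ham n z (s \<circ> y) * 0 ^ ham d w (t \<circ> v) * O1 s t"
      using complete_likelihood_perm[OF z] z by (simp add: O1_def)
    also have "\<dots> \<le> (\<Sum>t\<in>?T. 0 ^ ham n z (s \<circ> y) * 0 ^ ham d w (t \<circ> v) * O1 s t)"
      using t O0 by (intro member_le_sum[where f = "\<lambda>t. 0 ^ ham n z (s \<circ> y) * 0 ^ ham d w (t \<circ> v) * O1 s t"]) auto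
    also have "\<dots> \<le> (\<Sum>s\<in>?S. \<Sum>t\<in>?T. 0 ^ ham n z (s \<circ> y) * 0 ^ ham d w (t \<circ> v) * O1 s t)"
      using s O0 by (intro member_le_sum[where
            f = "\<lambda>s. \<Sum>t\<in>?T. 0 ^ ham n z (s \<circ> y) * 0 ^ ham d w (t \<circ> v) * O1 s t"] sum_nonneg) auto
    finally show ?thesis using False by (simp add: R_def)
  next
    case True
    have Rsq: "(R z w)\<^sup>2 = (1 / c) ^ (hmin n y z + hmin d v w)
        * exp (energy n d x a' z w - energy n d x A y v)"
    proof -
      have "(sqrt (1 / c) ^ h * exp (u / 2))\<^sup>2 = (1 / c) ^ h * exp u" for h and u :: real
      proof -
        have "(sqrt (1 / c) ^ h)\<^sup>2 = ((sqrt (1 / c))\<^sup>2) ^ h"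
          by (simp only: power_mult[symmetric] mult.commute)
        moreover have "(exp (u / 2))\<^sup>2 = exp u"
          by (simp add: power2_eq_square exp_add[symmetric])
        ultimately show ?thesis using c by (simp add: power_mult_distrib del: real_sqrt_divide)
      qed
      then show ?thesis using True by (simp only: R_def if_True)
    qed
    have "?cl (p, r, a) x z w = base n d x * ((\<Prod>i<n. p $ z i) * (\<Prod>j<d. r $ w j) * exp (energy n d x a z w))"
      by (rule complete_likelihood_eq)
    also have "\<dots> \<le> base n d x * ((1 / c) ^ hmin n y z * (\<Prod>i<n. prop_hat n y $ y i)
        * ((1 / c) ^ hmin d v w * (\<Prod>j<d. prop_hat d v $ v j)) * (exp (energy n d x a' z w) * ?e))"
      using c p1 r1 energy_lipschitz[OF lip(1) a lip(2), of n d x z w]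
      by (intro mult_left_mono mult_mono prior base_nonneg pv rv nd)
        (auto simp: exp_add[symmetric] intro!: prod_nonneg mult_nonneg_nonneg simp: prop_hat_cnt)
    also have "\<dots> = P * ?e * (R z w)\<^sup>2"
      unfolding P_def complete_likelihood_eq Rsq
      by (simp add: exp_diff power_add mult_ac)
    finally have "?cl (p, r, a) x z w \<le> P * ?e * (R z w)\<^sup>2" .
    moreover have "0 \<le> (\<Sum>s\<in>?S. \<Sum>t\<in>?T. 0 ^ ham n z (s \<circ> y) * 0 ^ ham d w (t \<circ> v) * O1 s t)"
      using O0 by (intro sum_nonneg) auto
    ultimately show ?thesis by linarith
  qed
  have R0: "R z w \<ge> 0" for z w using c by (simp add: R_def)
  have "observed_likelihood \<nu> b n d (p, r, a) x \<le>
      (\<Sum>z\<in>?Z. \<Sum>w\<in>?W. (\<Sum>s\<in>?S. \<Sum>t\<in>?T. 0 ^ ham n z (s \<circ> y) * 0 ^ ham d w (t \<circ> v) * O1 s t)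
      + P * ?e * (R z w)\<^sup>2)"
    unfolding observed_likelihood_def by (intro sum_mono each)
  also have "\<dots> = (\<Sum>z\<in>?Z. \<Sum>w\<in>?W. \<Sum>s\<in>?S. \<Sum>t\<in>?T. 0 ^ ham n z (s \<circ> y) * 0 ^ ham d w (t \<circ> v) * O1 s t)
      + P * ?e * (\<Sum>z\<in>?Z. \<Sum>w\<in>?W. (R z w)\<^sup>2)"
    by (simp only: sum.distrib sum_distrib_left)
  also have "(\<Sum>z\<in>?Z. \<Sum>w\<in>?W. \<Sum>s\<in>?S. \<Sum>t\<in>?T. 0 ^ ham n z (s \<circ> y) * 0 ^ ham d w (t \<circ> v) * O1 s t)
      = (\<Sum>s\<in>?S. \<Sum>t\<in>?T. \<Sum>z\<in>?Z. \<Sum>w\<in>?W. 0 ^ ham n z (s \<circ> y) * 0 ^ ham d w (t \<circ> v) * O1 s t)"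
    unfolding sum.swap[of _ ?S ?W] sum.swap[of _ ?T ?W] sum.swap[of _ ?S ?Z] sum.swap[of _ ?T ?Z] ..
  \<comment> \<open>For each pair \<open>(s, t)\<close> the indicators select exactly one pair of
    assignments.\<close>
  also have "\<dots> = (\<Sum>s\<in>?S. \<Sum>t\<in>?T. O1 s t)"
  proof (intro sum.cong refl)
    fix s t
    have "(\<Sum>z\<in>?Z. \<Sum>w\<in>?W. 0 ^ ham n z (s \<circ> y) * 0 ^ ham d w (t \<circ> v) * O1 s t)
        = (\<Sum>z\<in>?Z. 0 ^ ham n z (s \<circ> y)) * (\<Sum>w\<in>?W. 0 ^ ham d w (t \<circ> v)) * O1 s t"
      by (subst sum_product) (simp only: sum_distrib_right)
    then show "(\<Sum>z\<in>?Z. \<Sum>w\<in>?W. 0 ^ ham n z (s \<circ> y) * 0 ^ ham d w (t \<circ> v) * O1 s t) = O1 s t"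
      by (simp add: sum_power_ham_PiE)
  qed
  also have "(\<Sum>z\<in>?Z. \<Sum>w\<in>?W. (R z w)\<^sup>2) \<le> (sqrt_ratio_sum n d c y v A a' x)\<^sup>2"
  proof -
    have "(\<Sum>z\<in>?Z. \<Sum>w\<in>?W. (R z w)\<^sup>2) \<le> (\<Sum>z\<in>?Z. (\<Sum>w\<in>?W. R z w)\<^sup>2)"
      by (intro sum_mono sum_power2_le_power2_sum R0 finite_PiE) auto
    also have "\<dots> \<le> (\<Sum>z\<in>?Z. \<Sum>w\<in>?W. R z w)\<^sup>2"
      by (intro sum_power2_le_power2_sum sum_nonneg R0 finite_PiE) auto
    finally show ?thesis by (simp add: sqrt_ratio_sum_def R_def)
  qed
  finally show ?thesis
    using cl0[OF refl, of "prop_hat n y" "prop_hat d v" A y v] unfolding P_def O1_def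
    by (simp add: prop_hat_cnt mult_left_mono mult.assoc)
qed

end

section \<open>Concentration given the assignments\<close>

lemma (in prob_space) markov_prob:
  assumes "(\<integral>\<^sup>+x. g x \<partial>M) \<le> ennreal U" "g \<in> borel_measurable M" "G \<in> sets M"
    and "\<And>x. x \<in> G \<Longrightarrow> ennreal v \<le> g x" "v > 0" "U \<ge> 0"
  shows "prob G \<le> U / v"
proof -
  have "ennreal v * emeasure M G = (\<integral>\<^sup>+x. ennreal v * indicator G x \<partial>M)"
    using assms by (simp add: nn_integral_cmult_indicator)
  also have "\<dots> \<le> (\<integral>\<^sup>+x. g x \<partial>M)"
    using assms(4) by (intro nn_integral_mono) (auto simp: indicator_def)
  also have "\<dots> \<le> ennreal U" by fact
  finally have "ennreal (v * prob G) \<le> ennreal U"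
    using assms(5) by (simp add: emeasure_eq_measure ennreal_mult)
  then have "v * prob G \<le> U" using assms(6) by (simp add: ennreal_le_iff)
  then show ?thesis using assms(5) by (simp add: field_simps)
qed

lemma component_data_space:
  "i < n \<Longrightarrow> j < d \<Longrightarrow> (\<lambda>x. x (i, j)) \<in> borel_measurable (data_space n d)"
  unfolding data_space_def by (intro measurable_component_singleton) auto

lemma double_sum_data_space:
  fixes f :: "nat \<Rightarrow> nat \<Rightarrow> real \<Rightarrow> real"
  assumes "\<And>i j. i < n \<Longrightarrow> j < d \<Longrightarrow> f i j \<in> borel_measurable (borel :: real measure)"
  shows "(\<lambda>x. \<Sum>i<n. \<Sum>j<d. f i j (x (i, j))) \<in> borel_measurable (data_space n d)"
  by (intro borel_measurable_sum measurable_compose[OF component_data_space]) (auto simp: assms)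

context exp_family begin

lemma sets_phi_law [simp, measurable_cong]: "sets (phi_law \<nu> b \<alpha>) = sets borel"
  by (simp add: phi_law_def sets_nu)

text \<open>A tilt of the law stays inside the family, so its exponential moment is a ratio of
  normalisers. Nonnegative integrals keep the later product formulas free of integrability
  conditions.\<close>

lemma nn_integral_exp_phi_law:
  assumes "\<alpha> \<in> K" "\<alpha> + \<beta> \<in> K"
  shows "(\<integral>\<^sup>+x. ennreal (exp (\<beta> * x)) \<partial>phi_law \<nu> b \<alpha>) = ennreal (exp (\<psi> (\<alpha> + \<beta>) - \<psi> \<alpha>))"
proof -
  have "(\<integral>\<^sup>+x. ennreal (exp (\<beta> * x)) \<partial>phi_law \<nu> b \<alpha>)
      = (\<integral>\<^sup>+x. ennreal (phi \<nu> b x \<alpha>) * ennreal (exp (\<beta> * x)) \<partial>\<nu>)"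
    unfolding phi_law_def by (intro nn_integral_density) measurable
  also have "\<dots> = (\<integral>\<^sup>+x. ennreal (exp (- \<psi> \<alpha>)) * ennreal (b x * exp ((\<alpha> + \<beta>) * x)) \<partial>\<nu>)"
    by (intro nn_integral_cong)
      (simp add: phi_def ennreal_mult[symmetric] phi_nonneg exp_diff exp_add exp_minus field_simps)
  also have "\<dots> = ennreal (exp (- \<psi> \<alpha>)) * (\<integral>\<^sup>+x. ennreal (b x * exp ((\<alpha> + \<beta>) * x)) \<partial>\<nu>)"
    by (intro nn_integral_cmult) measurable
  also have "(\<integral>\<^sup>+x. ennreal (b x * exp ((\<alpha> + \<beta>) * x)) \<partial>\<nu>) = ennreal (mom 0 (\<alpha> + \<beta>))"
    unfolding mom_def using K_integrable[OF assms(2)] by (subst nn_integral_eq_integral) auto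
  also have "ennreal (exp (- \<psi> \<alpha>)) * ennreal (mom 0 (\<alpha> + \<beta>)) = ennreal (exp (\<psi> (\<alpha> + \<beta>) - \<psi> \<alpha>))"
    using assms(2) by (simp add: exp_psi[symmetric] ennreal_mult[symmetric] exp_diff exp_minus field_simps)
  finally show ?thesis .
qed

lemma prob_space_phi_law:
  assumes "\<alpha> \<in> K" shows "prob_space (phi_law \<nu> b \<alpha>)"
  using nn_integral_exp_phi_law[of \<alpha> 0] assms by (intro prob_spaceI) simp

text \<open>Points with \<open>b x = 0\<close> carry no mass under the density. Hence
  \<open>base\<close> is almost surely positive, and the complete likelihood at its maximum may be
  divided by.\<close>

lemma phi_law_base_pos: "AE x in phi_law \<nu> b \<alpha>. b x > 0"
proof -
  have [measurable]: "(\<lambda>x. ennreal (phi \<nu> b x \<alpha>)) \<in> borel_measurable \<nu>" by measurable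
  show ?thesis
    unfolding phi_law_def
    by (subst AE_density) (measurable, auto simp: phi_def zero_less_mult_iff order_less_le)
qed

context
  fixes A :: "real ^ 'm::finite ^ 'g::finite"
  assumes A_K: "\<And>k l. A $ k $ l \<in> K"
begin

lemma prob_space_data_law: "prob_space (data_law_given \<nu> b n d A z w)"
  unfolding data_law_given_def by (intro prob_space_PiM prob_space_phi_law A_K)

lemma sets_data_law [measurable_cong, simp]: "sets (data_law_given \<nu> b n d A z w) = sets (data_space n d)"
  unfolding data_law_given_def data_space_def by (intro sets_PiM_cong) auto

lemma space_data_law [simp]: "space (data_law_given \<nu> b n d A z w) = space (data_space n d)"
  by (intro sets_eq_imp_space_eq) simp

lemma nn_integral_data_prod:
  assumes [measurable]: "\<And>i j. f i j \<in> borel_measurable (borel :: real measure)"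
  shows "(\<integral>\<^sup>+x. (\<Prod>i<n. \<Prod>j<d. f i j (x (i, j))) \<partial>data_law_given \<nu> b n d A z w)
    = (\<Prod>i<n. \<Prod>j<d. \<integral>\<^sup>+u. f i j u \<partial>phi_law \<nu> b (A $ z i $ w j))"
proof -
  interpret product_sigma_finite "\<lambda>ij. phi_law \<nu> b (A $ z (fst ij) $ w (snd ij))"
    unfolding product_sigma_finite_def
    using prob_space_phi_law[OF A_K] prob_space_imp_sigma_finite by blast
  have "(\<integral>\<^sup>+x. (\<Prod>ij\<in>{..<n} \<times> {..<d}. f (fst ij) (snd ij) (x ij)) \<partial>data_law_given \<nu> b n d A z w)
    = (\<Prod>ij\<in>{..<n} \<times> {..<d}. \<integral>\<^sup>+u. f (fst ij) (snd ij) u \<partial>phi_law \<nu> b (A $ z (fst ij) $ w (snd ij)))"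
    unfolding data_law_given_def by (intro product_nn_integral_prod) (simp, measurable)
  then show ?thesis by (simp add: prod.cartesian_product case_prod_beta)
qed

text \<open>One exact formula for exponentials of affine statistics serves both the Chernoff bound
  for block means and the Bhattacharyya products; \<open>\<gamma> i j\<close> carries the
  deterministic part.\<close>

lemma nn_integral_data_exp:
  assumes "\<And>i j. i < n \<Longrightarrow> j < d \<Longrightarrow> A $ z i $ w j + \<beta> i j \<in> K"
  shows "(\<integral>\<^sup>+x. ennreal (exp (\<Sum>i<n. \<Sum>j<d. \<beta> i j * x (i, j) + \<gamma> i j)) \<partial>data_law_given \<nu> b n d A z w)
    = ennreal (exp (\<Sum>i<n. \<Sum>j<d. \<psi> (A $ z i $ w j + \<beta> i j) - \<psi> (A $ z i $ w j) + \<gamma> i j))"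
proof -
  have "(\<integral>\<^sup>+x. ennreal (exp (\<Sum>i<n. \<Sum>j<d. \<beta> i j * x (i, j) + \<gamma> i j)) \<partial>data_law_given \<nu> b n d A z w)
    = (\<integral>\<^sup>+x. (\<Prod>i<n. \<Prod>j<d. ennreal (exp (\<gamma> i j)) * ennreal (exp (\<beta> i j * x (i, j)))) \<partial>data_law_given \<nu> b n d A z w)"
    by (simp add: exp_sum prod_ennreal[symmetric] prod_nonneg ennreal_mult[symmetric] exp_add mult.commute)
  also have "\<dots> = (\<Prod>i<n. \<Prod>j<d. \<integral>\<^sup>+u. ennreal (exp (\<gamma> i j)) * ennreal (exp (\<beta> i j * u)) \<partial>phi_law \<nu> b (A $ z i $ w j))"
    by (subst nn_integral_data_prod[of "\<lambda>i j u. ennreal (exp (\<gamma> i j)) * ennreal (exp (\<beta> i j * u))"]) auto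
  also have "\<dots> = (\<Prod>i<n. \<Prod>j<d. ennreal (exp (\<psi> (A $ z i $ w j + \<beta> i j) - \<psi> (A $ z i $ w j) + \<gamma> i j)))"
  proof (intro prod.cong refl)
    fix i j assume ij: "i \<in> {..<n}" "j \<in> {..<d}"
    let ?P = "phi_law \<nu> b (A $ z i $ w j)"
    have "(\<integral>\<^sup>+u. ennreal (exp (\<gamma> i j)) * ennreal (exp (\<beta> i j * u)) \<partial>?P)
        = ennreal (exp (\<gamma> i j)) * (\<integral>\<^sup>+u. ennreal (exp (\<beta> i j * u)) \<partial>?P)"
      by (intro nn_integral_cmult) measurable
    also have "(\<integral>\<^sup>+u. ennreal (exp (\<beta> i j * u)) \<partial>?P) = ennreal (exp (\<psi> (A $ z i $ w j + \<beta> i j) - \<psi> (A $ z i $ w j)))"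
      using ij by (intro nn_integral_exp_phi_law A_K assms) auto
    finally show "(\<integral>\<^sup>+u. ennreal (exp (\<gamma> i j)) * ennreal (exp (\<beta> i j * u)) \<partial>?P)
        = ennreal (exp (\<psi> (A $ z i $ w j + \<beta> i j) - \<psi> (A $ z i $ w j) + \<gamma> i j))"
      by (simp add: ennreal_mult[symmetric] exp_add)
  qed
  finally show ?thesis
    by (simp add: exp_sum prod_ennreal prod_nonneg)
qed

lemma AE_base_pos: "AE x in data_law_given \<nu> b n d A z w. base n d x > 0"
proof -
  have "AE x in data_law_given \<nu> b n d A z w. b (x ij) > 0" if "ij \<in> {..<n} \<times> {..<d}" for ij
    unfolding data_law_given_def
    by (rule AE_PiM_component[OF prob_space_phi_law[OF A_K] that]) (rule phi_law_base_pos)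
  then have "AE x in data_law_given \<nu> b n d A z w. \<forall>ij\<in>{..<n} \<times> {..<d}. b (x ij) > 0"
    by (intro AE_finite_allI) auto
  then show ?thesis
    by eventually_elim (auto simp: base_def intro!: prod_pos)
qed

text \<open>A Chernoff bound for the absolute values, with \<open>exp (t * \<bar>u\<bar>)\<close>
  controlled by the exponential moments at \<open>t\<close> and \<open>- t\<close>.\<close>

lemma abs_sum_tail:
  assumes t: "t > 0" "\<And>k l. A $ k $ l + t \<in> I" "\<And>k l. A $ k $ l + - t \<in> I"
  obtains K1 where "K1 > 0" "\<And>n d z w. measure (data_law_given \<nu> b n d A z w)
    {x \<in> space (data_space n d). (\<Sum>i<n. \<Sum>j<d. \<bar>x (i, j)\<bar>) > K1 * (real n * real d)}
      \<le> exp (- (real n * real d))"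
proof -
  define C where "C = 1 + (\<Sum>k\<in>UNIV. \<Sum>l\<in>UNIV. exp (\<psi> (A $ k $ l + t) - \<psi> (A $ k $ l))
      + exp (\<psi> (A $ k $ l + - t) - \<psi> (A $ k $ l)))"
  have C: "exp (\<psi> (A $ k $ l + t) - \<psi> (A $ k $ l)) + exp (\<psi> (A $ k $ l + - t) - \<psi> (A $ k $ l)) \<le> C" for k l
  proof -
    let ?f = "\<lambda>k l. exp (\<psi> (A $ k $ l + t) - \<psi> (A $ k $ l)) + exp (\<psi> (A $ k $ l + - t) - \<psi> (A $ k $ l))"
    have "?f k l \<le> (\<Sum>l\<in>UNIV. ?f k l)"
      by (rule member_le_sum[where f = "\<lambda>l. ?f k l"]) auto
    also have "\<dots> \<le> (\<Sum>k\<in>UNIV. \<Sum>l\<in>UNIV. ?f k l)"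
      by (rule member_le_sum[where f = "\<lambda>k. \<Sum>l\<in>UNIV. ?f k l"]) (auto intro!: sum_nonneg add_nonneg_nonneg)
    finally show ?thesis by (simp add: C_def)
  qed
  have C1: "C \<ge> 1" unfolding C_def by (auto intro!: sum_nonneg add_nonneg_nonneg)
  show thesis
  \<comment> \<open>\<open>C\<close> bounds the exponential moment of one entry, so this constant
    makes the Chernoff bound \<open>C ^ (n * d) / exp ((1 + ln C) * n * d)\<close> equal to
    \<open>exp (- n * d)\<close>. It is positive as \<open>C \<ge> 1\<close>.\<close>
  proof (rule that[of "(1 + ln C) / t"])
    show "(1 + ln C) / t > 0" using t(1) C1 by (intro divide_pos_pos add_pos_nonneg) auto
    fix n d z w
    let ?M = "data_law_given \<nu> b n d A z w"
    let ?G = "{x \<in> space (data_space n d). (\<Sum>i<n. \<Sum>j<d. \<bar>x (i, j)\<bar>) > (1 + ln C) / t * (real n * real d)}"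
    interpret prob_space ?M by (rule prob_space_data_law)
    have f1: "(\<integral>\<^sup>+u. ennreal (exp (t * \<bar>u\<bar>)) \<partial>phi_law \<nu> b (A $ k $ l)) \<le> ennreal C" for k l
    proof -
      have "(\<integral>\<^sup>+u. ennreal (exp (t * \<bar>u\<bar>)) \<partial>phi_law \<nu> b (A $ k $ l))
          \<le> (\<integral>\<^sup>+u. ennreal (exp (t * u)) + ennreal (exp ((- t) * u)) \<partial>phi_law \<nu> b (A $ k $ l))"
      proof (intro nn_integral_mono)
        fix u
        have "exp (t * \<bar>u\<bar>) \<le> exp (t * u) + exp (- t * u)"
          by (cases "u \<ge> 0") (auto simp: add_increasing add_increasing2)
        then show "ennreal (exp (t * \<bar>u\<bar>)) \<le> ennreal (exp (t * u)) + ennreal (exp ((- t) * u))"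
          by (simp flip: ennreal_plus)
      qed
      also have "\<dots> = ennreal (exp (\<psi> (A $ k $ l + t) - \<psi> (A $ k $ l))) + ennreal (exp (\<psi> (A $ k $ l + - t) - \<psi> (A $ k $ l)))"
        using t(2,3) I_K A_K
        by (subst nn_integral_add) (measurable, simp only: nn_integral_exp_phi_law)
      also have "\<dots> \<le> ennreal C" using C[of k l] by (simp add: ennreal_leI flip: ennreal_plus)
      finally show ?thesis .
    qed
    have "prob ?G \<le> C ^ (n * d) / exp ((1 + ln C) * (real n * real d))"
    proof (rule markov_prob[where g = "\<lambda>x. \<Prod>i<n. \<Prod>j<d. ennreal (exp (t * \<bar>x (i, j)\<bar>))"])
      have "(\<integral>\<^sup>+x. (\<Prod>i<n. \<Prod>j<d. ennreal (exp (t * \<bar>x (i, j)\<bar>))) \<partial>?M)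
          = (\<Prod>i<n. \<Prod>j<d. \<integral>\<^sup>+u. ennreal (exp (t * \<bar>u\<bar>)) \<partial>phi_law \<nu> b (A $ z i $ w j))"
        by (rule nn_integral_data_prod) measurable
      also have "\<dots> \<le> (\<Prod>i<n. \<Prod>j<d. ennreal C)"
        by (intro prod_mono_ennreal f1)
      also have "\<dots> = ennreal (C ^ (n * d))"
        using C1 by (simp add: ennreal_power power_mult[symmetric] mult.commute)
      finally show "(\<integral>\<^sup>+x. (\<Prod>i<n. \<Prod>j<d. ennreal (exp (t * \<bar>x (i, j)\<bar>))) \<partial>?M) \<le> ennreal (C ^ (n * d))" .
      show "(\<lambda>x. \<Prod>i<n. \<Prod>j<d. ennreal (exp (t * \<bar>x (i, j)\<bar>))) \<in> borel_measurable ?M"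
        unfolding measurable_cong_sets[OF sets_data_law refl]
      proof (intro borel_measurable_prod_ennreal)
        fix i j assume "i \<in> {..<n}" "j \<in> {..<d}"
        then have [measurable]: "(\<lambda>x. x (i, j)) \<in> borel_measurable (data_space n d)"
          by (intro component_data_space) auto
        show "(\<lambda>x. ennreal (exp (t * \<bar>x (i, j)\<bar>))) \<in> borel_measurable (data_space n d)"
          by measurable
      qed
      have [measurable]: "(\<lambda>x. \<Sum>i<n. \<Sum>j<d. \<bar>x (i, j)\<bar>) \<in> borel_measurable (data_space n d)"
        by (intro double_sum_data_space) auto
      show "?G \<in> sets ?M" by simp
      fix x assume "x \<in> ?G"
      then have "(1 + ln C) * (real n * real d) \<le> t * (\<Sum>i<n. \<Sum>j<d. \<bar>x (i, j)\<bar>)"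
        using t(1) by (simp add: field_simps)
      then have "exp ((1 + ln C) * (real n * real d)) \<le> exp (\<Sum>i<n. \<Sum>j<d. t * \<bar>x (i, j)\<bar>)"
        by (simp add: sum_distrib_left)
      also have "\<dots> = (\<Prod>i<n. \<Prod>j<d. exp (t * \<bar>x (i, j)\<bar>))" by (simp add: exp_sum)
      finally show "ennreal (exp ((1 + ln C) * (real n * real d))) \<le> (\<Prod>i<n. \<Prod>j<d. ennreal (exp (t * \<bar>x (i, j)\<bar>)))"
        by (simp add: prod_ennreal prod_nonneg)
    qed (use C1 in auto)
    also have "C ^ (n * d) = exp (ln C * (real n * real d))"
      using C1 exp_of_nat_mult[of "n * d" "ln C"] by (simp add: mult.commute)
    also have "exp (ln C * (real n * real d)) / exp ((1 + ln C) * (real n * real d)) = exp (- (real n * real d))"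
      by (simp add: exp_diff[symmetric] algebra_simps)
    finally show "prob ?G \<le> exp (- (real n * real d))" .
  qed
qed

text \<open>Chernoff with tilt \<open>\<delta>\<close> and the mean at the tilted parameter as
  threshold: with \<open>\<alpha> = A $ k $ l\<close>, each entry of the block contributes the
  exponent \<open>\<psi> (\<alpha> + \<delta>) - \<psi> \<alpha> - \<delta> * \<mu> (\<alpha> +
  \<delta>)\<close>, at most \<open>- \<kappa> * \<delta>\<^sup>2\<close> by strong convexity at
  \<open>\<alpha> + \<delta>\<close>. The sign of \<open>\<delta>\<close> selects the upper or the
  lower tail.\<close>

lemma block_mean_tail:
  assumes sc: "\<And>x y. x \<in> {a0..b0} \<Longrightarrow> y \<in> {a0..b0} \<Longrightarrow> \<psi> y \<ge> \<psi> x + \<mu> x * (y - x) + \<kappa> * (y - x)\<^sup>2"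
    and A: "A $ k $ l \<in> {a0..b0}" "A $ k $ l + \<delta> \<in> {a0..b0}" "A $ k $ l + \<delta> \<in> K"
    and N: "cnt n z k > 0" "cnt d w l > 0"
  shows "measure (data_law_given \<nu> b n d A z w)
     {x \<in> space (data_space n d). \<delta> * (x_hat n d x z w $ k $ l - \<mu> (A $ k $ l + \<delta>)) \<ge> 0}
     \<le> exp (- \<kappa> * \<delta>\<^sup>2 * (real (cnt n z k) * real (cnt d w l)))"
proof -
  let ?M = "data_law_given \<nu> b n d A z w"
  let ?G = "{x \<in> space (data_space n d). \<delta> * (x_hat n d x z w $ k $ l - \<mu> (A $ k $ l + \<delta>)) \<ge> 0}"
  define e :: "nat \<Rightarrow> nat \<Rightarrow> real" where "e = (\<lambda>i j. of_bool (z i = k) * of_bool (w j = l))"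
  define m where "m = \<mu> (A $ k $ l + \<delta>)"
  define N where "N = real (cnt n z k) * real (cnt d w l)"
  interpret prob_space ?M by (rule prob_space_data_law)
  have cz: "(\<Sum>i<n. of_bool (z i = k)) = real (cnt n z k)" and cw: "(\<Sum>j<d. of_bool (w j = l)) = real (cnt d w l)"
    unfolding cnt_def by (simp_all add: of_bool_def sum.If_cases Int_def)
  have esum: "(\<Sum>i<n. \<Sum>j<d. e i j) = N"
    unfolding e_def N_def cz[symmetric] cw[symmetric] by (rule sum_product[symmetric])
  have xh: "x_hat n d x z w $ k $ l = (\<Sum>i<n. \<Sum>j<d. x (i, j) * e i j) / N" for x
    by (simp only: x_hat_def vec_lambda_beta e_def N_def cz cw mult.assoc)
  have Npos: "N > 0" using assms(5,6) by (simp add: N_def)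
  have meas [measurable]: "(\<lambda>x. x_hat n d x z w $ k $ l) \<in> borel_measurable (data_space n d)"
    unfolding xh by (intro borel_measurable_divide double_sum_data_space) auto
  define f where "f = (\<lambda>x. \<Sum>i<n. \<Sum>j<d. \<delta> * e i j * x (i, j) + - (\<delta> * m * e i j))"
  have f: "f x = \<delta> * N * (x_hat n d x z w $ k $ l - m)" for x
  proof -
    have "f x = \<delta> * (\<Sum>i<n. \<Sum>j<d. x (i, j) * e i j) - \<delta> * m * (\<Sum>i<n. \<Sum>j<d. e i j)"
      unfolding f_def by (simp only: sum.distrib sum_negf sum_distrib_left) (simp add: mult_ac)
    then show ?thesis unfolding xh esum using Npos by (simp add: right_diff_distrib)
  qed
  have "prob ?G \<le> exp (- \<kappa> * \<delta>\<^sup>2 * N) / 1"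
  proof (rule markov_prob[where g = "\<lambda>x. ennreal (exp (f x))"])
    have "(\<integral>\<^sup>+x. ennreal (exp (f x)) \<partial>?M)
        = ennreal (exp (\<Sum>i<n. \<Sum>j<d. \<psi> (A $ z i $ w j + \<delta> * e i j) - \<psi> (A $ z i $ w j) + - (\<delta> * m * e i j)))"
      unfolding f_def by (rule nn_integral_data_exp) (use A A_K in \<open>auto simp: e_def\<close>)
    also have "(\<Sum>i<n. \<Sum>j<d. \<psi> (A $ z i $ w j + \<delta> * e i j) - \<psi> (A $ z i $ w j) + - (\<delta> * m * e i j))
        \<le> (\<Sum>i<n. \<Sum>j<d. (- \<kappa> * \<delta>\<^sup>2) * e i j)"
    proof (intro sum_mono)
      fix i j
      show "\<psi> (A $ z i $ w j + \<delta> * e i j) - \<psi> (A $ z i $ w j) + - (\<delta> * m * e i j) \<le> (- \<kappa> * \<delta>\<^sup>2) * e i j"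
        using sc[OF A(2,1)] by (cases "z i = k \<and> w j = l") (auto simp: e_def m_def mult_ac)
    qed
    also have "\<dots> = - \<kappa> * \<delta>\<^sup>2 * N"
      by (simp only: sum_distrib_left[symmetric] esum)
    finally show "(\<integral>\<^sup>+x. ennreal (exp (f x)) \<partial>?M) \<le> ennreal (exp (- \<kappa> * \<delta>\<^sup>2 * N))"
      by (simp add: ennreal_leI)
    show "(\<lambda>x. ennreal (exp (f x))) \<in> borel_measurable ?M"
      unfolding f by measurable
    show "?G \<in> sets ?M" by simp
    fix x assume "x \<in> ?G"
    then have "0 \<le> f x" unfolding f using Npos
      by (simp add: m_def mult.assoc mult.left_commute[of _ N])
    then show "ennreal 1 \<le> ennreal (exp (f x))" by (intro ennreal_leI) simp
  qed auto
  then show ?thesis by (simp add: N_def)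
qed

text \<open>Halving the log-likelihood ratio tilts each true parameter to its midpoint with the
  competitor, so \<open>psi_midpoint\<close> and the separation bound the mean of each term. A
  wrongly labelled row affects \<open>d\<close> entries and a wrongly labelled column
  \<open>n\<close>: this is why \<open>q d\<close> is raised to the row distance and
  \<open>q n\<close> to the column distance. The generating functions sum these bounds, and Markov's
  inequality gives the tail.\<close>

lemma sqrt_ratio_tail:
  fixes a :: "real ^ 'm ^ 'g"
  assumes sc: "\<And>x y. x \<in> {a0..b0} \<Longrightarrow> y \<in> {a0..b0} \<Longrightarrow> \<psi> y \<ge> \<psi> x + \<mu> x * (y - x) + \<kappa> * (y - x)\<^sup>2"
    and A: "\<And>k l. A $ k $ l \<in> {a0..b0}" and a: "\<And>k l. a $ k $ l \<in> {a0..b0}" "{a0..b0} \<subseteq> K"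
    and sep: "\<And>z w. c1 * (real d * hmin n y z + real n * hmin d v w)
      \<le> (\<Sum>i<n. \<Sum>j<d. (a $ z i $ w j - A $ y i $ v j)\<^sup>2)"
    and pos: "c > 0" "\<kappa> > 0" "\<delta> > 0"
  defines "q \<equiv> \<lambda>e :: nat. sqrt (1 / c) * exp (- (\<kappa> / 4 * c1) * real e)"
  shows "measure (data_law_given \<nu> b n d A y v)
     {x \<in> space (data_space n d). sqrt_ratio_sum n d c y v A a x \<ge> \<delta>}
     \<le> real (card {s::'g\<Rightarrow>'g. bij s}) * real (card {t::'m\<Rightarrow>'m. bij t}) *
      (exp (real n * (real CARD('g) * q d) + real d * (real CARD('m) * q n)) - 1) / \<delta>" (is "_ \<le> ?U / \<delta>")
    and "sqrt_ratio_sum n d c y v A a \<in> borel_measurable (data_space n d)"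
proof -
  let ?M = "data_law_given \<nu> b n d A y v"
  let ?Z = "{..<n} \<rightarrow>\<^sub>E (UNIV::'g set)" and ?W = "{..<d} \<rightarrow>\<^sub>E (UNIV::'m set)"
  let ?r = "sqrt_ratio_sum n d c y v A a"
  interpret prob_space ?M by (rule prob_space_data_law)
  have en: "(energy n d x a z w - energy n d x A y v) / 2 = (\<Sum>i<n. \<Sum>j<d.
      (a $ z i $ w j - A $ y i $ v j) / 2 * x (i, j) + (\<psi> (A $ y i $ v j) - \<psi> (a $ z i $ w j)) / 2)" for x z w
    unfolding energy_def sum_subtractf[symmetric] sum_divide_distrib
    by (intro sum.cong refl) (simp add: field_simps)
  have emeas: "(\<lambda>x. exp ((energy n d x a z w - energy n d x A y v) / 2)) \<in> borel_measurable (data_space n d)" for z w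
    unfolding en by (intro measurable_compose[OF double_sum_data_space borel_measurable_exp]) measurable
  show rmeas: "?r \<in> borel_measurable (data_space n d)"
    unfolding sqrt_ratio_sum_def[abs_def] using emeas
    by (intro borel_measurable_sum) (auto intro!: borel_measurable_times)
  have int: "(\<integral>\<^sup>+x. ennreal (exp ((energy n d x a z w - energy n d x A y v) / 2)) \<partial>?M)
      \<le> ennreal (exp (- (\<kappa> / 4) * (c1 * (real d * hmin n y z + real n * hmin d v w))))" for z w
  proof -
    have mid: "A $ y i $ v j + (a $ z i $ w j - A $ y i $ v j) / 2 = (a $ z i $ w j + A $ y i $ v j) / 2" for i j
      by (simp add: field_simps)
    have inK: "(a $ z i $ w j + A $ y i $ v j) / 2 \<in> K" for i j
      using a(1)[of "z i" "w j"] A[of "y i" "v j"] a(2) by (intro subsetD[OF a(2)]) auto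
    have int: "(\<integral>\<^sup>+x. ennreal (exp ((energy n d x a z w - energy n d x A y v) / 2)) \<partial>?M)
        = ennreal (exp (\<Sum>i<n. \<Sum>j<d. \<psi> (A $ y i $ v j + (a $ z i $ w j - A $ y i $ v j) / 2) - \<psi> (A $ y i $ v j)
          + (\<psi> (A $ y i $ v j) - \<psi> (a $ z i $ w j)) / 2))"
      unfolding en by (rule nn_integral_data_exp) (simp only: mid inK)
    have "(\<Sum>i<n. \<Sum>j<d. \<psi> (A $ y i $ v j + (a $ z i $ w j - A $ y i $ v j) / 2) - \<psi> (A $ y i $ v j)
          + (\<psi> (A $ y i $ v j) - \<psi> (a $ z i $ w j)) / 2) \<le>
        (\<Sum>i<n. \<Sum>j<d. - (\<kappa> / 4) * (a $ z i $ w j - A $ y i $ v j)\<^sup>2)"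
      unfolding mid
    proof (intro sum_mono)
      fix i j
      show "\<psi> ((a $ z i $ w j + A $ y i $ v j) / 2) - \<psi> (A $ y i $ v j)
          + (\<psi> (A $ y i $ v j) - \<psi> (a $ z i $ w j)) / 2 \<le> - (\<kappa> / 4) * (a $ z i $ w j - A $ y i $ v j)\<^sup>2"
        using psi_midpoint[OF sc a(1)[of "z i" "w j"] A[of "y i" "v j"]] by (simp add: field_simps)
    qed
    also have "\<dots> = - (\<kappa> / 4) * (\<Sum>i<n. \<Sum>j<d. (a $ z i $ w j - A $ y i $ v j)\<^sup>2)"
      unfolding sum_distrib_left ..
    also have "\<dots> \<le> - (\<kappa> / 4) * (c1 * (real d * hmin n y z + real n * hmin d v w))"
      by (rule mult_left_mono_neg[OF sep]) (use pos in simp)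
    finally show ?thesis unfolding int by (intro ennreal_leI) simp
  qed
  have U: "(\<integral>\<^sup>+x. ennreal (?r x) \<partial>?M) \<le> ennreal ?U"
  proof -
    have "(\<integral>\<^sup>+x. ennreal (?r x) \<partial>?M) = (\<integral>\<^sup>+x. (\<Sum>z\<in>?Z. \<Sum>w\<in>?W. if hmin n y z + hmin d v w > 0
        then ennreal (sqrt (1 / c) ^ (hmin n y z + hmin d v w))
        * ennreal (exp ((energy n d x a z w - energy n d x A y v) / 2)) else 0) \<partial>?M)"
      unfolding sqrt_ratio_sum_def using pos
      by (intro nn_integral_cong)
        (simp add: sum_nonneg ennreal_mult[symmetric] if_distrib[of ennreal] flip: sum_ennreal cong: if_cong)
    also have "\<dots> = (\<Sum>z\<in>?Z. \<Sum>w\<in>?W. if hmin n y z + hmin d v w > 0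
        then ennreal (sqrt (1 / c) ^ (hmin n y z + hmin d v w))
        * (\<integral>\<^sup>+x. ennreal (exp ((energy n d x a z w - energy n d x A y v) / 2)) \<partial>?M) else 0)"
    proof -
      have m: "(\<lambda>x. ennreal (exp ((energy n d x a z w - energy n d x A y v) / 2))) \<in> borel_measurable ?M" for z w
        using emeas by simp
      have m': "(\<lambda>x. if hmin n y z + hmin d v w > 0 then ennreal (sqrt (1 / c) ^ (hmin n y z + hmin d v w))
          * ennreal (exp ((energy n d x a z w - energy n d x A y v) / 2)) else 0) \<in> borel_measurable ?M" for z w
        using m[of z w] by (cases "hmin n y z + hmin d v w > 0") auto
      show ?thesis
        by (simp only: nn_integral_sum m' borel_measurable_sum)
          (auto intro!: sum.cong simp: nn_integral_cmult m)
    qed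
    also have "\<dots> \<le> (\<Sum>z\<in>?Z. \<Sum>w\<in>?W. ennreal (if hmin n y z + hmin d v w > 0
        then q d ^ hmin n y z * q n ^ hmin d v w else 0))"
    proof (intro sum_mono)
      fix z w
      have "ennreal (sqrt (1 / c) ^ (hmin n y z + hmin d v w))
          * (\<integral>\<^sup>+x. ennreal (exp ((energy n d x a z w - energy n d x A y v) / 2)) \<partial>?M)
        \<le> ennreal (sqrt (1 / c) ^ (hmin n y z + hmin d v w))
          * ennreal (exp (- (\<kappa> / 4) * (c1 * (real d * hmin n y z + real n * hmin d v w))))"
        by (intro mult_left_mono int) simp
      also have "\<dots> = ennreal (q d ^ hmin n y z * q n ^ hmin d v w)"
        using pos unfolding q_def
        by (simp add: ennreal_mult[symmetric] power_mult_distrib power_add exp_of_nat_mult[symmetric]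
            exp_add[symmetric] algebra_simps)
      finally show "(if hmin n y z + hmin d v w > 0
        then ennreal (sqrt (1 / c) ^ (hmin n y z + hmin d v w))
        * (\<integral>\<^sup>+x. ennreal (exp ((energy n d x a z w - energy n d x A y v) / 2)) \<partial>?M) else 0)
        \<le> ennreal (if hmin n y z + hmin d v w > 0 then q d ^ hmin n y z * q n ^ hmin d v w else 0)"
        by simp
    qed
    also have "\<dots> = ennreal (\<Sum>z\<in>?Z. \<Sum>w\<in>?W. if hmin n y z + hmin d v w > 0
        then q d ^ hmin n y z * q n ^ hmin d v w else 0)"
      using pos by (simp add: sum_ennreal sum_nonneg q_def)
    also have "\<dots> \<le> ennreal ?U"
      using pos by (intro ennreal_leI nonorbit_sum_le) (auto simp: q_def)
    finally show ?thesis .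
  qed
  show "prob {x \<in> space (data_space n d). ?r x \<ge> \<delta>} \<le> ?U / \<delta>"
  proof (rule markov_prob[OF U])
    show "(\<lambda>x. ennreal (?r x)) \<in> borel_measurable ?M" using rmeas by simp
    show "{x \<in> space (data_space n d). ?r x \<ge> \<delta>} \<in> sets ?M" using rmeas by simp
    show "?U \<ge> 0" using pos by (auto simp: q_def intro!: mult_nonneg_nonneg add_nonneg_nonneg)
  qed (use pos in \<open>auto intro: ennreal_leI\<close>)
qed

end

end

section \<open>Maximisers of the observed likelihood\<close>

lemma norm_vec_sq: "(norm v)\<^sup>2 = (\<Sum>k\<in>UNIV. (norm (v $ k))\<^sup>2)"
  for v :: "'b::real_normed_vector ^ 'a::finite"
  by (simp add: norm_vec_def L2_set_def sum_nonneg)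

lemma norm_mat_sq: "(norm a)\<^sup>2 = (\<Sum>k\<in>UNIV. \<Sum>l\<in>UNIV. (a $ k $ l)\<^sup>2)"
  for a :: "real ^ 'm::finite ^ 'g::finite"
  by (simp add: norm_vec_sq)

lemma dist_param_sq:
  "(dist (p, r, a) (p', r', a'))\<^sup>2 = (norm (p - p'))\<^sup>2 + (norm (r - r'))\<^sup>2 + (norm (a - a'))\<^sup>2"
  by (simp add: dist_Pair_Pair) (simp add: dist_norm)

lemma norm_perm_vec: "bij s \<Longrightarrow> norm (perm_vec s p - perm_vec s p') = norm (p - p')"
proof -
  assume "bij s"
  then have "(norm (perm_vec s p - perm_vec s p'))\<^sup>2 = (norm (p - p'))\<^sup>2"
    unfolding norm_vec_sq using sum.reindex_bij_betw[of s UNIV UNIV "\<lambda>k. (norm ((p - p') $ k))\<^sup>2"]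
    by (simp add: perm_vec_def)
  then show ?thesis by simp
qed

lemma norm_perm_mat:
  assumes "bij s" "bij t"
  shows "norm (perm_mat s t a - perm_mat s t a') = norm (a - a')"
proof -
  have "(\<Sum>l\<in>UNIV. (a $ k $ t l - a' $ k $ t l)\<^sup>2) = (\<Sum>l\<in>UNIV. (a $ k $ l - a' $ k $ l)\<^sup>2)" for k
    using sum.reindex_bij_betw[of t UNIV UNIV "\<lambda>l. (a $ k $ l - a' $ k $ l)\<^sup>2"] assms by simp
  moreover have "(\<Sum>k\<in>UNIV. \<Sum>l\<in>UNIV. (a $ s k $ l - a' $ s k $ l)\<^sup>2)
      = (\<Sum>k\<in>UNIV. \<Sum>l\<in>UNIV. (a $ k $ l - a' $ k $ l)\<^sup>2)"
    using sum.reindex_bij_betw[of s UNIV UNIV "\<lambda>k. \<Sum>l\<in>UNIV. (a $ k $ l - a' $ k $ l)\<^sup>2"] assms by simp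
  ultimately have "(norm (perm_mat s t a - perm_mat s t a'))\<^sup>2 = (norm (a - a'))\<^sup>2"
    by (simp add: norm_mat_sq perm_mat_def)
  then show ?thesis by simp
qed

lemma dist_perm_param:
  assumes "bij s" "bij t"
  shows "dist (perm_param s t \<theta>) (perm_param s t \<theta>') = dist \<theta> \<theta>'"
proof -
  have "(dist (perm_param s t \<theta>) (perm_param s t \<theta>'))\<^sup>2 = (dist \<theta> \<theta>')\<^sup>2"
    by (cases \<theta>; cases \<theta>')
      (simp add: perm_param_def dist_param_sq norm_perm_vec norm_perm_mat assms)
  then show ?thesis by simp
qed

lemma perm_param_comp:
  "perm_param s' t' (perm_param s t \<theta>) = perm_param (s \<circ> s') (t \<circ> t') \<theta>"
  by (cases \<theta>) (simp add: perm_param_def perm_vec_def perm_mat_def vec_eq_iff)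

text \<open>If two different relabellings of \<open>\<theta>\<close> were near
  \<open>\<theta>0\<close>, the permutations \<open>\<sigma>\<close>, \<open>\<tau>\<close> leading
  from one to the other would move \<open>\<theta>0\<close> by less than \<open>2 * \<eta>\<close>,
  because relabelling is an isometry.\<close>

lemma perm_close_unique:
  assumes sym: "\<And>s t. bij s \<Longrightarrow> bij t \<Longrightarrow> (s, t) \<noteq> (id, id) \<Longrightarrow> 2 * \<eta> \<le> dist (perm_param s t \<theta>0) \<theta>0"
    and s: "bij s" "bij t" "dist (perm_param s t \<theta>) \<theta>0 < \<eta>"
    and s': "bij s'" "bij t'" "dist (perm_param s' t' \<theta>) \<theta>0 < \<eta>"
  shows "(s', t') = (s, t)"
proof (rule ccontr)
  assume ne: "(s', t') \<noteq> (s, t)"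
  define \<sigma> where "\<sigma> = inv s \<circ> s'"
  define \<tau> where "\<tau> = inv t \<circ> t'"
  have b: "bij \<sigma>" "bij \<tau>" using s s' by (auto simp: \<sigma>_def \<tau>_def bij_comp bij_imp_bij_inv)
  have e: "s \<circ> \<sigma> = s'" "t \<circ> \<tau> = t'"
    using s by (auto simp: \<sigma>_def \<tau>_def fun_eq_iff bij_is_surj surj_f_inv_f)
  have "(\<sigma>, \<tau>) \<noteq> (id, id)" using ne e by auto
  then have "2 * \<eta> \<le> dist (perm_param \<sigma> \<tau> \<theta>0) \<theta>0" using sym b by blast
  also have "\<dots> \<le> dist (perm_param \<sigma> \<tau> \<theta>0) (perm_param \<sigma> \<tau> (perm_param s t \<theta>))
      + dist (perm_param \<sigma> \<tau> (perm_param s t \<theta>)) \<theta>0" by (rule dist_triangle)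
  also have "\<dots> = dist \<theta>0 (perm_param s t \<theta>) + dist (perm_param s' t' \<theta>) \<theta>0"
    unfolding dist_perm_param[OF b] by (simp add: perm_param_comp e)
  finally show False using s(3) s'(3) by (simp add: dist_commute)
qed

lemma prob_vector_perm: "bij s \<Longrightarrow> prob_vector p \<Longrightarrow> prob_vector (perm_vec s p)"
  using sum.reindex_bij_betw[of s UNIV UNIV "\<lambda>k. p $ k"]
  by (simp add: prob_vector_def perm_vec_def)

lemma prob_vector_prop_hat:
  assumes "n > 0" shows "prob_vector (prop_hat n z)"
  using sum_cnt[of "\<lambda>_. 1" z n] assms
  by (simp add: prob_vector_def prop_hat_cnt sum_divide_distrib[symmetric])

context exp_family begin

text \<open>For fixed labels the block means are sufficient statistics. Every class must be nonempty
  because \<open>x_hat\<close> divides by the block size.\<close>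

lemma energy_block:
  fixes y :: "nat \<Rightarrow> 'g::finite" and v :: "nat \<Rightarrow> 'm::finite"
  assumes "\<And>k. cnt n y k > 0" "\<And>l. cnt d v l > 0"
  shows "energy n d x a y v = (\<Sum>k\<in>UNIV. \<Sum>l\<in>UNIV. real (cnt n y k) * real (cnt d v l)
    * (x_hat n d x y v $ k $ l * a $ k $ l - \<psi> (a $ k $ l)))"
proof -
  have cz: "(\<Sum>i<n. of_bool (y i = k)) = real (cnt n y k)" and cw: "(\<Sum>j<d. of_bool (v j = l)) = real (cnt d v l)" for k l
    unfolding cnt_def by (simp_all add: of_bool_def sum.If_cases Int_def)
  have xh: "x_hat n d x y v $ k $ l * (real (cnt n y k) * real (cnt d v l))
      = (\<Sum>i<n. \<Sum>j<d. x (i, j) * of_bool (y i = k) * of_bool (v j = l))" for k l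
    using assms(1)[of k] assms(2)[of l] unfolding x_hat_def cz cw by simp
  have sel: "h (y i) (v j) = (\<Sum>k\<in>UNIV. \<Sum>l\<in>UNIV. of_bool (y i = k) * of_bool (v j = l) * h k l)"
    for h :: "'g \<Rightarrow> 'm \<Rightarrow> real" and i j
    by (simp add: of_bool_def if_distrib[of "\<lambda>c. c * _"] cong: if_cong)
      (simp add: if_distrib[of "\<lambda>c. sum _ c"] sum.If_cases)
  have "energy n d x a y v = (\<Sum>i<n. \<Sum>j<d. \<Sum>k\<in>UNIV. \<Sum>l\<in>UNIV.
      of_bool (y i = k) * of_bool (v j = l) * (x (i, j) * a $ k $ l - \<psi> (a $ k $ l)))"
    unfolding energy_def
  proof (intro sum.cong refl)
    fix i j
    show "x (i, j) * a $ y i $ v j - \<psi> (a $ y i $ v j) = (\<Sum>k\<in>UNIV. \<Sum>l\<in>UNIV.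
      of_bool (y i = k) * of_bool (v j = l) * (x (i, j) * a $ k $ l - \<psi> (a $ k $ l)))"
      by (rule sel)
  qed
  also have "\<dots> = (\<Sum>k\<in>UNIV. \<Sum>l\<in>UNIV. \<Sum>i<n. \<Sum>j<d.
      of_bool (y i = k) * of_bool (v j = l) * (x (i, j) * a $ k $ l - \<psi> (a $ k $ l)))"
    unfolding sum.swap[of _ "UNIV :: 'm set" "{..<n}"] sum.swap[of _ "UNIV :: 'm set" "{..<d}"]
      sum.swap[of _ "UNIV :: 'g set" "{..<n}"] sum.swap[of _ "UNIV :: 'g set" "{..<d}"] ..
  also have "\<dots> = (\<Sum>k\<in>UNIV. \<Sum>l\<in>UNIV. real (cnt n y k) * real (cnt d v l)
    * (x_hat n d x y v $ k $ l * a $ k $ l - \<psi> (a $ k $ l)))"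
  proof (intro sum.cong refl)
    fix k l
    have "(\<Sum>i<n. \<Sum>j<d. of_bool (y i = k) * of_bool (v j = l) * (x (i, j) * a $ k $ l - \<psi> (a $ k $ l)))
      = (\<Sum>i<n. \<Sum>j<d. x (i, j) * of_bool (y i = k) * of_bool (v j = l)) * a $ k $ l
        - (\<Sum>i<n. of_bool (y i = k)) * (\<Sum>j<d. of_bool (v j = l)) * \<psi> (a $ k $ l)"
    proof -
      have "(\<Sum>i<n. \<Sum>j<d. of_bool (y i = k) * of_bool (v j = l) * (x (i, j) * a $ k $ l - \<psi> (a $ k $ l)))
        = (\<Sum>i<n. \<Sum>j<d. x (i, j) * of_bool (y i = k) * of_bool (v j = l) * a $ k $ l
          - of_bool (y i = k) * of_bool (v j = l) * \<psi> (a $ k $ l))"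
        by (intro sum.cong refl) (simp only: right_diff_distrib mult_ac)
      also have "\<dots> = (\<Sum>i<n. \<Sum>j<d. x (i, j) * of_bool (y i = k) * of_bool (v j = l)) * a $ k $ l
          - (\<Sum>i<n. \<Sum>j<d. of_bool (y i = k) * of_bool (v j = l)) * \<psi> (a $ k $ l)"
        by (simp only: sum_subtractf sum_distrib_right)
      finally show ?thesis by (simp only: sum_product)
    qed
    also have "\<dots> = real (cnt n y k) * real (cnt d v l)
        * (x_hat n d x y v $ k $ l * a $ k $ l - \<psi> (a $ k $ l))"
      unfolding xh[symmetric] cz cw by (simp add: algebra_simps)
    finally show "(\<Sum>i<n. \<Sum>j<d. of_bool (y i = k) * of_bool (v j = l) * (x (i, j) * a $ k $ l - \<psi> (a $ k $ l)))
      = real (cnt n y k) * real (cnt d v l) * (x_hat n d x y v $ k $ l * a $ k $ l - \<psi> (a $ k $ l))" .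
  qed
  finally show ?thesis .
qed

text \<open>The three squared errors, weighted by the inverse squares of the rates in the theorem:
  with \<open>\<kappa>' = 1\<close>, a small value yields all three rates at once.\<close>

definition excess :: "real \<Rightarrow> nat \<Rightarrow> nat \<Rightarrow> ('g::finite, 'm::finite) param \<Rightarrow> ('g, 'm) param \<Rightarrow> real" where
  "excess \<kappa>' n d \<theta> \<theta>' = \<kappa>' * (real n * (norm (fst \<theta> - fst \<theta>'))\<^sup>2
      + real d * (norm (fst (snd \<theta>) - fst (snd \<theta>')))\<^sup>2
      + real n * real d * (norm (snd (snd \<theta>) - snd (snd \<theta>')))\<^sup>2)"

text \<open>A crude bound whose purpose is to make the relabellings far from the truth
  negligible.\<close>

lemma excess_ge:
  assumes "n > 0" "d > 0" "\<kappa>' \<ge> 0"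
  shows "\<kappa>' * real (min n d) * (dist \<theta> \<theta>')\<^sup>2 \<le> excess \<kappa>' n d \<theta> \<theta>'"
proof -
  obtain p r a where \<theta>: "\<theta> = (p, r, a)" by (cases \<theta>)
  obtain p' r' a' where \<theta>': "\<theta>' = (p', r', a')" by (cases \<theta>')
  have "real (min n d) \<le> real (n * d)" using assms by (auto simp: min_def)
  then have "real (min n d) * (norm (a - a'))\<^sup>2 \<le> real n * real d * (norm (a - a'))\<^sup>2"
    by (intro mult_right_mono) auto
  moreover have "real (min n d) * (norm (p - p'))\<^sup>2 \<le> real n * (norm (p - p'))\<^sup>2"
    "real (min n d) * (norm (r - r'))\<^sup>2 \<le> real d * (norm (r - r'))\<^sup>2"
    by (intro mult_right_mono; simp)+
  ultimately have "real (min n d) * (dist \<theta> \<theta>')\<^sup>2 \<le> real n * (norm (p - p'))\<^sup>2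
      + real d * (norm (r - r'))\<^sup>2 + real n * real d * (norm (a - a'))\<^sup>2"
    unfolding \<theta> \<theta>' dist_param_sq distrib_left by linarith
  then show ?thesis
    using assms(3) unfolding excess_def \<theta> \<theta>' by (simp add: mult_left_mono mult.assoc)
qed

section \<open>Deterministic analysis of one sample with large classes and regular block
  means\<close>

context
  fixes n d :: nat and x :: "nat \<times> nat \<Rightarrow> real" and y :: "nat \<Rightarrow> 'g::finite" and v :: "nat \<Rightarrow> 'm::finite"
    and a0 b0 \<kappa> \<gamma> \<kappa>' :: real
  assumes sc: "\<And>x y. x \<in> {a0..b0} \<Longrightarrow> y \<in> {a0..b0} \<Longrightarrow> \<psi> y \<ge> \<psi> x + \<mu> x * (y - x) + \<kappa> * (y - x)\<^sup>2"
    and nd: "n > 0" "d > 0"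
    and \<gamma>: "\<gamma> > 0" "\<And>k. \<gamma> * real n \<le> real (cnt n y k)" "\<And>l. \<gamma> * real d \<le> real (cnt d v l)"
    and \<kappa>: "\<kappa> > 0" "\<kappa>' > 0" "\<kappa>' \<le> 1 / 4" "\<kappa>' \<le> \<kappa> * \<gamma>\<^sup>2"
    and ah: "\<And>k l. \<mu> (alpha_hat \<nu> b n d x y v $ k $ l) = x_hat n d x y v $ k $ l"
      "\<And>k l. alpha_hat \<nu> b n d x y v $ k $ l \<in> {a0..b0}"
begin

abbreviation "\<theta>c \<equiv> (prop_hat n y, prop_hat d v, alpha_hat \<nu> b n d x y v)"

text \<open>The score vanishes at \<open>alpha_hat\<close>, where \<open>\<mu>\<close> equals the
  block mean, so strong convexity leaves a purely quadratic loss. The condition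
  \<open>\<kappa>' \<le> 1 / 4\<close> comes from the label likelihood, and
  \<open>\<kappa>' \<le> \<kappa> * \<gamma>\<^sup>2\<close> from blocks of at least
  \<open>\<gamma> * n\<close> by \<open>\<gamma> * d\<close> entries.\<close>

lemma complete_likelihood_le_max:
  assumes "prob_vector p" "prob_vector r" "\<And>k l. a $ k $ l \<in> {a0..b0}"
  shows "complete_likelihood \<nu> b n d (p, r, a) x y v
    \<le> complete_likelihood \<nu> b n d \<theta>c x y v * exp (- excess \<kappa>' n d (p, r, a) \<theta>c)"
proof -
  let ?h = "alpha_hat \<nu> b n d x y v" and ?p = "prop_hat n y" and ?r = "prop_hat d v"
  have "cnt n y k > 0" "cnt d v l > 0" for k l
    using \<gamma>(1) \<gamma>(2)[of k] \<gamma>(3)[of l] nd by (metis mult_pos_pos of_nat_0_less_iff order_less_le_trans)+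
  note eb = energy_block[OF this]
  have prior: "(\<Prod>i<n. p $ z i) \<le> (\<Prod>i<n. prop_hat n z $ z i) * exp (- \<kappa>' * (real n * (norm (p - prop_hat n z))\<^sup>2))"
    if "prob_vector p" "n > 0" for p :: "real ^ 'k::finite" and n z
  proof -
    have "(\<Prod>i<n. p $ z i) \<le> (\<Prod>i<n. prop_hat n z $ z i) * exp (- real n / 4 * (norm (p - prop_hat n z))\<^sup>2)"
      using prod_le_empirical[of "\<lambda>k. p $ k" n z] that
      by (simp add: prob_vector_def prop_hat_cnt norm_vec_sq)
    also have "\<dots> \<le> (\<Prod>i<n. prop_hat n z $ z i) * exp (- \<kappa>' * (real n * (norm (p - prop_hat n z))\<^sup>2))"
    proof (intro mult_left_mono prod_nonneg)
      have "\<kappa>' * (real n * (norm (p - prop_hat n z))\<^sup>2) \<le> 1/4 * (real n * (norm (p - prop_hat n z))\<^sup>2)"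
        using \<kappa> by (intro mult_right_mono) auto
      then show "exp (- real n / 4 * (norm (p - prop_hat n z))\<^sup>2) \<le> exp (- \<kappa>' * (real n * (norm (p - prop_hat n z))\<^sup>2))"
        by simp
    qed (simp add: prop_hat_cnt)
    finally show ?thesis .
  qed
  have "energy n d x a y v - energy n d x ?h y v
      = (\<Sum>k\<in>UNIV. \<Sum>l\<in>UNIV. real (cnt n y k) * real (cnt d v l)
    * (x_hat n d x y v $ k $ l * (a $ k $ l - ?h $ k $ l) - \<psi> (a $ k $ l) + \<psi> (?h $ k $ l)))"
    unfolding eb sum_subtractf[symmetric] by (intro sum.cong refl) (simp add: algebra_simps)
  also have "\<dots> \<le> (\<Sum>k\<in>UNIV. \<Sum>l\<in>UNIV. - \<kappa>' * (real n * real d) * (a $ k $ l - ?h $ k $ l)\<^sup>2)"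
  proof (intro sum_mono)
    fix k l
    have "x_hat n d x y v $ k $ l * (a $ k $ l - ?h $ k $ l) - \<psi> (a $ k $ l) + \<psi> (?h $ k $ l)
        \<le> - \<kappa> * (a $ k $ l - ?h $ k $ l)\<^sup>2"
      using sc[OF ah(2) assms(3), of k l k l] unfolding ah(1) by simp
    then have "real (cnt n y k) * real (cnt d v l)
      * (x_hat n d x y v $ k $ l * (a $ k $ l - ?h $ k $ l) - \<psi> (a $ k $ l) + \<psi> (?h $ k $ l))
      \<le> real (cnt n y k) * real (cnt d v l) * (- \<kappa> * (a $ k $ l - ?h $ k $ l)\<^sup>2)"
      by (intro mult_left_mono) auto
    also have "\<dots> \<le> - \<kappa>' * (real n * real d) * (a $ k $ l - ?h $ k $ l)\<^sup>2"
    proof -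
      have "\<kappa>' * (real n * real d) \<le> \<kappa> * \<gamma>\<^sup>2 * (real n * real d)"
        using \<kappa> by (intro mult_right_mono) auto
      also have "\<dots> = \<kappa> * ((\<gamma> * real n) * (\<gamma> * real d))" by (simp add: power2_eq_square)
      also have "\<dots> \<le> \<kappa> * (real (cnt n y k) * real (cnt d v l))"
        using \<kappa> \<gamma> by (intro mult_left_mono mult_mono) auto
      finally have "\<kappa>' * (real n * real d) * (a $ k $ l - ?h $ k $ l)\<^sup>2
          \<le> \<kappa> * (real (cnt n y k) * real (cnt d v l)) * (a $ k $ l - ?h $ k $ l)\<^sup>2"
        by (intro mult_right_mono) auto
      then show ?thesis by (simp add: mult_ac)
    qed
    finally show "real (cnt n y k) * real (cnt d v l)
      * (x_hat n d x y v $ k $ l * (a $ k $ l - ?h $ k $ l) - \<psi> (a $ k $ l) + \<psi> (?h $ k $ l))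
      \<le> - \<kappa>' * (real n * real d) * (a $ k $ l - ?h $ k $ l)\<^sup>2" .
  qed
  also have "\<dots> = - \<kappa>' * (real n * real d * (norm (a - ?h))\<^sup>2)"
    by (simp only: sum_distrib_left[symmetric] norm_mat_sq) (simp add: mult.assoc)
  finally have en: "exp (energy n d x a y v)
      \<le> exp (energy n d x ?h y v) * exp (- \<kappa>' * (real n * real d * (norm (a - ?h))\<^sup>2))"
    by (simp flip: exp_add)
  have "complete_likelihood \<nu> b n d (p, r, a) x y v
      = base n d x * ((\<Prod>i<n. p $ y i) * (\<Prod>j<d. r $ v j) * exp (energy n d x a y v))"
    by (rule complete_likelihood_eq)
  also have "\<dots> \<le> base n d x * (((\<Prod>i<n. ?p $ y i) * exp (- \<kappa>' * (real n * (norm (p - ?p))\<^sup>2)))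
      * ((\<Prod>j<d. ?r $ v j) * exp (- \<kappa>' * (real d * (norm (r - ?r))\<^sup>2)))
      * (exp (energy n d x ?h y v) * exp (- \<kappa>' * (real n * real d * (norm (a - ?h))\<^sup>2))))"
    using assms by (intro mult_left_mono mult_mono prior en nd base_nonneg)
      (auto intro!: prod_nonneg mult_nonneg_nonneg simp: prop_hat_cnt prob_vector_def)
  also have "\<dots> = complete_likelihood \<nu> b n d \<theta>c x y v * exp (- excess \<kappa>' n d (p, r, a) \<theta>c)"
    unfolding complete_likelihood_eq excess_def by (simp add: exp_add[symmetric] exp_diff algebra_simps)
      (simp add: exp_add[symmetric] algebra_simps exp_minus exp_diff field_simps)?
  finally show ?thesis .
qed

lemma complete_likelihood_max_pos:
  assumes "base n d x > 0"
  shows "complete_likelihood \<nu> b n d \<theta>c x y v > 0"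
proof -
  have "cnt n y k > 0" "cnt d v l > 0" for k l
    using \<gamma>(1) \<gamma>(2)[of k] \<gamma>(3)[of l] nd by (metis mult_pos_pos of_nat_0_less_iff order_less_le_trans)+
  then show ?thesis
    unfolding complete_likelihood_eq using assms nd
    by (intro mult_pos_pos prod_pos) (auto simp: prop_hat_cnt)
qed

text \<open>With \<open>L\<close> the complete likelihood at \<open>\<theta>c\<close>, the sandwich
  \<open>L \<le> obs(\<theta>c) \<le> obs(\<theta>) \<le> L * (\<Sum> exp (- excess) +
  \<delta>)\<close> over relabellings shows that the exponentials sum to at least
  \<open>1 - \<delta>\<close>. The far relabellings contribute at most \<open>\<delta>\<close>
  together. Hence there is a near one, and as it is the only one, its exponential alone is at least
  \<open>1 - 2 * \<delta>\<close>.\<close>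

lemma mle_close:
  assumes bpos: "base n d x > 0"
    and mle: "is_mle \<nu> b \<Theta> n d x \<theta>" and params: "\<Theta> \<subseteq> param_space"
    and box: "\<And>p r a k l. (p, r, a) \<in> \<Theta> \<Longrightarrow> a $ k $ l \<in> {a0..b0}"
    and inT: "\<theta>c \<in> \<Theta>"
    and A: "\<And>k l. A $ k $ l \<in> {a0..b0}"
    and \<delta>: "0 < \<delta>" "\<delta> \<le> 1 / 4"
    and obs: "observed_likelihood \<nu> b n d \<theta> x
      \<le> (\<Sum>s | bij s. \<Sum>t | bij t. complete_likelihood \<nu> b n d (perm_param s t \<theta>) x y v)
        + complete_likelihood \<nu> b n d (prop_hat n y, prop_hat d v, A) x y v * \<delta>"
    and \<eta>: "\<eta> > 0" "dist \<theta>c \<theta>0 < \<eta> / 2"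
    and sym: "\<And>s t. bij s \<Longrightarrow> bij t \<Longrightarrow> (s, t) \<noteq> (id, id) \<Longrightarrow> 2 * \<eta> \<le> dist (perm_param s t \<theta>0) \<theta>0"
    and far: "real (card {s::'g\<Rightarrow>'g. bij s}) * real (card {t::'m\<Rightarrow>'m. bij t})
      * exp (- \<kappa>' * real (min n d) * (\<eta> / 2)\<^sup>2) \<le> \<delta>"
  shows "\<exists>s t. bij s \<and> bij t \<and> dist (perm_param s t \<theta>) \<theta>0 < \<eta>"
    and "\<And>s t. bij s \<Longrightarrow> bij t \<Longrightarrow> dist (perm_param s t \<theta>) \<theta>0 < \<eta>
      \<Longrightarrow> excess \<kappa>' n d (perm_param s t \<theta>) \<theta>c \<le> - ln (1 - 2 * \<delta>)"
proof -
  let ?S = "{s::'g\<Rightarrow>'g. bij s}" and ?T = "{t::'m\<Rightarrow>'m. bij t}"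
  let ?cl = "\<lambda>\<theta>. complete_likelihood \<nu> b n d \<theta> x y v"
  define L where "L = ?cl \<theta>c"
  define e where "e = (\<lambda>s t. exp (- excess \<kappa>' n d (perm_param s t \<theta>) \<theta>c))"
  define f where "f = exp (- \<kappa>' * real (min n d) * (\<eta> / 2)\<^sup>2)"
  have L: "L > 0" unfolding L_def by (rule complete_likelihood_max_pos[OF bpos])
  obtain p r a where \<theta>: "\<theta> = (p, r, a)" by (cases \<theta>)
  have T: "(p, r, a) \<in> \<Theta>" using mle by (simp add: is_mle_def \<theta>)
  then have pv: "prob_vector p" "prob_vector r" using params by (auto simp: param_space_def)
  have cl: "?cl (perm_param s t \<theta>) \<le> L * e s t" if "bij s" "bij t" for s t
    unfolding L_def e_def \<theta> perm_param_def prod.case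
    by (intro complete_likelihood_le_max prob_vector_perm that pv) (use box[OF T] in \<open>simp add: perm_mat_def\<close>)
  have clA: "?cl (prop_hat n y, prop_hat d v, A) \<le> L"
  proof -
    have "?cl (prop_hat n y, prop_hat d v, A) \<le> L * exp (- excess \<kappa>' n d (prop_hat n y, prop_hat d v, A) \<theta>c)"
      unfolding L_def by (intro complete_likelihood_le_max prob_vector_prop_hat nd A)
    also have "\<dots> \<le> L * 1"
      using L \<kappa> by (intro mult_left_mono) (auto simp: excess_def)
    finally show ?thesis by simp
  qed
  have "L \<le> observed_likelihood \<nu> b n d \<theta>c x"
  proof -
    \<comment> \<open>\<open>observed_likelihood\<close> sums over extensional functions, so the
      labels are cut off outside the index range before one term of the sum is singled out.\<close>
    let ?y = "restrict y {..<n}" and ?v = "restrict v {..<d}"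
    have cl0: "complete_likelihood \<nu> b n d \<theta>c x z w \<ge> 0" for z w
      unfolding complete_likelihood_eq
      by (intro mult_nonneg_nonneg prod_nonneg base_nonneg) (auto simp: prop_hat_cnt)
    have "L = complete_likelihood \<nu> b n d \<theta>c x ?y ?v"
      by (simp add: L_def complete_likelihood_def)
    also have "\<dots> \<le> (\<Sum>w\<in>{..<d} \<rightarrow>\<^sub>E UNIV. complete_likelihood \<nu> b n d \<theta>c x ?y w)"
      by (rule member_le_sum[where f = "\<lambda>w. complete_likelihood \<nu> b n d \<theta>c x ?y w"])
        (auto intro!: finite_PiE cl0)
    also have "\<dots> \<le> observed_likelihood \<nu> b n d \<theta>c x"
      unfolding observed_likelihood_def
      by (rule member_le_sum[where f = "\<lambda>z. \<Sum>w\<in>{..<d} \<rightarrow>\<^sub>E UNIV. complete_likelihood \<nu> b n d \<theta>c x z w"])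
        (auto intro!: finite_PiE cl0 sum_nonneg)
    finally show ?thesis .
  qed
  also have "\<dots> \<le> observed_likelihood \<nu> b n d \<theta> x"
    using mle inT by (simp add: is_mle_def)
  also note obs
  also have "(\<Sum>s\<in>?S. \<Sum>t\<in>?T. ?cl (perm_param s t \<theta>)) + ?cl (prop_hat n y, prop_hat d v, A) * \<delta>
      \<le> (\<Sum>s\<in>?S. \<Sum>t\<in>?T. L * e s t) + L * \<delta>"
    using \<delta> clA by (intro add_mono sum_mono mult_right_mono) (auto intro: cl)
  also have "\<dots> = L * ((\<Sum>s\<in>?S. \<Sum>t\<in>?T. e s t) + \<delta>)"
    by (simp add: distrib_left sum_distrib_left)
  finally have "1 \<le> (\<Sum>s\<in>?S. \<Sum>t\<in>?T. e s t) + \<delta>"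
    using L by (simp add: mult_le_cancel_left1)
  then have main: "1 - \<delta> \<le> (\<Sum>st\<in>?S \<times> ?T. e (fst st) (snd st))"
    by (simp add: sum.cartesian_product case_prod_beta)
  \<comment> \<open>Half of \<open>\<eta>\<close> is lost because the excess is measured from
    \<open>\<theta>c\<close>, which is only known to lie within \<open>\<eta> / 2\<close> of
    \<open>\<theta>0\<close>.\<close>
  have fard: "e s t \<le> f" if "\<eta> \<le> dist (perm_param s t \<theta>) \<theta>0" for s t
  proof -
    have "\<eta> / 2 \<le> dist (perm_param s t \<theta>) \<theta>c"
      using dist_triangle[of "perm_param s t \<theta>" \<theta>0 \<theta>c] that \<eta> by linarith
    then have "\<kappa>' * real (min n d) * (\<eta> / 2)\<^sup>2 \<le> \<kappa>' * real (min n d) * (dist (perm_param s t \<theta>) \<theta>c)\<^sup>2"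
      using \<kappa> \<eta> by (intro mult_left_mono power_mono) auto
    also have "\<dots> \<le> excess \<kappa>' n d (perm_param s t \<theta>) \<theta>c"
      using nd \<kappa> by (intro excess_ge) auto
    finally show ?thesis by (simp add: e_def f_def)
  qed
  have card: "real (card (?S \<times> ?T)) * f \<le> \<delta>"
    using far by (simp add: f_def card_cartesian_product)
  have f0: "f \<ge> 0" by (simp add: f_def)
  show "\<exists>s t. bij s \<and> bij t \<and> dist (perm_param s t \<theta>) \<theta>0 < \<eta>"
  proof (rule ccontr)
    assume "\<not> ?thesis"
    then have "(\<Sum>st\<in>?S \<times> ?T. e (fst st) (snd st)) \<le> (\<Sum>st\<in>?S \<times> ?T. f)"
      by (intro sum_mono fard) (auto simp: not_less)
    also have "\<dots> \<le> \<delta>" using card by simp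
    finally show False using main \<delta> by linarith
  qed
  fix s t assume st: "bij s" "bij t" "dist (perm_param s t \<theta>) \<theta>0 < \<eta>"
  have "(\<Sum>st\<in>?S \<times> ?T. e (fst st) (snd st))
      = e s t + (\<Sum>st\<in>?S \<times> ?T - {(s, t)}. e (fst st) (snd st))"
    using st by (subst sum.remove[of _ "(s, t)"]) auto
  also have "(\<Sum>st\<in>?S \<times> ?T - {(s, t)}. e (fst st) (snd st)) \<le> (\<Sum>st\<in>?S \<times> ?T - {(s, t)}. f)"
  proof (intro sum_mono fard)
    fix st assume "st \<in> ?S \<times> ?T - {(s, t)}"
    then show "\<eta> \<le> dist (perm_param (fst st) (snd st) \<theta>) \<theta>0"
      using perm_close_unique[OF sym st, of "fst st" "snd st"] by (force simp: not_less[symmetric])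
  qed
  also have "\<dots> \<le> (\<Sum>st\<in>?S \<times> ?T. f)"
    using f0 by (intro sum_mono2) auto
  also have "\<dots> \<le> \<delta>" using card by simp
  finally have "1 - 2 * \<delta> \<le> e s t" using main by simp
  \<comment> \<open>\<open>\<delta> \<le> 1 / 4\<close> keeps the argument of the logarithm
    positive.\<close>
  then have "ln (1 - 2 * \<delta>) \<le> ln (e s t)"
    using \<delta> by (subst ln_le_cancel_iff) (auto simp: e_def)
  then show "excess \<kappa>' n d (perm_param s t \<theta>) \<theta>c \<le> - ln (1 - 2 * \<delta>)"
    by (simp add: e_def)
qed

end

end

section \<open>Random assignments and the joint law\<close>

lemma pmf_embed_vec:
  assumes "prob_vector p"
  shows "pmf (embed_pmf (\<lambda>k. p $ k)) k = p $ k"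
proof (rule pmf_embed_pmf)
  show "(\<integral>\<^sup>+x. ennreal (p $ x) \<partial>count_space UNIV) = 1"
    using assms by (simp add: nn_integral_count_space_finite prob_vector_def sum_ennreal)
qed (use assms in \<open>simp add: prob_vector_def\<close>)

text \<open>The number of indices with label \<open>k\<close> is binomial, so Hoeffding's inequality
  for the binomial distribution applies.\<close>

lemma label_pmf_deviation:
  assumes p: "prob_vector p" and n: "n > 0" and \<eta>: "\<eta> \<ge> 0"
  shows "measure_pmf.prob (label_pmf n p) {z. \<bar>prop_hat n z $ k - p $ k\<bar> \<ge> \<eta>} \<le> 2 * exp (- 2 * real n * \<eta>\<^sup>2)"
proof -
  let ?e = "embed_pmf (\<lambda>k. p $ k)"
  have pk: "p $ k \<in> {0..1}"
    using p member_le_sum[of k UNIV "\<lambda>k. p $ k"] by (auto simp: prob_vector_def)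
  interpret binomial_distribution n "p $ k" by unfold_locales (rule pk)
  have bern: "map_pmf (\<lambda>k'. k' = k) ?e = bernoulli_pmf (p $ k)"
  proof (rule pmf_eqI)
    have True_case: "pmf (map_pmf (\<lambda>k'. k' = k) ?e) True = p $ k"
      using pmf_embed_vec[OF assms(1), of k] by (simp add: pmf_map vimage_def measure_pmf_single)
    show "pmf (map_pmf (\<lambda>k'. k' = k) ?e) i = pmf (bernoulli_pmf (p $ k)) i" for i
      using True_case pk pmf_False_conv_True[of "map_pmf (\<lambda>k'. k' = k) ?e"] by (cases i) auto
  qed
  \<comment> \<open>Outside the index range the labels equal \<open>undefined\<close>, so the
    default of the Boolean product is the truth value of \<open>undefined = k\<close>.\<close>
  have "binomial_pmf n (p $ k)
      = map_pmf (\<lambda>f. card {i \<in> {..<n}. f i}) (Pi_pmf {..<n} (undefined = k) (\<lambda>_. bernoulli_pmf (p $ k)))"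
    by (rule binomial_pmf_altdef') (use pk in auto)
  also have "Pi_pmf {..<n} (undefined = k) (\<lambda>_. bernoulli_pmf (p $ k))
      = map_pmf (\<lambda>h. (\<lambda>k'. k' = k) \<circ> h) (label_pmf n p)"
    unfolding label_pmf_def bern[symmetric] by (rule Pi_pmf_map) auto
  finally have "binomial_pmf n (p $ k) = map_pmf (\<lambda>z. cnt n z k) (label_pmf n p)"
    by (simp add: pmf.map_comp o_def cnt_def)
  then have "measure_pmf.prob (label_pmf n p) {z. \<bar>prop_hat n z $ k - p $ k\<bar> \<ge> \<eta>}
      = measure_pmf.prob (binomial_pmf n (p $ k)) {x. \<bar>real x / n - p $ k\<bar> \<ge> \<eta>}"
    by (simp add: prop_hat_cnt vimage_def)
  also have "\<dots> \<le> 2 * exp (- 2 * real n * \<eta>\<^sup>2)"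
    using prob_abs_ge'[OF n \<eta>] by simp
  finally show ?thesis .
qed

lemma label_pair_deviation:
  fixes p :: "real ^ 'g::finite" and r :: "real ^ 'm::finite"
  assumes "prob_vector p" "prob_vector r" "n > 0" "d > 0" "\<eta> \<ge> 0"
  shows "measure_pmf.prob (pair_pmf (label_pmf n p) (label_pmf d r))
      (- {(z, w). (\<forall>k. \<bar>prop_hat n z $ k - p $ k\<bar> < \<eta>) \<and> (\<forall>l. \<bar>prop_hat d w $ l - r $ l\<bar> < \<eta>)})
    \<le> real CARD('g) * (2 * exp (- 2 * real n * \<eta>\<^sup>2)) + real CARD('m) * (2 * exp (- 2 * real d * \<eta>\<^sup>2))"
proof -
  let ?Q = "pair_pmf (label_pmf n p) (label_pmf d r)"
  let ?E = "\<lambda>k. {zw. \<bar>prop_hat n (fst zw) $ k - p $ k\<bar> \<ge> \<eta>} :: ((nat \<Rightarrow> 'g) \<times> (nat \<Rightarrow> 'm)) set"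
  let ?F = "\<lambda>l. {zw. \<bar>prop_hat d (snd zw) $ l - r $ l\<bar> \<ge> \<eta>} :: ((nat \<Rightarrow> 'g) \<times> (nat \<Rightarrow> 'm)) set"
  have E: "measure_pmf.prob ?Q (?E k) \<le> 2 * exp (- 2 * real n * \<eta>\<^sup>2)" for k
  proof -
    have "measure_pmf.prob ?Q (?E k) = measure_pmf.prob (map_pmf fst ?Q) {z. \<bar>prop_hat n z $ k - p $ k\<bar> \<ge> \<eta>}"
      by (simp add: vimage_def)
    then show ?thesis using label_pmf_deviation[OF assms(1,3,5)] by (simp add: map_fst_pair_pmf)
  qed
  have F: "measure_pmf.prob ?Q (?F l) \<le> 2 * exp (- 2 * real d * \<eta>\<^sup>2)" for l
  proof -
    have "measure_pmf.prob ?Q (?F l) = measure_pmf.prob (map_pmf snd ?Q) {z. \<bar>prop_hat d z $ l - r $ l\<bar> \<ge> \<eta>}"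
      by (simp add: vimage_def)
    then show ?thesis using label_pmf_deviation[OF assms(2,4,5)] by (simp add: map_snd_pair_pmf)
  qed
  have "measure_pmf.prob ?Q (- {(z, w). (\<forall>k. \<bar>prop_hat n z $ k - p $ k\<bar> < \<eta>) \<and> (\<forall>l. \<bar>prop_hat d w $ l - r $ l\<bar> < \<eta>)})
      \<le> measure_pmf.prob ?Q ((\<Union>k. ?E k) \<union> (\<Union>l. ?F l))"
    by (intro measure_pmf.finite_measure_mono) (auto simp: not_less)
  also have "\<dots> \<le> measure_pmf.prob ?Q (\<Union>k. ?E k) + measure_pmf.prob ?Q (\<Union>l. ?F l)"
    by (intro measure_Un_le) auto
  also have "\<dots> \<le> (\<Sum>k\<in>UNIV. measure_pmf.prob ?Q (?E k)) + (\<Sum>l\<in>UNIV. measure_pmf.prob ?Q (?F l))"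
    by (intro add_mono measure_pmf.finite_measure_subadditive_finite) auto
  also have "\<dots> \<le> (\<Sum>k\<in>(UNIV::'g set). 2 * exp (- 2 * real n * \<eta>\<^sup>2)) + (\<Sum>l\<in>(UNIV::'m set). 2 * exp (- 2 * real d * \<eta>\<^sup>2))"
    by (intro add_mono sum_mono E F)
  finally show ?thesis by simp
qed

section \<open>Limits of the error terms\<close>

lemma exp_neg_tendsto_0:
  fixes a :: real
  assumes "a > 0" "filterlim X at_top F"
  shows "((\<lambda>i. exp (- a * X i)) \<longlongrightarrow> 0) F"
proof -
  have "filterlim (\<lambda>i. a * X i) at_top F"
    by (rule filterlim_tendsto_pos_mult_at_top[OF tendsto_const assms])
  then show ?thesis
    by (intro filterlim_compose[OF exp_at_bot]) (simp add: filterlim_uminus_at_bot)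
qed

text \<open>This is where the size condition enters: \<open>ln N = o(D)\<close> makes any power of
  \<open>N * D\<close> equal to \<open>exp (o(D))\<close>, which the exponential decay in
  \<open>D\<close> outweighs. The other size condition enters through the same lemma with
  \<open>N\<close> and \<open>D\<close> exchanged.\<close>

lemma poly_times_exp_tendsto_0:
  fixes N D :: "nat \<Rightarrow> nat"
  assumes "filterlim N at_top sequentially" "filterlim D at_top sequentially"
    and "(\<lambda>i. ln (real (N i)) / real (D i)) \<longlonglongrightarrow> 0" and e: "e > 0"
  shows "(\<lambda>i. (real (N i) * real (D i)) ^ k * exp (- e * real (D i))) \<longlonglongrightarrow> 0"
proof -
  have D: "filterlim (\<lambda>i. real (D i)) at_top sequentially"
    using assms(2) filterlim_real_sequentially filterlim_compose by blast
  have "(\<lambda>i. ln (real (D i)) / real (D i)) \<longlonglongrightarrow> 0"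
    using filterlim_compose[OF ln_x_over_x_tendsto_0 D] by simp
  then have "(\<lambda>i. e - real k * (ln (real (N i)) / real (D i)) - real k * (ln (real (D i)) / real (D i))) \<longlonglongrightarrow> e - real k * 0 - real k * 0"
    by (intro tendsto_intros assms)
  then have "filterlim (\<lambda>i. (e - real k * (ln (real (N i)) / real (D i)) - real k * (ln (real (D i)) / real (D i))) * real (D i)) at_top sequentially"
    by (intro filterlim_tendsto_pos_mult_at_top[OF _ _ D]) (use e in auto)
  then have "(\<lambda>i. exp (- ((e - real k * (ln (real (N i)) / real (D i)) - real k * (ln (real (D i)) / real (D i))) * real (D i)))) \<longlonglongrightarrow> 0"
    by (intro filterlim_compose[OF exp_at_bot]) (simp add: filterlim_uminus_at_bot)
  moreover have "eventually (\<lambda>i. exp (- ((e - real k * (ln (real (N i)) / real (D i)) - real k * (ln (real (D i)) / real (D i))) * real (D i)))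
      = (real (N i) * real (D i)) ^ k * exp (- e * real (D i))) sequentially"
  proof -
    have "eventually (\<lambda>i. N i \<ge> 1) sequentially" "eventually (\<lambda>i. D i \<ge> 1) sequentially"
      using assms(1,2) by (auto simp: filterlim_at_top)
    then show ?thesis
    proof eventually_elim
      case (elim i)
      have "- ((e - real k * (ln (real (N i)) / real (D i)) - real k * (ln (real (D i)) / real (D i))) * real (D i))
          = real k * (ln (real (N i)) + ln (real (D i))) + - e * real (D i)"
        using elim by (simp add: field_simps)
      moreover have "exp (real k * (ln (real (N i)) + ln (real (D i)))) = (real (N i) * real (D i)) ^ k"
        using elim by (simp add: exp_of_nat_mult exp_add)
      ultimately show ?case by (simp only: exp_add)
    qed
  qed
  ultimately show ?thesis by (rule Lim_transform_eventually)
qed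

text \<open>The exponent \<open>u\<close> is eventually below 1, so
  \<open>exp u - 1 \<le> 2 * u\<close>, and \<open>u\<close> is at most \<open>N * D\<close> times
  decaying exponentials. The polynomial prefactor, which stands for the cardinality of the grid,
  only raises the power of \<open>N * D\<close>.\<close>

lemma union_bound_tendsto_0:
  fixes N D :: "nat \<Rightarrow> nat"
  assumes ND: "filterlim N at_top sequentially" "filterlim D at_top sequentially"
    and lnD: "(\<lambda>i. ln (real (D i)) / real (N i)) \<longlonglongrightarrow> 0"
    and lnN: "(\<lambda>i. ln (real (N i)) / real (D i)) \<longlonglongrightarrow> 0" and e: "e > 0" and C: "C1 \<ge> 0" "C2 \<ge> 0"
  shows "(\<lambda>i. (real (N i) * real (D i) + 1) ^ k *
    (exp (real (N i) * (C1 * exp (- e * real (D i))) + real (D i) * (C2 * exp (- e * real (N i)))) - 1)) \<longlonglongrightarrow> 0"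
proof -
  define u where "u = (\<lambda>i. real (N i) * (C1 * exp (- e * real (D i))) + real (D i) * (C2 * exp (- e * real (N i))))"
  define B where "B = (\<lambda>j i. (real (N i) * real (D i)) ^ j * (C1 * exp (- e * real (D i)) + C2 * exp (- e * real (N i))))"
  have B0: "B j \<longlonglongrightarrow> 0" for j
  proof -
    have "(\<lambda>i. C1 * ((real (N i) * real (D i)) ^ j * exp (- e * real (D i)))
        + C2 * ((real (D i) * real (N i)) ^ j * exp (- e * real (N i)))) \<longlonglongrightarrow> C1 * 0 + C2 * 0"
      by (intro tendsto_intros poly_times_exp_tendsto_0 assms)
    then show ?thesis by (simp add: B_def algebra_simps)
  qed
  have pos: "eventually (\<lambda>i. N i \<ge> 1) sequentially" "eventually (\<lambda>i. D i \<ge> 1) sequentially"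
    using ND by (auto simp: filterlim_at_top)
  have small: "eventually (\<lambda>i. B 1 i < 1) sequentially"
    using order_tendstoD(2)[OF B0[of 1], of 1] by simp
  have u0: "u i \<ge> 0" for i using C by (simp add: u_def)
  have bound: "eventually (\<lambda>i. norm ((real (N i) * real (D i) + 1) ^ k * (exp (u i) - 1)) \<le> 2 ^ (k + 1) * B (k + 1) i) sequentially"
    using pos small
  proof eventually_elim
    case (elim i)
    let ?M = "real (N i) * real (D i)"
    have ge: "real (N i) \<le> ?M" "real (D i) \<le> ?M" "1 \<le> ?M"
      using elim mult_left_mono[of 1 "real (D i)" "real (N i)"] mult_right_mono[of 1 "real (N i)" "real (D i)"]
        mult_mono[of 1 "real (N i)" 1 "real (D i)"]
      by auto
    have uB: "u i \<le> ?M * (C1 * exp (- e * real (D i)) + C2 * exp (- e * real (N i)))"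
      unfolding u_def distrib_left using C ge by (intro add_mono mult_right_mono) auto
    then have "u i \<le> 1" using elim(3) by (simp add: B_def)
    then have "exp (u i) \<le> 1 + u i + (u i)\<^sup>2" using u0 by (intro exp_bound) auto
    also have "(u i)\<^sup>2 \<le> u i" using u0[of i] \<open>u i \<le> 1\<close> by (simp add: power2_eq_square mult_left_le)
    finally have "exp (u i) - 1 \<le> 2 * u i" by simp
    also have "\<dots> \<le> 2 * (?M * (C1 * exp (- e * real (D i)) + C2 * exp (- e * real (N i))))"
      using uB by simp
    finally have "(?M + 1) ^ k * (exp (u i) - 1) \<le> (2 * ?M) ^ k * (2 * (?M * (C1 * exp (- e * real (D i)) + C2 * exp (- e * real (N i)))))"
      using ge u0[of i] by (intro mult_mono power_mono) (auto simp: mult.commute)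
    also have "\<dots> = 2 ^ (k + 1) * B (k + 1) i"
      by (simp add: B_def power_mult_distrib mult_ac)
    finally show ?case using u0[of i] by (simp add: abs_mult)
  qed
  have "(\<lambda>i. 2 ^ (k + 1) * B (k + 1) i) \<longlonglongrightarrow> 2 ^ (k + 1) * 0"
    by (intro tendsto_intros B0)
  then have "(\<lambda>i. (real (N i) * real (D i) + 1) ^ k * (exp (u i) - 1)) \<longlonglongrightarrow> 0"
    using Lim_null_comparison[OF bound] by simp
  then show ?thesis by (simp add: u_def)
qed

section \<open>Conditioning the joint law on the labels\<close>

context exp_family begin

context
  fixes p :: "real ^ 'g::finite" and r :: "real ^ 'm::finite" and A :: "real ^ 'm ^ 'g"
  assumes A_K: "\<And>k l. A $ k $ l \<in> K"
begin

abbreviation "joint_space n d \<equiv>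
  data_space n d \<Otimes>\<^sub>M ((count_space UNIV :: (nat \<Rightarrow> 'g) measure) \<Otimes>\<^sub>M (count_space UNIV :: (nat \<Rightarrow> 'm) measure))"

abbreviation "labels n d \<equiv> pair_pmf (label_pmf n p) (label_pmf d r)"

abbreviation "kern n d \<equiv> (\<lambda>(z, w). distr (data_law_given \<nu> b n d A z w) (joint_space n d) (\<lambda>x. (x, z, w)))"

lemma section_measurable: "(\<lambda>x. (x, z, w)) \<in> data_law_given \<nu> b n d A z w \<rightarrow>\<^sub>M joint_space n d"
  unfolding measurable_cong_sets[OF sets_data_law[OF A_K] refl] by measurable

text \<open>The labels are discrete, so any family of probability measures indexed by them is a
  measurable kernel.\<close>

lemma kern_measurable: "kern n d \<in> measure_pmf (labels n d) \<rightarrow>\<^sub>M subprob_algebra (joint_space n d)"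
proof -
  have "kern n d zw \<in> space (subprob_algebra (joint_space n d))" for zw
  proof -
    obtain z w where zw: "zw = (z, w)" by (cases zw)
    interpret prob_space "data_law_given \<nu> b n d A z w" by (rule prob_space_data_law[OF A_K])
    show ?thesis
      unfolding zw prod.case space_subprob_algebra
      using prob_space_distr[OF section_measurable] prob_space_imp_subprob_space by auto
  qed
  then show ?thesis by (simp add: measurable_pmf_measure1)
qed

lemma lbm_law_eq: "lbm_law \<nu> b n d (p, r, A) = measure_pmf (labels n d) \<bind> kern n d"
  by (simp add: lbm_law_def)

lemma sets_lbm_law [measurable_cong, simp]: "sets (lbm_law \<nu> b n d (p, r, A)) = sets (joint_space n d)"
  unfolding lbm_law_eq by (rule sets_bind_measurable[OF kern_measurable]) simp

text \<open>The joint probability is the mean of the conditional one, which is at most 1 outside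
  \<open>T\<close>. The bound is asked only for labels of positive probability because statements
  holding almost surely for the observed data pass to the conditional law only there.\<close>

lemma lbm_measure_le:
  assumes G: "G \<in> sets (joint_space n d)" and u: "u \<ge> 0"
    and T: "\<And>z w. (z, w) \<in> T \<Longrightarrow> (z, w) \<in> set_pmf (labels n d) \<Longrightarrow>
      measure (data_law_given \<nu> b n d A z w) {x \<in> space (data_space n d). (x, z, w) \<in> G} \<le> u"
  shows "measure (lbm_law \<nu> b n d (p, r, A)) G \<le> u + measure_pmf.prob (labels n d) (- T)"
proof -
  let ?Q = "labels n d"
  have "measure (lbm_law \<nu> b n d (p, r, A)) G = (\<integral>zw. measure (kern n d zw) G \<partial>measure_pmf ?Q)"
    unfolding lbm_law_eq by (rule measure_pmf.measure_bind[OF kern_measurable G])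
  also have "\<dots> \<le> (\<integral>zw. u + indicator (- T) zw \<partial>measure_pmf ?Q)"
  proof (rule integral_mono_AE)
    have ms: "measure (kern n d (z, w)) G = measure (data_law_given \<nu> b n d A z w) {x \<in> space (data_space n d). (x, z, w) \<in> G}" for z w
      unfolding prod.case by (subst measure_distr[OF section_measurable G])
        (simp add: vimage_def Int_def conj_commute space_data_law[OF A_K])
    have le1: "measure (kern n d zw) G \<le> 1" for zw
      using prob_space.prob_le_1[OF prob_space_data_law[OF A_K]] ms by (cases zw) simp
    show "integrable (measure_pmf ?Q) (\<lambda>zw. measure (kern n d zw) G)"
      by (rule measure_pmf.integrable_const_bound[where B = 1]) (use le1 in auto)
    show "integrable (measure_pmf ?Q) (\<lambda>zw. u + indicator (- T) zw)"
      by (intro Bochner_Integration.integrable_add integrable_const integrable_real_indicator)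
        (auto simp: less_top[symmetric] measure_pmf.emeasure_finite)
    show "AE zw in measure_pmf ?Q. measure (kern n d zw) G \<le> u + indicator (- T) zw"
    proof (rule AE_pmfI)
      fix zw assume "zw \<in> set_pmf ?Q"
      then show "measure (kern n d zw) G \<le> u + indicator (- T) zw"
        using T[of "fst zw" "snd zw"] ms[of "fst zw" "snd zw"] le1[of zw] u
        by (cases "zw \<in> T") (auto simp: case_prod_beta)
    qed
  qed
  also have "\<dots> = u + measure_pmf.prob ?Q (- T)"
    by (subst Bochner_Integration.integral_add)
      (auto simp: less_top[symmetric] measure_pmf.emeasure_finite intro!: integrable_real_indicator)
  finally show ?thesis .
qed

text \<open>A null set of a discrete mixture is null for each component of positive weight. As
  \<open>Pr\<close> is not assumed measurable, the argument runs through a measurable null set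
  \<open>X\<close> containing its failures.\<close>

lemma observed_AE_section:
  assumes "AE x in observed_law \<nu> b n d (p, r, A). Pr x" "(z, w) \<in> set_pmf (labels n d)"
  shows "AE x in data_law_given \<nu> b n d A z w. Pr x"
proof -
  let ?L = "lbm_law \<nu> b n d (p, r, A)"
  have fm: "fst \<in> ?L \<rightarrow>\<^sub>M data_space n d"
    unfolding measurable_cong_sets[OF sets_lbm_law refl] by measurable
  obtain X where X: "X \<in> null_sets (observed_law \<nu> b n d (p, r, A))"
      "{x \<in> space (observed_law \<nu> b n d (p, r, A)). \<not> Pr x} \<subseteq> X"
    using assms(1) by (auto simp: eventually_ae_filter)
  have Xs: "X \<in> sets (data_space n d)" using X(1) by (auto simp: observed_law_def)
  have sp: "space (observed_law \<nu> b n d (p, r, A)) = space (data_space n d)" by (simp add: observed_law_def)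
  have "AE x in observed_law \<nu> b n d (p, r, A). x \<notin> X" using X(1) by (rule AE_not_in)
  then have "AE \<omega> in ?L. fst \<omega> \<notin> X"
    unfolding observed_law_def by (rule AE_distrD[OF fm])
  moreover have "Measurable.pred (joint_space n d) (\<lambda>\<omega>. fst \<omega> \<notin> X)"
    using Xs by measurable
  ultimately have "AE zw in measure_pmf (labels n d). AE \<omega> in kern n d zw. fst \<omega> \<notin> X"
    unfolding lbm_law_eq by (simp add: AE_bind[OF kern_measurable])
  then have "AE \<omega> in kern n d (z, w). fst \<omega> \<notin> X"
    using assms(2) by (auto simp: AE_measure_pmf_iff)
  then have "AE x in data_law_given \<nu> b n d A z w. x \<notin> X"
    unfolding prod.case using AE_distrD[OF section_measurable] by force
  then show ?thesis
  proof (rule AE_mp, intro AE_I2 impI)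
    fix x assume "x \<in> space (data_law_given \<nu> b n d A z w)" "x \<notin> X"
    then show "Pr x" using X(2) unfolding sp by (auto simp: space_data_law[OF A_K])
  qed
qed

end

end

section \<open>The exceptional event\<close>

text \<open>The empty case does occur: with a single label there are no pairs of distinct
  rows.\<close>

lemma finite_pos_lower_bound:
  fixes f :: "'a \<Rightarrow> real"
  assumes "finite S" "\<And>x. x \<in> S \<Longrightarrow> f x > 0"
  obtains m where "m > 0" "\<And>x. x \<in> S \<Longrightarrow> m \<le> f x"
proof (cases "S = {}")
  case True
  then show thesis using that[of 1] by simp
next
  case False
  show thesis
  proof (rule that[of "Min (f ` S)"])
    show "Min (f ` S) > 0" using assms False by simp
  qed (use assms in auto)
qed

text \<open>A product grid with \<open>M + 1\<close> equally spaced values per entry. With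
  \<open>M = n * d\<close> its cardinality is polynomial in \<open>n * d\<close> and its mesh is of
  order \<open>1 / (n * d)\<close>.\<close>

definition grid :: "real \<Rightarrow> real \<Rightarrow> nat \<Rightarrow> (real ^ 'm::finite ^ 'g::finite) set" where
  "grid a0 b0 M = (\<lambda>f. \<chi> k l. a0 + (b0 - a0) * real (f (k, l)) / real M) ` (UNIV \<rightarrow>\<^sub>E {..M})"

lemma finite_grid [simp]: "finite (grid a0 b0 M :: (real ^ 'm::finite ^ 'g::finite) set)"
  unfolding grid_def by (intro finite_imageI finite_PiE) auto

lemma card_grid_le: "card (grid a0 b0 M :: (real ^ 'm::finite ^ 'g::finite) set) \<le> (M + 1) ^ (CARD('g) * CARD('m))"
proof -
  have "card (grid a0 b0 M :: (real ^ 'm ^ 'g) set) \<le> card ((UNIV :: ('g \<times> 'm) set) \<rightarrow>\<^sub>E {..M})"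
    unfolding grid_def by (intro card_image_le finite_PiE) auto
  also have "\<dots> = (M + 1) ^ CARD('g \<times> 'm)" by (simp add: card_PiE)
  finally show ?thesis by simp
qed

lemma grid_box:
  assumes "a' \<in> grid a0 b0 M" "a0 \<le> b0"
  shows "a' $ k $ l \<in> {a0..b0}"
proof -
  obtain f where f: "f \<in> UNIV \<rightarrow>\<^sub>E {..M}" "a' = (\<chi> k l. a0 + (b0 - a0) * real (f (k, l)) / real M)"
    using assms(1) by (auto simp: grid_def)
  have "f (k, l) \<le> M" using f(1) by (auto simp: PiE_iff)
  then have "0 \<le> real (f (k, l)) / real M" "real (f (k, l)) / real M \<le> 1"
    by (auto simp: divide_le_eq_1)
  then have "0 \<le> (b0 - a0) * (real (f (k, l)) / real M)" "(b0 - a0) * (real (f (k, l)) / real M) \<le> b0 - a0"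
    using assms(2) mult_left_le[of "real (f (k, l)) / real M" "b0 - a0"] by auto
  then show ?thesis by (simp add: f(2))
qed

lemma grid_approx:
  fixes a :: "real ^ 'm::finite ^ 'g::finite"
  assumes "\<And>k l. a $ k $ l \<in> {a0..b0}" "a0 < b0" "M > 0"
  obtains a' where "a' \<in> grid a0 b0 M" "\<And>k l. \<bar>a $ k $ l - a' $ k $ l\<bar> \<le> (b0 - a0) / real M"
proof -
  have "\<exists>q\<le>M. \<bar>u - (a0 + (b0 - a0) * real q / real M)\<bar> \<le> (b0 - a0) / real M" if u: "u \<in> {a0..b0}" for u
  proof -
    define t where "t = (u - a0) / (b0 - a0) * real M"
    have t: "0 \<le> t" "t \<le> real M" using u assms(2,3) by (auto simp: t_def divide_le_eq mult_left_le_one_le)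
    define q where "q = nat \<lfloor>t\<rfloor>"
    have q: "real q \<le> t" "t < real q + 1" using t(1) by (auto simp: q_def)
    have uq: "u - (a0 + (b0 - a0) * real q / real M) = (b0 - a0) / real M * (t - real q)"
      using assms(2,3) by (simp add: t_def field_simps)
    have "\<bar>t - real q\<bar> \<le> 1" using q by auto
    then have "\<bar>(b0 - a0) / real M * (t - real q)\<bar> \<le> (b0 - a0) / real M"
      using assms(2,3) mult_left_le[of "\<bar>t - real q\<bar>" "(b0 - a0) / real M"] by (simp add: abs_mult)
    moreover have "q \<le> M" using q(1) t(2) by linarith
    ultimately show ?thesis using uq by metis
  qed
  then obtain q where q: "\<And>u. u \<in> {a0..b0} \<Longrightarrow> q u \<le> M"
      "\<And>u. u \<in> {a0..b0} \<Longrightarrow> \<bar>u - (a0 + (b0 - a0) * real (q u) / real M)\<bar> \<le> (b0 - a0) / real M"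
    by metis
  show thesis
  proof (rule that[of "\<chi> k l. a0 + (b0 - a0) * real (q (a $ k $ l)) / real M"])
    show "(\<chi> k l. a0 + (b0 - a0) * real (q (a $ k $ l)) / real M) \<in> grid a0 b0 M"
      unfolding grid_def
      by (rule image_eqI[of _ _ "\<lambda>(k, l). q (a $ k $ l)"]) (use q(1) assms(1) in \<open>auto simp: PiE_iff\<close>)
  qed (use q(2) assms(1) in auto)
qed

context exp_family begin

context
  fixes A :: "real ^ 'm::finite ^ 'g::finite" and a0 b0 \<kappa> K1 c \<gamma> \<eta>1 \<Delta> :: real
  assumes box: "a0 \<in> I" "b0 \<in> I" "a0 < b0"
    and sc: "\<kappa> > 0" "\<And>x y. x \<in> {a0..b0} \<Longrightarrow> y \<in> {a0..b0} \<Longrightarrow> \<psi> y \<ge> \<psi> x + \<mu> x * (y - x) + \<kappa> * (y - x)\<^sup>2"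
    and K1: "\<And>n d z w. measure (data_law_given \<nu> b n d A z w)
      {x \<in> space (data_space n d). (\<Sum>i<n. \<Sum>j<d. \<bar>x (i, j)\<bar>) > K1 * (real n * real d)} \<le> exp (- (real n * real d))"
    and \<eta>1: "\<eta>1 > 0" "\<And>k l. A $ k $ l - \<eta>1 \<in> {a0..b0}" "\<And>k l. A $ k $ l + \<eta>1 \<in> {a0..b0}"
    and c: "c > 0" and \<gamma>: "\<gamma> > 0" "\<gamma> \<le> 1"
    and \<Delta>: "\<Delta> > 0" "\<And>k k'. k \<noteq> k' \<Longrightarrow> \<Delta> \<le> (\<Sum>l\<in>UNIV. (A $ k $ l - A $ k' $ l)\<^sup>2)"
      "\<And>l l'. l \<noteq> l' \<Longrightarrow> \<Delta> \<le> (\<Sum>k\<in>UNIV. (A $ k $ l - A $ k $ l')\<^sup>2)"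
begin

text \<open>The Bhattacharyya exponent \<open>\<kappa> / 4\<close> times the constant of
  \<open>block_separation\<close>.\<close>

definition rate :: real where
  "rate = \<kappa> / 4 * (\<gamma>\<^sup>2 * \<Delta> / (8 * real CARD('g) * real CARD('m)))"

text \<open>The summands account for the sum of absolute values, for both tails of all block means,
  and for Markov's inequality applied to \<open>sqrt_ratio_sum\<close> at level
  \<open>\<delta>0\<close> at every grid point.\<close>

definition bad_bound :: "real \<Rightarrow> nat \<Rightarrow> nat \<Rightarrow> real" where
  "bad_bound \<delta>0 n d = exp (- (real n * real d))
    + real CARD('g) * real CARD('m) * (2 * exp (- \<kappa> * \<eta>1\<^sup>2 * \<gamma>\<^sup>2 * (real n * real d)))
    + real (card {s::'g\<Rightarrow>'g. bij s}) * real (card {t::'m\<Rightarrow>'m. bij t}) / \<delta>0 *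
      ((real n * real d + 1) ^ (CARD('g) * CARD('m)) *
      (exp (real n * (real CARD('g) * sqrt (1 / c) * exp (- rate * real d))
          + real d * (real CARD('m) * sqrt (1 / c) * exp (- rate * real n))) - 1))"

lemma A_box: "A $ k $ l \<in> {a0..b0}"
  using \<eta>1(1) \<eta>1(2)[of k l] \<eta>1(3)[of k l] by auto

lemma box_sub_I: "{a0..b0} \<subseteq> I"
  using I_between[OF box(1,2)] by auto

lemma box_sub_K: "{a0..b0} \<subseteq> K"
  using box_sub_I interior_subset by blast

lemma A_in_K: "A $ k $ l \<in> K"
  using A_box box_sub_K by blast

text \<open>The union bound over the grid is affordable since the separation, and with it the bound
  on each mean, is the same for all matrices in the box.\<close>

lemma bad_event:
  assumes nd: "n > 0" "d > 0" and \<delta>0: "\<delta>0 > 0"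
    and cz: "\<And>k. \<gamma> * real n \<le> real (cnt n y k)" and cw: "\<And>l. \<gamma> * real d \<le> real (cnt d v l)"
  obtains B where "B \<in> sets (data_space n d)" "measure (data_law_given \<nu> b n d A y v) B \<le> bad_bound \<delta>0 n d"
    "\<And>x. x \<in> space (data_space n d) - B \<Longrightarrow> (\<Sum>i<n. \<Sum>j<d. \<bar>x (i, j)\<bar>) \<le> K1 * (real n * real d)"
    "\<And>x k l. x \<in> space (data_space n d) - B \<Longrightarrow> \<mu> (A $ k $ l - \<eta>1) < x_hat n d x y v $ k $ l"
    "\<And>x k l. x \<in> space (data_space n d) - B \<Longrightarrow> x_hat n d x y v $ k $ l < \<mu> (A $ k $ l + \<eta>1)"
    "\<And>x a'. x \<in> space (data_space n d) - B \<Longrightarrow> a' \<in> grid a0 b0 (n * d) \<Longrightarrow> sqrt_ratio_sum n d c y v A a' x < \<delta>0"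
proof -
  let ?M = "data_law_given \<nu> b n d A y v" and ?X = "space (data_space n d)"
  interpret prob_space ?M by (rule prob_space_data_law[OF A_in_K])
  have sets: "sets ?M = sets (data_space n d)" by (rule sets_data_law[OF A_in_K])
  define B1 where "B1 = {x \<in> ?X. (\<Sum>i<n. \<Sum>j<d. \<bar>x (i, j)\<bar>) > K1 * (real n * real d)}"
  define B2 where "B2 = (\<lambda>k l \<delta>. {x \<in> ?X. \<delta> * (x_hat n d x y v $ k $ l - \<mu> (A $ k $ l + \<delta>)) \<ge> 0})"
  define B3 where "B3 = (\<lambda>a'. {x \<in> ?X. sqrt_ratio_sum n d c y v A a' x \<ge> \<delta>0})"
  define B where "B = B1 \<union> (\<Union>k. \<Union>l. B2 k l \<eta>1 \<union> B2 k l (- \<eta>1)) \<union> (\<Union>a'\<in>grid a0 b0 (n * d). B3 a')"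
  have sep: "\<gamma>\<^sup>2 * \<Delta> / (8 * real CARD('g) * real CARD('m)) * (real d * real (hmin n y z) + real n * real (hmin d v w))
      \<le> (\<Sum>i<n. \<Sum>j<d. (a $ z i $ w j - A $ y i $ v j)\<^sup>2)" for a z w
    using block_separation[of \<gamma> n y d v \<Delta> "\<lambda>k l. A $ k $ l" z w "\<lambda>k l. a $ k $ l"] \<gamma> cz cw \<Delta> by simp
  have m1: "B1 \<in> sets (data_space n d)"
  proof -
    have [measurable]: "(\<lambda>x. \<Sum>i<n. \<Sum>j<d. \<bar>x (i, j)\<bar>) \<in> borel_measurable (data_space n d)"
      by (intro double_sum_data_space) auto
    show ?thesis unfolding B1_def by measurable
  qed
  have xh: "(\<lambda>x. x_hat n d x y v $ k $ l) \<in> borel_measurable (data_space n d)" for k l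
    unfolding x_hat_def vec_lambda_beta
    using double_sum_data_space[of n d "\<lambda>i j u. u * of_bool (y i = k) * of_bool (v j = l)"]
    by (intro borel_measurable_divide) auto
  have m2: "B2 k l \<delta> \<in> sets (data_space n d)" for k l \<delta>
    unfolding B2_def using xh[of k l] by measurable
  have m2l: "(\<Union>l. B2 k l \<eta>1 \<union> B2 k l (- \<eta>1)) \<in> sets (data_space n d)" for k
    by (intro sets.finite_UN sets.Un m2) auto
  have m2u: "(\<Union>k. \<Union>l. B2 k l \<eta>1 \<union> B2 k l (- \<eta>1)) \<in> sets (data_space n d)"
    by (intro sets.finite_UN sets.Un m2) auto
  have m3: "B3 a' \<in> sets (data_space n d)" if "a' \<in> grid a0 b0 (n * d)" for a'
    unfolding B3_def
    using sqrt_ratio_tail(2)[OF A_in_K sc(2) A_box grid_box[OF that less_imp_le[OF box(3)]] box_sub_K sep c sc(1) \<delta>0]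
    by measurable
  have p2: "prob (B2 k l \<delta>) \<le> exp (- \<kappa> * \<eta>1\<^sup>2 * \<gamma>\<^sup>2 * (real n * real d))" if "\<delta> = \<eta>1 \<or> \<delta> = - \<eta>1" for k l \<delta>
  proof -
    have cp: "cnt n y k > 0" "cnt d v l > 0"
      using \<gamma>(1) cz[of k] cw[of l] nd by (metis mult_pos_pos of_nat_0_less_iff order_less_le_trans)+
    have "A $ k $ l + \<delta> \<in> {a0..b0}" using that \<eta>1(2)[of k l] \<eta>1(3)[of k l] by auto
    then have "prob (B2 k l \<delta>) \<le> exp (- \<kappa> * \<delta>\<^sup>2 * (real (cnt n y k) * real (cnt d v l)))"
      unfolding B2_def using box_sub_K by (intro block_mean_tail[OF A_in_K sc(2) A_box _ _ cp]) auto
    also have "\<dots> \<le> exp (- \<kappa> * \<eta>1\<^sup>2 * \<gamma>\<^sup>2 * (real n * real d))"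
    proof -
      have "(\<gamma> * real n) * (\<gamma> * real d) \<le> real (cnt n y k) * real (cnt d v l)"
        using \<gamma> cz[of k] cw[of l] by (intro mult_mono) auto
      then have "\<kappa> * \<eta>1\<^sup>2 * ((\<gamma> * real n) * (\<gamma> * real d)) \<le> \<kappa> * \<eta>1\<^sup>2 * (real (cnt n y k) * real (cnt d v l))"
        using sc(1) by (intro mult_left_mono) auto
      moreover have "\<delta>\<^sup>2 = \<eta>1\<^sup>2" using that by auto
      moreover have "\<kappa> * \<eta>1\<^sup>2 * ((\<gamma> * real n) * (\<gamma> * real d)) = \<kappa> * \<eta>1\<^sup>2 * \<gamma>\<^sup>2 * (real n * real d)"
        by (simp add: power2_eq_square)
      ultimately show ?thesis by simp
    qed
    finally show ?thesis .
  qed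
  define U where "U = real (card {s::'g\<Rightarrow>'g. bij s}) * real (card {t::'m\<Rightarrow>'m. bij t}) *
      (exp (real n * (real CARD('g) * sqrt (1 / c) * exp (- rate * real d))
          + real d * (real CARD('m) * sqrt (1 / c) * exp (- rate * real n))) - 1)"
  have U0: "U \<ge> 0" unfolding U_def using c by (intro mult_nonneg_nonneg) auto
  have p3: "prob (B3 a') \<le> U / \<delta>0" if "a' \<in> grid a0 b0 (n * d)" for a'
    unfolding B3_def U_def
    using sqrt_ratio_tail(1)[OF A_in_K sc(2) A_box grid_box[OF that less_imp_le[OF box(3)]] box_sub_K sep c sc(1) \<delta>0]
    by (simp add: rate_def mult.assoc)
  have "prob B \<le> prob B1 + prob (\<Union>k. \<Union>l. B2 k l \<eta>1 \<union> B2 k l (- \<eta>1)) + prob (\<Union>a'\<in>grid a0 b0 (n * d). B3 a')"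
  proof -
    have "prob B \<le> prob (B1 \<union> (\<Union>k. \<Union>l. B2 k l \<eta>1 \<union> B2 k l (- \<eta>1))) + prob (\<Union>a'\<in>grid a0 b0 (n * d). B3 a')"
      unfolding B_def by (rule measure_Un_le) (auto simp: sets intro!: sets.Un m1 m2u m3)
    moreover have "prob (B1 \<union> (\<Union>k. \<Union>l. B2 k l \<eta>1 \<union> B2 k l (- \<eta>1)))
        \<le> prob B1 + prob (\<Union>k. \<Union>l. B2 k l \<eta>1 \<union> B2 k l (- \<eta>1))"
      by (rule measure_Un_le) (auto simp: sets intro!: sets.Un m1 m2u m3)
    ultimately show ?thesis by simp
  qed
  also have "prob (\<Union>k. \<Union>l. B2 k l \<eta>1 \<union> B2 k l (- \<eta>1))
      \<le> (\<Sum>k\<in>(UNIV::'g set). \<Sum>l\<in>(UNIV::'m set). 2 * exp (- \<kappa> * \<eta>1\<^sup>2 * \<gamma>\<^sup>2 * (real n * real d)))"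
  proof -
    have "prob (\<Union>k. \<Union>l. B2 k l \<eta>1 \<union> B2 k l (- \<eta>1)) \<le> (\<Sum>k\<in>UNIV. prob (\<Union>l. B2 k l \<eta>1 \<union> B2 k l (- \<eta>1)))"
      by (rule finite_measure_subadditive_finite) (use m2l in \<open>auto simp: sets\<close>)
    also have "\<dots> \<le> (\<Sum>k\<in>UNIV. \<Sum>l\<in>UNIV. prob (B2 k l \<eta>1 \<union> B2 k l (- \<eta>1)))"
      by (intro sum_mono finite_measure_subadditive_finite) (auto simp: sets m2)
    also have "\<dots> \<le> (\<Sum>k\<in>(UNIV::'g set). \<Sum>l\<in>(UNIV::'m set). 2 * exp (- \<kappa> * \<eta>1\<^sup>2 * \<gamma>\<^sup>2 * (real n * real d)))"
    proof (intro sum_mono)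
      fix k l
      have "prob (B2 k l \<eta>1 \<union> B2 k l (- \<eta>1)) \<le> prob (B2 k l \<eta>1) + prob (B2 k l (- \<eta>1))"
        by (rule measure_Un_le) (auto simp: sets m2)
      then show "prob (B2 k l \<eta>1 \<union> B2 k l (- \<eta>1)) \<le> 2 * exp (- \<kappa> * \<eta>1\<^sup>2 * \<gamma>\<^sup>2 * (real n * real d))"
        using p2[of \<eta>1 k l] p2[of "- \<eta>1" k l] by simp
    qed
    finally show ?thesis .
  qed
  also have "prob (\<Union>a'\<in>grid a0 b0 (n * d). B3 a') \<le> (real n * real d + 1) ^ (CARD('g) * CARD('m)) * (U / \<delta>0)"
  proof -
    have "prob (\<Union>a'\<in>grid a0 b0 (n * d). B3 a') \<le> (\<Sum>a'\<in>grid a0 b0 (n * d). prob (B3 a'))"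
      by (rule finite_measure_subadditive_finite) (auto simp: sets m3)
    also have "\<dots> \<le> (\<Sum>a'\<in>(grid a0 b0 (n * d) :: (real ^ 'm ^ 'g) set). U / \<delta>0)" by (intro sum_mono p3)
    also have "\<dots> = real (card (grid a0 b0 (n * d) :: (real ^ 'm ^ 'g) set)) * (U / \<delta>0)" by simp
    also have "\<dots> \<le> real ((n * d + 1) ^ (CARD('g) * CARD('m))) * (U / \<delta>0)"
      using card_grid_le[where ?'g = 'g and ?'m = 'm] U0 \<delta>0 by (intro mult_right_mono) (auto simp: of_nat_le_iff simp del: of_nat_power)
    finally show ?thesis by (simp add: add.commute)
  qed
  also have "prob B1 \<le> exp (- (real n * real d))" unfolding B1_def by (rule K1)
  finally have pB: "prob B \<le> bad_bound \<delta>0 n d"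
    by (simp add: bad_bound_def U_def mult_ac)
  show thesis
  proof (rule that[of B])
    show "B \<in> sets (data_space n d)" unfolding B_def by (auto intro!: sets.Un m1 m2u m3)
    show "prob B \<le> bad_bound \<delta>0 n d" by (rule pB)
    fix x assume x: "x \<in> ?X - B"
    show "(\<Sum>i<n. \<Sum>j<d. \<bar>x (i, j)\<bar>) \<le> K1 * (real n * real d)"
      using x by (auto simp: B_def B1_def not_less)
    have nB2: "x \<notin> B2 k l \<eta>1" "x \<notin> B2 k l (- \<eta>1)" for k l using x by (auto simp: B_def)
    show "\<mu> (A $ k $ l - \<eta>1) < x_hat n d x y v $ k $ l" for k l
      using nB2(2)[of k l] x \<eta>1(1) by (auto simp: B2_def not_le mult_less_0_iff zero_less_mult_iff)
    show "x_hat n d x y v $ k $ l < \<mu> (A $ k $ l + \<eta>1)" for k l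
      using nB2(1)[of k l] x \<eta>1(1) by (auto simp: B2_def not_le mult_less_0_iff zero_less_mult_iff)
    show "sqrt_ratio_sum n d c y v A a' x < \<delta>0" if "a' \<in> grid a0 b0 (n * d)" for a'
      using x that by (auto simp: B_def B3_def not_le)
  qed
qed

lemma bad_bound_tendsto_0:
  fixes N D :: "nat \<Rightarrow> nat"
  assumes ND: "filterlim N at_top sequentially" "filterlim D at_top sequentially"
    and lnD: "(\<lambda>i. ln (real (D i)) / real (N i)) \<longlonglongrightarrow> 0"
    and lnN: "(\<lambda>i. ln (real (N i)) / real (D i)) \<longlonglongrightarrow> 0"
  shows "(\<lambda>i. bad_bound \<delta>0 (N i) (D i)) \<longlonglongrightarrow> 0"
proof -
  have N: "filterlim (\<lambda>i. real (N i)) at_top sequentially" and D: "filterlim (\<lambda>i. real (D i)) at_top sequentially"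
    using ND filterlim_real_sequentially filterlim_compose by blast+
  have NDt: "filterlim (\<lambda>i. real (N i) * real (D i)) at_top sequentially"
    by (rule filterlim_at_top_mult_at_top[OF N D])
  note expt = exp_neg_tendsto_0[OF _ NDt]
  have g: "real CARD('g) > 0" "real CARD('m) > 0" by auto
  have rate: "rate > 0" unfolding rate_def using sc(1) \<gamma> \<Delta> g by (auto intro!: mult_pos_pos divide_pos_pos)
  have "(\<lambda>i. bad_bound \<delta>0 (N i) (D i)) \<longlonglongrightarrow> 0 + real CARD('g) * real CARD('m) * (2 * 0)
    + real (card {s::'g\<Rightarrow>'g. bij s}) * real (card {t::'m\<Rightarrow>'m. bij t}) / \<delta>0 * 0"
    unfolding bad_bound_def
  proof (intro tendsto_intros union_bound_tendsto_0 ND lnD lnN rate)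
    show "(\<lambda>i. exp (- (real (N i) * real (D i)))) \<longlonglongrightarrow> 0" using expt[of 1] by simp
    show "(\<lambda>i. exp (- \<kappa> * \<eta>1\<^sup>2 * \<gamma>\<^sup>2 * (real (N i) * real (D i)))) \<longlonglongrightarrow> 0"
      using expt[of "\<kappa> * \<eta>1\<^sup>2 * \<gamma>\<^sup>2"] sc(1) \<eta>1(1) \<gamma> by simp
  qed (use c in auto)
  then show ?thesis by simp
qed

end

end

section \<open>Asymptotics\<close>

text \<open>The margin \<open>e\<close> leaves room to tilt the parameters in \<open>C\<close>, and
  for estimators to miss them slightly, without leaving the interval between two interior points on
  which the constants of \<open>\<psi>\<close> are taken.\<close>

lemma box_around_compact:
  fixes C S :: "real set"
  assumes "compact C" "C \<noteq> {}" "C \<subseteq> interior S"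
  obtains a0 b0 e where "a0 \<in> interior S" "b0 \<in> interior S" "a0 < b0" "e > 0" "\<And>u. u \<in> C \<Longrightarrow> {u - e..u + e} \<subseteq> {a0..b0}"
proof -
  obtain lo where lo: "lo \<in> C" "\<And>u. u \<in> C \<Longrightarrow> lo \<le> u"
    using compact_attains_inf[OF assms(1,2)] by blast
  obtain hi where hi: "hi \<in> C" "\<And>u. u \<in> C \<Longrightarrow> u \<le> hi"
    using compact_attains_sup[OF assms(1,2)] by blast
  obtain e1 where e1: "e1 > 0" "ball lo e1 \<subseteq> interior S"
    using lo(1) assms(3) open_contains_ball open_interior by blast
  obtain e2 where e2: "e2 > 0" "ball hi e2 \<subseteq> interior S"
    using hi(1) assms(3) open_contains_ball open_interior by blast
  define e where "e = min e1 e2 / 2"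
  show thesis
  proof (rule that[of "lo - e" "hi + e" e])
    show "lo - e \<in> interior S" "hi + e \<in> interior S"
      using e1 e2 by (auto simp: e_def dist_real_def subset_iff)
    show "e > 0" using e1 e2 by (simp add: e_def)
    then show "lo - e < hi + e" using lo(2)[OF hi(1)] by simp
    show "{u - e..u + e} \<subseteq> {lo - e..hi + e}" if "u \<in> C" for u
      using lo(2)[OF that] hi(2)[OF that] by auto
  qed
qed

lemma dist_param_le:
  fixes p :: "real ^ 'g::finite" and r :: "real ^ 'm::finite" and a :: "real ^ 'm ^ 'g"
  assumes "\<And>k. \<bar>p' $ k - p $ k\<bar> \<le> \<eta>" "\<And>l. \<bar>r' $ l - r $ l\<bar> \<le> \<eta>" "\<And>k l. \<bar>a' $ k $ l - a $ k $ l\<bar> \<le> \<eta>"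
  shows "dist (p', r', a') (p, r, a) \<le> (real CARD('g) + real CARD('m) + real CARD('g) * real CARD('m)) * \<eta>"
proof (rule power2_le_imp_le)
  let ?G = "real CARD('g) + real CARD('m) + real CARD('g) * real CARD('m)"
  have \<eta>: "\<eta> \<ge> 0" using assms(1)[of undefined] by linarith
  have sq: "u\<^sup>2 \<le> \<eta>\<^sup>2" if "\<bar>u\<bar> \<le> \<eta>" for u :: real using that power_mono[of "\<bar>u\<bar>" \<eta> 2] by simp
  have G1: "?G \<ge> 1" using card_gt_0_iff[of "UNIV::'g set"] by (auto simp: Suc_le_eq intro!: add_increasing2)
  have "(dist (p', r', a') (p, r, a))\<^sup>2
      \<le> (\<Sum>k\<in>(UNIV::'g set). \<eta>\<^sup>2) + (\<Sum>l\<in>(UNIV::'m set). \<eta>\<^sup>2) + (\<Sum>k\<in>(UNIV::'g set). \<Sum>l\<in>(UNIV::'m set). \<eta>\<^sup>2)"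
    unfolding dist_param_sq
  proof (intro add_mono)
    show "(norm (p' - p))\<^sup>2 \<le> (\<Sum>k\<in>(UNIV::'g set). \<eta>\<^sup>2)"
      unfolding norm_vec_sq by (intro sum_mono) (simp add: sq assms)
    show "(norm (r' - r))\<^sup>2 \<le> (\<Sum>l\<in>(UNIV::'m set). \<eta>\<^sup>2)"
      unfolding norm_vec_sq by (intro sum_mono) (simp add: sq assms)
    show "(norm (a' - a))\<^sup>2 \<le> (\<Sum>k\<in>(UNIV::'g set). \<Sum>l\<in>(UNIV::'m set). \<eta>\<^sup>2)"
      unfolding norm_mat_sq by (intro sum_mono) (simp add: sq assms)
  qed
  also have "\<dots> = ?G * \<eta>\<^sup>2" by (simp add: algebra_simps)
  also have "\<dots> \<le> ?G\<^sup>2 * \<eta>\<^sup>2"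
    using G1 by (intro mult_right_mono) (auto simp: power2_eq_square mult_le_cancel_left1)
  finally show "(dist (p', r', a') (p, r, a))\<^sup>2 \<le> (?G * \<eta>)\<^sup>2" by (simp add: power_mult_distrib)
  show "0 \<le> ?G * \<eta>" using \<eta> by simp
qed

context exp_family begin

text \<open>Speaking of every maximiser and of every near relabelling makes this independent of how
  the estimator and its permutations are chosen. The condition on \<open>base\<close> holds almost
  surely.\<close>

definition mle_near :: "('g::finite, 'm::finite) param set \<Rightarrow> ('g, 'm) param \<Rightarrow> real \<Rightarrow> real \<Rightarrow> nat \<Rightarrow> nat
    \<Rightarrow> (nat \<times> nat \<Rightarrow> real) \<Rightarrow> (nat \<Rightarrow> 'g) \<Rightarrow> (nat \<Rightarrow> 'm) \<Rightarrow> bool" where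
  "mle_near \<Theta> \<theta>0 \<eta> \<epsilon> n d x y v \<longleftrightarrow> (\<forall>\<theta>. base n d x > 0 \<longrightarrow> is_mle \<nu> b \<Theta> n d x \<theta> \<longrightarrow>
    (\<exists>s t. bij s \<and> bij t \<and> dist (perm_param s t \<theta>) \<theta>0 < \<eta>) \<and>
    (\<forall>s t. bij s \<longrightarrow> bij t \<longrightarrow> dist (perm_param s t \<theta>) \<theta>0 < \<eta> \<longrightarrow>
      excess 1 n d (perm_param s t \<theta>) (prop_hat n y, prop_hat d v, alpha_hat \<nu> b n d x y v) \<le> \<epsilon>\<^sup>2))"

text \<open>The radius \<open>\<eta>\<close> is fixed before the accuracy \<open>\<epsilon>\<close>
  and the probability \<open>\<delta>\<close>, because the permutations selected through it must
  serve all \<open>\<epsilon>\<close> at once. The exceptional set \<open>B\<close> is measured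
  conditionally on typical labels.\<close>

lemma mle_excess_small:
  fixes \<Theta> :: "('g::finite, 'm::finite) param set" and N D :: "nat \<Rightarrow> nat"
    and p0 :: "real ^ 'g" and r0 :: "real ^ 'm" and A :: "real ^ 'm ^ 'g"
  assumes params: "\<Theta> \<subseteq> param_space"
    and H1: "c > 0" "compact C_alpha" "C_alpha \<subseteq> I"
      "\<And>p r a k. (p, r, a) \<in> \<Theta> \<Longrightarrow> c \<le> p $ k" "\<And>p r a l. (p, r, a) \<in> \<Theta> \<Longrightarrow> c \<le> r $ l"
      "\<And>p r a k l. (p, r, a) \<in> \<Theta> \<Longrightarrow> a $ k $ l \<in> C_alpha"
    and \<theta>0: "(p0, r0, A) \<in> \<Theta>" and \<rho>: "\<rho> > 0" "ball (p0, r0, A) \<rho> \<inter> param_space \<subseteq> \<Theta>"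
    and sym: "\<And>s t. bij s \<Longrightarrow> bij t \<Longrightarrow> (s, t) \<noteq> (id, id) \<Longrightarrow> perm_param s t (p0, r0, A) \<noteq> (p0, r0, A)"
    and rows: "\<And>k k'. k \<noteq> k' \<Longrightarrow> \<exists>l. A $ k $ l \<noteq> A $ k' $ l"
    and cols: "\<And>l l'. l \<noteq> l' \<Longrightarrow> \<exists>k. A $ k $ l \<noteq> A $ k $ l'"
    and ND: "filterlim N at_top sequentially" "filterlim D at_top sequentially"
    and lnD: "(\<lambda>i. ln (real (D i)) / real (N i)) \<longlonglongrightarrow> 0"
    and lnN: "(\<lambda>i. ln (real (N i)) / real (D i)) \<longlonglongrightarrow> 0"
  obtains \<eta> where "\<eta> > 0"
    "\<And>s t. bij s \<Longrightarrow> bij t \<Longrightarrow> (s, t) \<noteq> (id, id) \<Longrightarrow> 2 * \<eta> \<le> dist (perm_param s t (p0, r0, A)) (p0, r0, A)"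
    "\<And>\<epsilon> \<delta>. \<epsilon> > 0 \<Longrightarrow> \<delta> > 0 \<Longrightarrow> eventually (\<lambda>i. \<exists>T.
      measure_pmf.prob (pair_pmf (label_pmf (N i) p0) (label_pmf (D i) r0)) (- T) \<le> \<delta> \<and>
      (\<forall>(y, v)\<in>T. \<exists>B\<in>sets (data_space (N i) (D i)).
        measure (data_law_given \<nu> b (N i) (D i) A y v) B \<le> \<delta> \<and>
        (\<forall>x\<in>space (data_space (N i) (D i)) - B. mle_near \<Theta> (p0, r0, A) \<eta> \<epsilon> (N i) (D i) x y v))) sequentially"
proof -
  let ?\<theta>0 = "(p0, r0, A)"
  have pv0: "prob_vector p0" "prob_vector r0" using \<theta>0 params by (auto simp: param_space_def)
  have c1: "c \<le> 1"
  proof -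
    have "p0 $ undefined \<le> 1"
      using pv0 member_le_sum[of undefined UNIV "\<lambda>k. p0 $ k"] by (auto simp: prob_vector_def)
    then show ?thesis using H1(4)[OF \<theta>0, of undefined] by linarith
  qed
  have AC: "A $ k $ l \<in> C_alpha" for k l by (rule H1(6)[OF \<theta>0])
  then have Cne: "C_alpha \<noteq> {}" by auto
  obtain a0 b0 e where box: "a0 \<in> I" "b0 \<in> I" "a0 < b0" and e: "e > 0"
      "\<And>u. u \<in> C_alpha \<Longrightarrow> {u - e..u + e} \<subseteq> {a0..b0}"
    by (rule box_around_compact[OF H1(2) Cne H1(3)]) blast
  have Cbox: "u \<in> {a0..b0}" if "u \<in> C_alpha" for u using e(2)[OF that] e(1) by auto
  obtain \<kappa> where \<kappa>: "\<kappa> > 0"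
      "\<And>x y. x \<in> {a0..b0} \<Longrightarrow> y \<in> {a0..b0} \<Longrightarrow> \<psi> y \<ge> \<psi> x + \<mu> x * (y - x) + \<kappa> * (y - x)\<^sup>2"
    by (rule strong_convex[OF box(1,2) less_imp_le[OF box(3)]]) blast
  obtain L where L: "L \<ge> 0"
      "\<And>x y. x \<in> {a0..b0} \<Longrightarrow> y \<in> {a0..b0} \<Longrightarrow> \<bar>\<psi> x - \<psi> y\<bar> \<le> L * \<bar>x - y\<bar>"
    by (rule psi_lipschitz[OF box(1,2) less_imp_le[OF box(3)]]) blast
  have AI: "A $ k $ l \<in> I" for k l using AC H1(3) by blast
  have AK: "A $ k $ l \<in> K" for k l using AI I_K by blast
  obtain K1 where K1: "K1 > 0" "\<And>n d z w. measure (data_law_given \<nu> b n d A z w)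
      {x \<in> space (data_space n d). (\<Sum>i<n. \<Sum>j<d. \<bar>x (i, j)\<bar>) > K1 * (real n * real d)} \<le> exp (- (real n * real d))"
  proof (rule abs_sum_tail[where A = A and t = e])
    show "A $ k $ l + e \<in> I" "A $ k $ l + - e \<in> I" for k l
      using e(2)[OF AC[of k l]] e(1) I_between[OF box(1,2)] by (auto simp: subset_iff)
  qed (use AK e(1) in blast)+
  obtain \<Delta>1 where \<Delta>1: "\<Delta>1 > 0" "\<And>q. q \<in> {(k, k'). k \<noteq> k'} \<Longrightarrow> \<Delta>1 \<le> (\<Sum>l\<in>UNIV. (A $ fst q $ l - A $ snd q $ l)\<^sup>2)"
  proof (rule finite_pos_lower_bound[of "{(k, k'). k \<noteq> k'}" "\<lambda>q. \<Sum>l\<in>UNIV. (A $ fst q $ l - A $ snd q $ l)\<^sup>2"])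
    fix q assume "q \<in> {(k::'g, k'). k \<noteq> k'}"
    then obtain l where "A $ fst q $ l \<noteq> A $ snd q $ l" using rows[of "fst q" "snd q"] by auto
    then show "(\<Sum>l\<in>UNIV. (A $ fst q $ l - A $ snd q $ l)\<^sup>2) > 0" by (intro sum_pos2[of _ l]) auto
  qed auto
  obtain \<Delta>2 where \<Delta>2: "\<Delta>2 > 0" "\<And>q. q \<in> {(l, l'). l \<noteq> l'} \<Longrightarrow> \<Delta>2 \<le> (\<Sum>k\<in>UNIV. (A $ k $ fst q - A $ k $ snd q)\<^sup>2)"
  proof (rule finite_pos_lower_bound[of "{(l, l'). l \<noteq> l'}" "\<lambda>q. \<Sum>k\<in>UNIV. (A $ k $ fst q - A $ k $ snd q)\<^sup>2"])
    fix q assume "q \<in> {(l::'m, l'). l \<noteq> l'}"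
    then obtain k where "A $ k $ fst q \<noteq> A $ k $ snd q" using cols[of "fst q" "snd q"] by auto
    then show "(\<Sum>k\<in>UNIV. (A $ k $ fst q - A $ k $ snd q)\<^sup>2) > 0" by (intro sum_pos2[of _ k]) auto
  qed auto
  define \<Delta> where "\<Delta> = min \<Delta>1 \<Delta>2"
  have \<Delta>: "\<Delta> > 0" "\<And>k k'. k \<noteq> k' \<Longrightarrow> \<Delta> \<le> (\<Sum>l\<in>UNIV. (A $ k $ l - A $ k' $ l)\<^sup>2)"
      "\<And>l l'. l \<noteq> l' \<Longrightarrow> \<Delta> \<le> (\<Sum>k\<in>UNIV. (A $ k $ l - A $ k $ l')\<^sup>2)"
    using \<Delta>1(1) \<Delta>2(1) \<Delta>1(2)[of "(_, _)"] \<Delta>2(2)[of "(_, _)"] by (fastforce simp: \<Delta>_def)+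
  obtain m where m: "m > 0" "\<And>q. q \<in> {(s, t). bij s \<and> bij t \<and> (s, t) \<noteq> (id, id)}
      \<Longrightarrow> m \<le> dist (perm_param (fst q) (snd q) ?\<theta>0) ?\<theta>0"
  proof (rule finite_pos_lower_bound[of "{(s, t). bij s \<and> bij t \<and> (s, t) \<noteq> (id, id)}"
        "\<lambda>q. dist (perm_param (fst q) (snd q) ?\<theta>0) ?\<theta>0"])
    show "finite {(s :: 'g \<Rightarrow> 'g, t :: 'm \<Rightarrow> 'm). bij s \<and> bij t \<and> (s, t) \<noteq> (id, id)}"
      by (rule finite_subset[OF subset_UNIV]) simp
  qed (use sym in auto)
  \<comment> \<open>\<open>m / 2\<close> makes the near relabelling unique;
    \<open>2 * \<rho>\<close> makes \<open>\<eta> / 2\<close> at most the radius of a ball of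
    admissible parameters.\<close>
  define \<eta> where "\<eta> = min (m / 2) (2 * \<rho>)"
  have \<eta>: "\<eta> > 0" "\<eta> / 2 \<le> \<rho>" using m(1) \<rho>(1) by (auto simp: \<eta>_def)
  have sym2: "2 * \<eta> \<le> dist (perm_param s t ?\<theta>0) ?\<theta>0" if "bij s" "bij t" "(s, t) \<noteq> (id, id)" for s t
    using m(2)[of "(s, t)"] that by (auto simp: \<eta>_def)
  let ?G = "real CARD('g) + real CARD('m) + real CARD('g) * real CARD('m)"
  have G0: "?G > 0" by (intro add_pos_nonneg) auto
  \<comment> \<open>In this order, the three bounds keep the complete-data estimator within
    \<open>\<eta> / 2\<close> of the truth, its matrix in the box, and all label frequencies at
    least \<open>c / 2\<close>.\<close>
  define \<eta>1 where "\<eta>1 = min (\<eta> / (4 * ?G)) (min e (c / 2))"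
  have \<eta>1: "\<eta>1 > 0" "\<eta>1 \<le> e" "\<eta>1 \<le> c / 2" "?G * \<eta>1 < \<eta> / 2"
  proof -
    show "\<eta>1 > 0" using \<eta> G0 e H1(1) by (auto simp: \<eta>1_def)
    have "\<eta>1 \<le> \<eta> / (4 * ?G)" by (simp add: \<eta>1_def)
    then have "?G * \<eta>1 \<le> ?G * (\<eta> / (4 * ?G))" using G0 by (intro mult_left_mono) auto
    also have "\<dots> = \<eta> / 4" using G0 by (simp add: field_simps)
    also have "\<dots> < \<eta> / 2" using \<eta> by simp
    finally show "?G * \<eta>1 < \<eta> / 2" .
    show "\<eta>1 \<le> e" "\<eta>1 \<le> c / 2" unfolding \<eta>1_def by linarith+
  qed
  have Apm: "A $ k $ l - \<eta>1 \<in> {a0..b0}" "A $ k $ l + \<eta>1 \<in> {a0..b0}" for k l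
    using e(2)[OF AC[of k l]] \<eta>1(1,2) by (auto simp: subset_iff)
  define \<gamma> where "\<gamma> = c / 2"
  have \<gamma>: "\<gamma> > 0" "\<gamma> \<le> 1" using H1(1) c1 by (auto simp: \<gamma>_def)
  define \<kappa>' where "\<kappa>' = min (1 / 4) (\<kappa> * \<gamma>\<^sup>2)"
  have \<kappa>': "\<kappa>' > 0" "\<kappa>' \<le> 1 / 4" "\<kappa>' \<le> \<kappa> * \<gamma>\<^sup>2" using \<kappa>(1) \<gamma>(1) by (auto simp: \<kappa>'_def)
  show thesis
  proof (rule that[OF \<eta>(1) sym2])
    fix \<epsilon> \<epsilon>' :: real assume eps: "\<epsilon> > 0" "\<epsilon>' > 0"
    \<comment> \<open>Chosen so that the bound \<open>- ln (1 - 2 * \<delta>)\<close> on the excess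
      is at most \<open>\<kappa>' * \<epsilon>\<^sup>2\<close>.\<close>
    define \<delta> where "\<delta> = min (1 / 4) ((1 - exp (- \<kappa>' * \<epsilon>\<^sup>2)) / 2)"
    have \<delta>: "\<delta> > 0" "\<delta> \<le> 1 / 4" using eps \<kappa>'(1) by (auto simp: \<delta>_def)
    have ln\<delta>: "- ln (1 - 2 * \<delta>) \<le> \<kappa>' * \<epsilon>\<^sup>2"
    proof -
      have "exp (- \<kappa>' * \<epsilon>\<^sup>2) \<le> 1 - 2 * \<delta>"
        using min.cobounded2[of "1 / 4" "(1 - exp (- \<kappa>' * \<epsilon>\<^sup>2)) / 2"] unfolding \<delta>_def[symmetric]
        by (simp add: field_simps)
      then have "ln (exp (- \<kappa>' * \<epsilon>\<^sup>2)) \<le> ln (1 - 2 * \<delta>)"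
        using \<delta> by (subst ln_le_cancel_iff) auto
      then show ?thesis by simp
    qed
    \<comment> \<open>\<open>E\<close> is the cost of rounding on the good event: mesh
      \<open>(b0 - a0) / (n * d)\<close> times slope \<open>(K1 + L) * n * d\<close>. The level
      \<open>\<delta>0\<close> is set so that \<open>E\<close> times its square is
      \<open>\<delta>\<close>.\<close>
    define E where "E = exp ((b0 - a0) * (K1 + L))"
    define \<delta>0 where "\<delta>0 = sqrt (\<delta> / E)"
    have \<delta>0: "\<delta>0 > 0" "E * \<delta>0\<^sup>2 = \<delta>" using \<delta>(1) by (auto simp: \<delta>0_def E_def)
    define GS where "GS = real (card {s::'g\<Rightarrow>'g. bij s}) * real (card {t::'m\<Rightarrow>'m. bij t})"
    have N: "filterlim (\<lambda>i. real (N i)) at_top sequentially" and D: "filterlim (\<lambda>i. real (D i)) at_top sequentially"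
      using ND filterlim_real_sequentially filterlim_compose by blast+
    have ev1: "eventually (\<lambda>i. real CARD('g) * (2 * exp (- 2 * real (N i) * \<eta>1\<^sup>2))
        + real CARD('m) * (2 * exp (- 2 * real (D i) * \<eta>1\<^sup>2)) < \<epsilon>') sequentially"
    proof (rule order_tendstoD(2)[OF _ eps(2)])
      have "(\<lambda>i. real CARD('g) * (2 * exp (- (2 * \<eta>1\<^sup>2) * real (N i)))
        + real CARD('m) * (2 * exp (- (2 * \<eta>1\<^sup>2) * real (D i)))) \<longlonglongrightarrow> real CARD('g) * (2 * 0) + real CARD('m) * (2 * 0)"
        using \<eta>1(1) by (intro tendsto_intros exp_neg_tendsto_0 N D) auto
      then show "(\<lambda>i. real CARD('g) * (2 * exp (- 2 * real (N i) * \<eta>1\<^sup>2))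
        + real CARD('m) * (2 * exp (- 2 * real (D i) * \<eta>1\<^sup>2))) \<longlonglongrightarrow> 0" by (simp add: mult_ac)
    qed
    have ev2: "eventually (\<lambda>i. bad_bound TYPE('g) TYPE('m) \<kappa> c \<gamma> \<eta>1 \<Delta> \<delta>0 (N i) (D i) < \<epsilon>') sequentially"
      by (rule order_tendstoD(2)[OF bad_bound_tendsto_0[OF box \<kappa> K1(2) \<eta>1(1) Apm H1(1) \<gamma> \<Delta> ND lnD lnN] eps(2)])
    have ev3: "eventually (\<lambda>i. GS * exp (- \<kappa>' * real (min (N i) (D i)) * (\<eta> / 2)\<^sup>2) < \<delta>) sequentially"
    proof (rule order_tendstoD(2)[OF _ \<delta>(1)])
      have "filterlim (\<lambda>i. real (min (N i) (D i))) at_top sequentially"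
        unfolding filterlim_at_top
      proof
        fix Z :: real
        have "eventually (\<lambda>i. Z \<le> real (N i)) sequentially" "eventually (\<lambda>i. Z \<le> real (D i)) sequentially"
          using N D by (auto simp: filterlim_at_top)
        then show "eventually (\<lambda>i. Z \<le> real (min (N i) (D i))) sequentially"
          by eventually_elim (auto simp: min_def)
      qed
      then have "(\<lambda>i. GS * exp (- (\<kappa>' * (\<eta> / 2)\<^sup>2) * real (min (N i) (D i)))) \<longlonglongrightarrow> GS * 0"
        using \<kappa>'(1) \<eta>(1) by (intro tendsto_intros exp_neg_tendsto_0) auto
      then show "(\<lambda>i. GS * exp (- \<kappa>' * real (min (N i) (D i)) * (\<eta> / 2)\<^sup>2)) \<longlonglongrightarrow> 0" by (simp add: mult_ac)
    qed
    have pos: "eventually (\<lambda>i. N i > 0) sequentially" "eventually (\<lambda>i. D i > 0) sequentially"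
      using eventually_compose_filterlim[OF eventually_gt_at_top ND(1)]
        eventually_compose_filterlim[OF eventually_gt_at_top ND(2)] by auto
    show "eventually (\<lambda>i. \<exists>T.
      measure_pmf.prob (pair_pmf (label_pmf (N i) p0) (label_pmf (D i) r0)) (- T) \<le> \<epsilon>' \<and>
      (\<forall>(y, v)\<in>T. \<exists>B\<in>sets (data_space (N i) (D i)).
        measure (data_law_given \<nu> b (N i) (D i) A y v) B \<le> \<epsilon>' \<and>
        (\<forall>x\<in>space (data_space (N i) (D i)) - B. mle_near \<Theta> (p0, r0, A) \<eta> \<epsilon> (N i) (D i) x y v))) sequentially"
      using ev1 ev2 ev3 pos
    proof eventually_elim
      case (elim i)
      define n d where "n = N i" and "d = D i"
      have nd: "n > 0" "d > 0" using elim by (simp_all add: n_def d_def)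
      define T :: "((nat \<Rightarrow> 'g) \<times> (nat \<Rightarrow> 'm)) set" where
        "T = {(z, w). (\<forall>k. \<bar>prop_hat n z $ k - p0 $ k\<bar> < \<eta>1) \<and> (\<forall>l. \<bar>prop_hat d w $ l - r0 $ l\<bar> < \<eta>1)}"
      have probT: "measure_pmf.prob (pair_pmf (label_pmf n p0) (label_pmf d r0)) (- T) \<le> \<epsilon>'"
        using label_pair_deviation[OF pv0 nd, of \<eta>1] elim(1) \<eta>1(1) unfolding T_def n_def d_def by linarith
      have main: "\<exists>B\<in>sets (data_space n d).
        measure (data_law_given \<nu> b n d A y v) B \<le> \<epsilon>' \<and>
        (\<forall>x\<in>space (data_space n d) - B. mle_near \<Theta> (p0, r0, A) \<eta> \<epsilon> n d x y v)"
        if "(y, v) \<in> T" for y v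
      proof -
        have ph: "\<bar>prop_hat n y $ k - p0 $ k\<bar> < \<eta>1" "\<bar>prop_hat d v $ l - r0 $ l\<bar> < \<eta>1" for k l
          using that by (auto simp: T_def)
        have cz: "\<gamma> * real n \<le> real (cnt n y k)" for k
        proof -
          have "\<gamma> \<le> prop_hat n y $ k"
            using ph(1)[of k] \<eta>1(3) H1(4)[OF \<theta>0, of k] unfolding \<gamma>_def by linarith
          then show ?thesis using nd by (simp add: prop_hat_cnt field_simps)
        qed
        have cw: "\<gamma> * real d \<le> real (cnt d v l)" for l
        proof -
          have "\<gamma> \<le> prop_hat d v $ l"
            using ph(2)[of l] \<eta>1(3) H1(5)[OF \<theta>0, of l] unfolding \<gamma>_def by linarith
          then show ?thesis using nd by (simp add: prop_hat_cnt field_simps)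
        qed
        have "\<exists>B\<in>sets (data_space n d).
            measure (data_law_given \<nu> b n d A y v) B \<le> bad_bound TYPE('g) TYPE('m) \<kappa> c \<gamma> \<eta>1 \<Delta> \<delta>0 n d \<and>
            (\<forall>x\<in>space (data_space n d) - B. (\<Sum>i<n. \<Sum>j<d. \<bar>x (i, j)\<bar>) \<le> K1 * (real n * real d) \<and>
              (\<forall>k l. \<mu> (A $ k $ l - \<eta>1) < x_hat n d x y v $ k $ l \<and> x_hat n d x y v $ k $ l < \<mu> (A $ k $ l + \<eta>1)) \<and>
              (\<forall>a'\<in>grid a0 b0 (n * d). sqrt_ratio_sum n d c y v A a' x < \<delta>0))"
          by (rule bad_event[OF box \<kappa> K1(2) \<eta>1(1) Apm H1(1) \<gamma> \<Delta> nd \<delta>0(1) cz cw]) (assumption | blast)+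
        then obtain B where B: "B \<in> sets (data_space n d)"
            "measure (data_law_given \<nu> b n d A y v) B \<le> bad_bound TYPE('g) TYPE('m) \<kappa> c \<gamma> \<eta>1 \<Delta> \<delta>0 n d"
          and good: "\<And>x. x \<in> space (data_space n d) - B \<Longrightarrow> (\<Sum>i<n. \<Sum>j<d. \<bar>x (i, j)\<bar>) \<le> K1 * (real n * real d)"
            "\<And>x k l. x \<in> space (data_space n d) - B \<Longrightarrow> \<mu> (A $ k $ l - \<eta>1) < x_hat n d x y v $ k $ l"
            "\<And>x k l. x \<in> space (data_space n d) - B \<Longrightarrow> x_hat n d x y v $ k $ l < \<mu> (A $ k $ l + \<eta>1)"
            "\<And>x a'. x \<in> space (data_space n d) - B \<Longrightarrow> a' \<in> grid a0 b0 (n * d) \<Longrightarrow> sqrt_ratio_sum n d c y v A a' x < \<delta>0"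
          by blast
        show ?thesis
        proof (rule bexI[OF _ B(1)], rule conjI)
          show "measure (data_law_given \<nu> b n d A y v) B \<le> \<epsilon>'"
            using B(2) elim(2) unfolding n_def d_def by linarith
        next
          show "\<forall>x\<in>space (data_space n d) - B. mle_near \<Theta> (p0, r0, A) \<eta> \<epsilon> n d x y v"
            unfolding mle_near_def
          proof (rule ballI, rule allI, rule impI, rule impI)
            fix x \<theta> assume x: "x \<in> space (data_space n d) - B" and bp: "base n d x > 0"
              and mle: "is_mle \<nu> b \<Theta> n d x \<theta>"
            let ?h = "alpha_hat \<nu> b n d x y v"
            let ?\<theta>c = "(prop_hat n y, prop_hat d v, ?h)"
            have Apm': "A $ k $ l - \<eta>1 \<in> I" "A $ k $ l + \<eta>1 \<in> I" for k l
              using Apm[of k l] I_between[OF box(1,2)] by auto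
            have h: "\<mu> (?h $ k $ l) = x_hat n d x y v $ k $ l" "\<bar>?h $ k $ l - A $ k $ l\<bar> < \<eta>1" for k l
              using inv_mu_near[OF AI Apm' \<eta>1(1) good(2)[OF x] good(3)[OF x], of k l]
              by (simp_all add: alpha_hat_def)
            have hbox: "?h $ k $ l \<in> {a0..b0}" for k l
              using h(2)[of k l] Apm[of k l] by auto
            have dc: "dist ?\<theta>c ?\<theta>0 < \<eta> / 2"
              using dist_param_le[of "prop_hat n y" p0 \<eta>1 "prop_hat d v" r0 ?h A] ph h(2) \<eta>1(4)
              by (meson less_imp_le order_le_less_trans)
            \<comment> \<open>The relative interior makes the complete-data estimator a legitimate
              competitor of the maximiser.\<close>
            have inT: "?\<theta>c \<in> \<Theta>"
            proof -
              have "?\<theta>c \<in> param_space" by (simp add: param_space_def prob_vector_prop_hat nd)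
              moreover have "?\<theta>c \<in> ball ?\<theta>0 \<rho>" using dc \<eta>(2) by (simp add: dist_commute)
              ultimately show ?thesis using \<rho>(2) by blast
            qed
            obtain p r a where \<theta>: "\<theta> = (p, r, a)" by (cases \<theta>)
            have \<theta>T: "(p, r, a) \<in> \<Theta>" using mle by (simp add: is_mle_def \<theta>)
            have abox: "a $ k $ l \<in> {a0..b0}" for k l by (rule Cbox[OF H1(6)[OF \<theta>T]])
            have pv: "prob_vector p" "prob_vector r" using \<theta>T params by (auto simp: param_space_def)
            have nd0: "n * d > 0" using nd by simp
            obtain a' where a': "a' \<in> grid a0 b0 (n * d)" "\<And>k l. \<bar>a $ k $ l - a' $ k $ l\<bar> \<le> (b0 - a0) / real (n * d)"
              by (rule grid_approx[OF abox box(3) nd0]) blast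
            have a'box: "a' $ k $ l \<in> {a0..b0}" for k l by (rule grid_box[OF a'(1) less_imp_le[OF box(3)]])
            let ?cA = "complete_likelihood \<nu> b n d (prop_hat n y, prop_hat d v, A) x y v"
            have "observed_likelihood \<nu> b n d \<theta> x \<le>
              (\<Sum>s | bij s. \<Sum>t | bij t. complete_likelihood \<nu> b n d (perm_param s t \<theta>) x y v)
              + ?cA * (exp ((b0 - a0) / real (n * d) * ((\<Sum>i<n. \<Sum>j<d. \<bar>x (i, j)\<bar>) + L * (real n * real d)))
                * (sqrt_ratio_sum n d c y v A a' x)\<^sup>2)"
              unfolding \<theta>
              by (rule observed_likelihood_le[OF L(2,1) abox a'box a'(2) H1(1) pv(1) H1(4)[OF \<theta>T] pv(2) H1(5)[OF \<theta>T] nd])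
            also have "\<dots> \<le> (\<Sum>s | bij s. \<Sum>t | bij t. complete_likelihood \<nu> b n d (perm_param s t \<theta>) x y v) + ?cA * \<delta>"
            proof (intro add_left_mono mult_left_mono)
              have "(b0 - a0) / real (n * d) * ((\<Sum>i<n. \<Sum>j<d. \<bar>x (i, j)\<bar>) + L * (real n * real d))
                  \<le> (b0 - a0) / real (n * d) * ((K1 + L) * (real n * real d))"
                using good(1)[OF x] box(3) by (intro mult_left_mono) (auto simp: distrib_right)
              also have "\<dots> = (b0 - a0) * (K1 + L)" using nd by simp
              finally have "exp ((b0 - a0) / real (n * d) * ((\<Sum>i<n. \<Sum>j<d. \<bar>x (i, j)\<bar>) + L * (real n * real d))) \<le> E"
                by (simp add: E_def)
              moreover have "(sqrt_ratio_sum n d c y v A a' x)\<^sup>2 \<le> \<delta>0\<^sup>2"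
              proof (rule power_mono)
                show "0 \<le> sqrt_ratio_sum n d c y v A a' x"
                  unfolding sqrt_ratio_sum_def using H1(1) by (auto intro!: sum_nonneg)
              qed (use good(4)[OF x a'(1)] in simp)
              ultimately show "exp ((b0 - a0) / real (n * d) * ((\<Sum>i<n. \<Sum>j<d. \<bar>x (i, j)\<bar>) + L * (real n * real d)))
                * (sqrt_ratio_sum n d c y v A a' x)\<^sup>2 \<le> \<delta>"
                unfolding \<delta>0(2)[symmetric] by (intro mult_mono) (auto simp: E_def)
              show "0 \<le> ?cA"
                unfolding complete_likelihood_eq
                by (intro mult_nonneg_nonneg prod_nonneg base_nonneg) (auto simp: prop_hat_cnt)
            qed
            finally have obs: "observed_likelihood \<nu> b n d \<theta> x \<le>
              (\<Sum>s | bij s. \<Sum>t | bij t. complete_likelihood \<nu> b n d (perm_param s t \<theta>) x y v) + ?cA * \<delta>" .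
            have far: "real (card {s::'g\<Rightarrow>'g. bij s}) * real (card {t::'m\<Rightarrow>'m. bij t})
                * exp (- \<kappa>' * real (min n d) * (\<eta> / 2)\<^sup>2) \<le> \<delta>"
              using elim(3) unfolding GS_def n_def d_def by linarith
            have Tbox: "a $ k $ l \<in> {a0..b0}" if "(p, r, a) \<in> \<Theta>" for p r a k l by (rule Cbox[OF H1(6)[OF that]])
            have AC': "A $ k $ l \<in> {a0..b0}" for k l by (rule Cbox[OF AC])
            have close1: "\<exists>s t. bij s \<and> bij t \<and> dist (perm_param s t \<theta>) ?\<theta>0 < \<eta>"
              by (rule mle_close(1)[where ?a0.0 = a0 and ?b0.0 = b0 and \<kappa> = \<kappa> and n = n and d = d and \<gamma> = \<gamma> and y = y and v = v
                and \<kappa>' = \<kappa>' and x = x and \<Theta> = \<Theta> and \<theta> = \<theta> and A = A and \<delta> = \<delta> and \<eta> = \<eta> and ?\<theta>0.0 = ?\<theta>0];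
                fact \<kappa> nd \<gamma>(1) cz cw \<kappa>' h(1) hbox bp mle params Tbox inT AC' \<delta> obs \<eta>(1) dc sym2 far)
            have close2: "excess \<kappa>' n d (perm_param s t \<theta>) ?\<theta>c \<le> - ln (1 - 2 * \<delta>)"
              if st: "bij s" "bij t" "dist (perm_param s t \<theta>) ?\<theta>0 < \<eta>" for s t
              by (rule mle_close(2)[where ?a0.0 = a0 and ?b0.0 = b0 and \<kappa> = \<kappa> and n = n and d = d and \<gamma> = \<gamma> and y = y and v = v
                and \<kappa>' = \<kappa>' and x = x and \<Theta> = \<Theta> and \<theta> = \<theta> and A = A and \<delta> = \<delta> and \<eta> = \<eta> and ?\<theta>0.0 = ?\<theta>0];
                fact \<kappa> nd \<gamma>(1) cz cw \<kappa>' h(1) hbox bp mle params Tbox inT AC' \<delta> obs \<eta>(1) dc sym2 far st)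
            show "(\<exists>s t. bij s \<and> bij t \<and> dist (perm_param s t \<theta>) ?\<theta>0 < \<eta>) \<and>
              (\<forall>s t. bij s \<longrightarrow> bij t \<longrightarrow> dist (perm_param s t \<theta>) ?\<theta>0 < \<eta> \<longrightarrow>
                excess 1 n d (perm_param s t \<theta>) ?\<theta>c \<le> \<epsilon>\<^sup>2)"
            proof (rule conjI[OF close1], rule allI, rule allI, rule impI, rule impI, rule impI)
              fix s t assume st: "bij s" "bij t" "dist (perm_param s t \<theta>) ?\<theta>0 < \<eta>"
              have "excess \<kappa>' n d (perm_param s t \<theta>) ?\<theta>c \<le> \<kappa>' * \<epsilon>\<^sup>2"
                by (rule order_trans[OF close2[OF st] ln\<delta>])
              moreover have "excess \<kappa>' n d (perm_param s t \<theta>) ?\<theta>c = \<kappa>' * excess 1 n d (perm_param s t \<theta>) ?\<theta>c"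
                by (simp add: excess_def)
              ultimately show "excess 1 n d (perm_param s t \<theta>) ?\<theta>c \<le> \<epsilon>\<^sup>2" using \<kappa>'(1) by simp
            qed
          qed
        qed
      qed
      show ?case
        using probT main unfolding n_def d_def by (intro exI[of _ T] conjI) auto
    qed
  qed
qed

end

section \<open>Measurability of the relabelled estimator and conclusion\<close>

lemma borel_measurable_vecI:
  fixes f :: "'a \<Rightarrow> 'b::euclidean_space ^ 'n::finite"
  assumes "\<And>k. (\<lambda>x. f x $ k) \<in> borel_measurable M"
  shows "f \<in> borel_measurable M"
proof (subst borel_measurable_euclidean_space, rule ballI)
  fix u :: "'b ^ 'n" assume "u \<in> Basis"
  then obtain k w where u: "u = axis k w" by (auto simp: Basis_vec_def)
  have "(\<lambda>x. f x $ k \<bullet> w) \<in> borel_measurable M"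
    using assms[of k] by (intro borel_measurable_inner) auto
  then show "(\<lambda>x. f x \<bullet> u) \<in> borel_measurable M" by (simp add: u inner_axis)
qed

lemma perm_param_simps [simp]:
  "fst (perm_param s t \<theta>) = perm_vec s (fst \<theta>)"
  "fst (snd (perm_param s t \<theta>)) = perm_vec t (fst (snd \<theta>))"
  "snd (snd (perm_param s t \<theta>)) = perm_mat s t (snd (snd \<theta>))"
  by (cases \<theta>; simp add: perm_param_def)+

lemma le_times_powr_minus_half:
  fixes m u \<epsilon> :: real
  assumes "m > 0" "m * u\<^sup>2 \<le> \<epsilon>\<^sup>2" "\<epsilon> > 0"
  shows "u \<le> \<epsilon> * m powr (- 1 / 2)"
proof (rule power2_le_imp_le)
  have "(m powr (- 1 / 2))\<^sup>2 = m powr (- 1)"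
    using assms(1) by (simp add: power2_eq_square flip: powr_add)
  then have "(m powr (- 1 / 2))\<^sup>2 = 1 / m"
    using powr_neg_one[OF assms(1)] by (simp only:)
  then have "(\<epsilon> * m powr (- 1 / 2))\<^sup>2 = \<epsilon>\<^sup>2 / m"
    unfolding power_mult_distrib by (simp only:) simp
  moreover have "u\<^sup>2 \<le> \<epsilon>\<^sup>2 / m" using assms(1,2) by (simp add: pos_le_divide_eq mult.commute)
  ultimately show "u\<^sup>2 \<le> (\<epsilon> * m powr (- 1 / 2))\<^sup>2" by (simp only:)
qed (use assms in simp)

text \<open>The permutations are a function of the estimate alone, hence of the data. The default
  \<open>(id, id)\<close> keeps them bijective when no relabelling is near.\<close>

definition align :: "real \<Rightarrow> ('g::finite, 'm::finite) param \<Rightarrow> ('g, 'm) param \<Rightarrow> ('g \<Rightarrow> 'g) \<times> ('m \<Rightarrow> 'm)" where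
  "align \<eta> \<theta>0 \<theta> = (if \<exists>s t. bij s \<and> bij t \<and> dist (perm_param s t \<theta>) \<theta>0 < \<eta>
    then SOME (s, t). bij s \<and> bij t \<and> dist (perm_param s t \<theta>) \<theta>0 < \<eta> else (id, id))"

lemma align_close:
  assumes "\<exists>s t. bij s \<and> bij t \<and> dist (perm_param s t \<theta>) \<theta>0 < \<eta>"
  shows "bij (fst (align \<eta> \<theta>0 \<theta>)) \<and> bij (snd (align \<eta> \<theta>0 \<theta>))
    \<and> dist (perm_param (fst (align \<eta> \<theta>0 \<theta>)) (snd (align \<eta> \<theta>0 \<theta>)) \<theta>) \<theta>0 < \<eta>"
proof -
  obtain s t where "bij s" "bij t" "dist (perm_param s t \<theta>) \<theta>0 < \<eta>" using assms by blast
  then have "case (s, t) of (s, t) \<Rightarrow> bij s \<and> bij t \<and> dist (perm_param s t \<theta>) \<theta>0 < \<eta>" by simp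
  then have "case align \<eta> \<theta>0 \<theta> of (s, t) \<Rightarrow> bij s \<and> bij t \<and> dist (perm_param s t \<theta>) \<theta>0 < \<eta>"
    unfolding align_def if_P[OF assms] by (rule someI)
  then show ?thesis by (simp add: case_prod_beta)
qed

lemma align_bij: "bij (fst (align \<eta> \<theta>0 \<theta>))" "bij (snd (align \<eta> \<theta>0 \<theta>))"
  using align_close[of \<theta> \<theta>0 \<eta>] by (auto simp: align_def)

text \<open>Uniqueness of the close relabelling makes \<open>align\<close> take each non-default value on an open set.\<close>
lemma align_measurable:
  fixes \<theta>0 :: "('g::finite, 'm::finite) param"
  assumes sym: "\<And>s t. bij s \<Longrightarrow> bij t \<Longrightarrow> (s, t) \<noteq> (id, id) \<Longrightarrow> 2 * \<eta> \<le> dist (perm_param s t \<theta>0) \<theta>0"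
  shows "(\<lambda>\<theta>. perm_param (fst (align \<eta> \<theta>0 \<theta>)) (snd (align \<eta> \<theta>0 \<theta>)) \<theta>) \<in> borel_measurable borel"
proof -
  let ?I = "{(s :: 'g \<Rightarrow> 'g, t :: 'm \<Rightarrow> 'm). bij s \<and> bij t}"
  have fin: "finite ?I" by (rule finite_subset[OF subset_UNIV]) simp
  have cont: "continuous_on UNIV (perm_param s t :: ('g, 'm) param \<Rightarrow> _)" if "(s, t) \<in> ?I" for s t
    unfolding continuous_on_iff using that dist_perm_param[of s t] by (metis (mono_tags, lifting) mem_Collect_eq case_prodD)
  define U where "U = (\<lambda>st :: ('g \<Rightarrow> 'g) \<times> ('m \<Rightarrow> 'm). {\<theta>. dist (perm_param (fst st) (snd st) \<theta>) \<theta>0 < \<eta>})"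
  have U: "U st \<in> sets borel" if "st \<in> ?I" for st
  proof -
    have "continuous_on UNIV (perm_param (fst st) (snd st) :: ('g, 'm) param \<Rightarrow> _)"
      using cont[of "fst st" "snd st"] that by simp
    then have "open (U st)"
      unfolding U_def by (intro open_Collect_less continuous_intros)
    then show ?thesis by simp
  qed
  have ex: "(\<exists>s t. bij s \<and> bij t \<and> dist (perm_param s t \<theta>) \<theta>0 < \<eta>) \<longleftrightarrow> \<theta> \<in> (\<Union>st\<in>?I. U st)" for \<theta>
    by (auto simp: U_def)
  define V where "V = (\<Union>st\<in>?I. U st)"
  \<comment> \<open>The pair \<open>(id, id)\<close> also collects the parameters without a near
    relabelling.\<close>
  have val: "align \<eta> \<theta>0 -` {st} = U st \<union> (if st = (id, id) then - V else {})" if st: "st \<in> ?I" for st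
  proof (rule set_eqI)
    fix \<theta>
    show "\<theta> \<in> align \<eta> \<theta>0 -` {st} \<longleftrightarrow> \<theta> \<in> U st \<union> (if st = (id, id) then - V else {})"
    proof (cases "\<theta> \<in> V")
      case True
      then have e: "\<exists>s t. bij s \<and> bij t \<and> dist (perm_param s t \<theta>) \<theta>0 < \<eta>" unfolding ex V_def .
      have "align \<eta> \<theta>0 \<theta> = st \<longleftrightarrow> \<theta> \<in> U st"
      proof
        show "align \<eta> \<theta>0 \<theta> = st \<Longrightarrow> \<theta> \<in> U st" using align_close[OF e] by (auto simp: U_def)
        assume "\<theta> \<in> U st"
        then show "align \<eta> \<theta>0 \<theta> = st"
          using perm_close_unique[OF sym, of "fst st" "snd st" \<theta> "fst (align \<eta> \<theta>0 \<theta>)" "snd (align \<eta> \<theta>0 \<theta>)"]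
            align_close[OF e] st by (auto simp: U_def)
      qed
      then show ?thesis using True by simp
    next
      case False
      then have "align \<eta> \<theta>0 \<theta> = (id, id)"
        unfolding V_def ex[symmetric] align_def by (simp only: if_False)
      moreover have "\<theta> \<notin> U st" using False st by (auto simp: V_def)
      ultimately show ?thesis using False by auto
    qed
  qed
  have am: "align \<eta> \<theta>0 \<in> borel \<rightarrow>\<^sub>M count_space ?I"
    unfolding measurable_count_space_eq2[OF fin]
  proof (intro conjI ballI)
    show "align \<eta> \<theta>0 \<in> space borel \<rightarrow> ?I"
    proof
      fix \<theta>
      show "align \<eta> \<theta>0 \<theta> \<in> ?I" using align_bij[of \<eta> \<theta>0 \<theta>] by (cases "align \<eta> \<theta>0 \<theta>") auto
    qed
    fix st assume st: "st \<in> ?I"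
    have "V \<in> sets borel" unfolding V_def by (intro sets.finite_UN fin U)
    then show "align \<eta> \<theta>0 -` {st} \<inter> space borel \<in> sets borel"
      unfolding val[OF st] using U[OF st] by (auto intro!: sets.Un borel_comp)
  qed
  show ?thesis
  proof (rule measurable_compose_countable'[where f = "\<lambda>st \<theta>. perm_param (fst st) (snd st) \<theta>" and g = "align \<eta> \<theta>0" and I = ?I])
    fix st assume "st \<in> ?I"
    then show "(\<lambda>\<theta>. perm_param (fst st) (snd st) \<theta>) \<in> borel_measurable borel"
      using cont[of "fst st" "snd st"] by (intro borel_measurable_continuous_onI) simp
  qed (use am fin in \<open>auto intro: countable_finite\<close>)
qed

lemma (in exp_family) excess_1_partD:
  assumes "excess 1 n d \<theta> \<theta>' \<le> u"
  shows "real n * (norm (fst \<theta> - fst \<theta>'))\<^sup>2 \<le> u"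
    "real d * (norm (fst (snd \<theta>) - fst (snd \<theta>')))\<^sup>2 \<le> u"
    "real n * real d * (norm (snd (snd \<theta>) - snd (snd \<theta>')))\<^sup>2 \<le> u"
proof -
  define X Y Z where "X = real n * (norm (fst \<theta> - fst \<theta>'))\<^sup>2"
    and "Y = real d * (norm (fst (snd \<theta>) - fst (snd \<theta>')))\<^sup>2"
    and "Z = real n * real d * (norm (snd (snd \<theta>) - snd (snd \<theta>')))\<^sup>2"
  have "0 \<le> X" "0 \<le> Y" "0 \<le> Z" by (simp_all add: X_def Y_def Z_def)
  moreover have "X + Y + Z \<le> u" using assms by (simp add: excess_def X_def Y_def Z_def)
  ultimately have "X \<le> u" "Y \<le> u" "Z \<le> u" by linarith+
  then show "real n * (norm (fst \<theta> - fst \<theta>'))\<^sup>2 \<le> u"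
    "real d * (norm (fst (snd \<theta>) - fst (snd \<theta>')))\<^sup>2 \<le> u"
    "real n * real d * (norm (snd (snd \<theta>) - snd (snd \<theta>')))\<^sup>2 \<le> u"
    by (simp_all only: X_def Y_def Z_def)
qed

lemma (in exp_family) alpha_hat_measurable:
  "(\<lambda>\<omega>. alpha_hat \<nu> b n d (fst \<omega>) (fst (snd \<omega>)) (snd (snd \<omega>))) \<in> borel_measurable
    (data_space n d \<Otimes>\<^sub>M ((count_space UNIV :: (nat \<Rightarrow> 'g::finite) measure) \<Otimes>\<^sub>M (count_space UNIV :: (nat \<Rightarrow> 'm::finite) measure)))"
  (is "_ \<in> borel_measurable ?S")
proof (rule borel_measurable_vecI, rule borel_measurable_vecI)
  fix k l
  have z: "(\<lambda>\<omega>. h (fst (snd \<omega>)) :: real) \<in> borel_measurable ?S" for h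
    by (rule measurable_compose[of "\<lambda>\<omega>. fst (snd \<omega>)" _ "count_space UNIV"]) measurable
  have w: "(\<lambda>\<omega>. h (snd (snd \<omega>)) :: real) \<in> borel_measurable ?S" for h
    by (rule measurable_compose[of "\<lambda>\<omega>. snd (snd \<omega>)" _ "count_space UNIV"]) measurable
  have x: "(\<lambda>\<omega>. fst \<omega> (i, j)) \<in> borel_measurable ?S" if "i < n" "j < d" for i j
    by (rule measurable_compose[OF measurable_fst component_data_space[OF that]])
  have "(\<lambda>\<omega>. x_hat n d (fst \<omega>) (fst (snd \<omega>)) (snd (snd \<omega>)) $ k $ l) \<in> borel_measurable ?S"
    unfolding x_hat_def vec_lambda_beta
    by (intro borel_measurable_divide borel_measurable_times borel_measurable_sum x z w) auto
  then show "(\<lambda>\<omega>. alpha_hat \<nu> b n d (fst \<omega>) (fst (snd \<omega>)) (snd (snd \<omega>)) $ k $ l) \<in> borel_measurable ?S"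
    unfolding alpha_hat_def vec_lambda_beta by (rule measurable_compose[OF _ inv_mu_meas])
qed

text \<open>The permutations depend on the sample because the observed likelihood is invariant under
  relabelling of the parameter: the labels of a maximiser carry no meaning and may change from
  sample to sample.\<close>

theorem theorem6p1:
  fixes \<nu> :: "real measure" and b :: "real \<Rightarrow> real"
    and \<Theta> :: "('g::finite, 'm::finite) param set" and \<theta>_star :: "('g, 'm) param"
    and c :: real and C_alpha :: "real set"
    and N D :: "nat \<Rightarrow> nat"
    and mle :: "nat \<Rightarrow> (nat \<times> nat \<Rightarrow> real) \<Rightarrow> ('g, 'm) param"
  assumes family: "regular_exp_family \<nu> b"
    and params: "\<Theta> \<subseteq> param_space"
    and H1: "c > 0" "compact C_alpha" "C_alpha \<subseteq> interior (canonical_space \<nu> b)"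
      "\<Theta> \<subseteq> {(p, r, a). (\<forall>k. p $ k \<in> {c..1 - c}) \<and> (\<forall>l. r $ l \<in> {c..1 - c}) \<and>
                        (\<forall>k l. a $ k $ l \<in> C_alpha)}"
    and H2: "\<theta>_star \<in> (top_of_set param_space) interior_of \<Theta>"
    and H3: "identifiable_up_to_labels \<nu> b \<Theta> \<theta>_star"
    and sizes: "filterlim N at_top sequentially" "filterlim D at_top sequentially"
      "(\<lambda>i. ln (real (D i)) / real (N i)) \<longlonglongrightarrow> 0"
      "(\<lambda>i. ln (real (N i)) / real (D i)) \<longlonglongrightarrow> 0"
    and mle_measurable: "\<And>i. mle i \<in> borel_measurable (data_space (N i) (D i))"
    and mle: "\<And>i. AE x in observed_law \<nu> b (N i) (D i) \<theta>_star.
                     is_mle \<nu> b \<Theta> (N i) (D i) x (mle i x)"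
  defines "P \<equiv> \<lambda>i. lbm_law \<nu> b (N i) (D i) \<theta>_star"
    and "p_mle \<equiv> \<lambda>i x. fst (mle i x)"
    and "r_mle \<equiv> \<lambda>i x. fst (snd (mle i x))"
    and "a_mle \<equiv> \<lambda>i x. snd (snd (mle i x))"
  shows "\<exists>s t. (\<forall>i \<omega>. bij (s i \<omega>) \<and> bij (t i \<omega>)) \<and>
    small_o_P P (\<lambda>i (x, z, w). prop_hat (N i) z - perm_vec (s i (x, z, w)) (p_mle i x))
      (\<lambda>i. real (N i) powr (- 1 / 2)) \<and>
    small_o_P P (\<lambda>i (x, z, w). prop_hat (D i) w - perm_vec (t i (x, z, w)) (r_mle i x))
      (\<lambda>i. real (D i) powr (- 1 / 2)) \<and>
    small_o_P P (\<lambda>i (x, z, w). alpha_hat \<nu> b (N i) (D i) x z w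
                                 - perm_mat (s i (x, z, w)) (t i (x, z, w)) (a_mle i x))
      (\<lambda>i. (real (N i) * real (D i)) powr (- 1 / 2))"
proof -
  interpret exp_family \<nu> b
    using family H3 by unfold_locales (auto simp: identifiable_up_to_labels_def)
  obtain p0 r0 A where star: "\<theta>_star = (p0, r0, A)" by (cases \<theta>_star)
  obtain W where W: "openin (top_of_set param_space) W" "(p0, r0, A) \<in> W" "W \<subseteq> \<Theta>"
    using H2 unfolding star interior_of_def by blast
  then have in\<Theta>: "(p0, r0, A) \<in> \<Theta>" by blast
  obtain O1 where O1: "open O1" "W = param_space \<inter> O1" using W(1) by (auto simp: openin_open)
  obtain \<rho> where \<rho>: "\<rho> > 0" "ball (p0, r0, A) \<rho> \<subseteq> O1"
    using O1 W(2) open_contains_ball by blast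
  have \<rho>\<Theta>: "ball (p0, r0, A) \<rho> \<inter> param_space \<subseteq> \<Theta>" using \<rho>(2) O1(2) W(3) by blast
  have ident: "\<forall>\<theta>'\<in>\<Theta>. (\<forall>n d. observed_law \<nu> b n d \<theta>' = observed_law \<nu> b n d (p0, r0, A)) \<longrightarrow>
        (\<exists>!(s, t). bij s \<and> bij t \<and> \<theta>' = perm_param s t (p0, r0, A))"
    and row_ne: "\<forall>k k'. k \<noteq> k' \<longrightarrow> row k A \<noteq> row k' A"
    and col_ne: "\<forall>l l'. l \<noteq> l' \<longrightarrow> column l A \<noteq> column l' A"
    using H3 unfolding identifiable_up_to_labels_def star prod.case by simp_all
  \<comment> \<open>A symmetry and the identity pair would both represent
    \<open>\<theta>_star\<close> as a relabelling of itself, against uniqueness in the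
    identifiability assumption.\<close>
  have sym: "perm_param s t (p0, r0, A) \<noteq> (p0, r0, A)" if st: "bij s" "bij t" "(s, t) \<noteq> (id, id)" for s t
  proof
    assume fixed: "perm_param s t (p0, r0, A) = (p0, r0, A)"
    have idp: "perm_param id id (p0, r0, A) = (p0, r0, A)"
      by (simp add: perm_param_def perm_vec_def perm_mat_def vec_eq_iff)
    have "\<exists>!(s, t). bij s \<and> bij t \<and> (p0, r0, A) = perm_param s t (p0, r0, A)"
      by (rule mp[OF bspec[OF ident in\<Theta>]]) simp
    then obtain q where q: "\<And>q'. (case q' of (s, t) \<Rightarrow> bij s \<and> bij t \<and> (p0, r0, A) = perm_param s t (p0, r0, A)) \<Longrightarrow> q' = q"
      by (elim ex1E) blast
    have "(s, t) = q" "(id, id) = q" by (rule q; simp add: st fixed idp)+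
    then show False using st(3) by simp
  qed
  have rows: "\<exists>l. A $ k $ l \<noteq> A $ k' $ l" if "k \<noteq> k'" for k k'
  proof -
    have "row k A \<noteq> row k' A" using row_ne that by blast
    then show ?thesis by (simp add: row_def vec_eq_iff)
  qed
  have cols: "\<exists>k. A $ k $ l \<noteq> A $ k $ l'" if "l \<noteq> l'" for l l'
  proof -
    have "column l A \<noteq> column l' A" using col_ne that by blast
    then show ?thesis by (simp add: column_def vec_eq_iff)
  qed
  have H1p: "c \<le> p $ k" and H1r: "c \<le> r $ l" and H1a: "a $ k $ l \<in> C_alpha"
    if "(p, r, a) \<in> \<Theta>" for p r a k l
    using H1(4) that by auto
  have AK: "A $ k $ l \<in> K" for k l using H1a[OF in\<Theta>] H1(3) I_K by blast
  let ?Q = "\<lambda>\<eta> \<epsilon> \<delta> i. \<exists>T.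
      measure_pmf.prob (pair_pmf (label_pmf (N i) p0) (label_pmf (D i) r0)) (- T) \<le> \<delta> \<and>
      (\<forall>(y, v)\<in>T. \<exists>B\<in>sets (data_space (N i) (D i)).
        measure (data_law_given \<nu> b (N i) (D i) A y v) B \<le> \<delta> \<and>
        (\<forall>x\<in>space (data_space (N i) (D i)) - B. mle_near \<Theta> (p0, r0, A) \<eta> \<epsilon> (N i) (D i) x y v))"
  have "\<exists>\<eta>>0. (\<forall>s t. bij s \<longrightarrow> bij t \<longrightarrow> (s, t) \<noteq> (id, id) \<longrightarrow>
      2 * \<eta> \<le> dist (perm_param s t (p0, r0, A)) (p0, r0, A)) \<and>
      (\<forall>\<epsilon> \<delta>. \<epsilon> > 0 \<longrightarrow> \<delta> > 0 \<longrightarrow> eventually (?Q \<eta> \<epsilon> \<delta>) sequentially)"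
  proof (rule mle_excess_small[where \<Theta> = \<Theta> and c = c and C_alpha = C_alpha and ?p0.0 = p0 and ?r0.0 = r0 and A = A
        and \<rho> = \<rho> and N = N and D = D])
    fix \<eta> assume h: "\<eta> > 0"
      "\<And>s t. bij s \<Longrightarrow> bij t \<Longrightarrow> (s, t) \<noteq> (id, id) \<Longrightarrow> 2 * \<eta> \<le> dist (perm_param s t (p0, r0, A)) (p0, r0, A)"
      "\<And>\<epsilon> \<delta>. \<epsilon> > 0 \<Longrightarrow> \<delta> > 0 \<Longrightarrow> eventually (?Q \<eta> \<epsilon> \<delta>) sequentially"
    show ?thesis
      by (rule exI[of _ \<eta>], intro conjI allI impI h)
  qed (fact params H1(1,2,3) H1p H1r H1a in\<Theta> \<rho>(1) \<rho>\<Theta> sym rows cols sizes)+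
  then obtain \<eta> where \<eta>: "\<eta> > 0"
    and sym2: "\<And>s t. bij s \<Longrightarrow> bij t \<Longrightarrow> (s, t) \<noteq> (id, id) \<Longrightarrow> 2 * \<eta> \<le> dist (perm_param s t (p0, r0, A)) (p0, r0, A)"
    and close: "\<And>\<epsilon> \<delta>. \<epsilon> > 0 \<Longrightarrow> \<delta> > 0 \<Longrightarrow> eventually (?Q \<eta> \<epsilon> \<delta>) sequentially"
    by blast
  define al where "al = align \<eta> (p0, r0, A)"
  \<comment> \<open>The estimate after its labels have been matched with those of the truth.\<close>
  define g where "g = (\<lambda>\<theta>. perm_param (fst (al \<theta>)) (snd (al \<theta>)) \<theta>)"
  have gm: "g \<in> borel_measurable borel" unfolding g_def al_def by (rule align_measurable[OF sym2])
  let ?S = "\<lambda>i. joint_space (N i) (D i) :: ((nat \<times> nat \<Rightarrow> real) \<times> (nat \<Rightarrow> 'g) \<times> (nat \<Rightarrow> 'm)) measure"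
  have setsP: "sets (P i) = sets (?S i)" for i unfolding P_def star by (rule sets_lbm_law[OF AK])
  have spaceP: "space (P i) = space (?S i)" for i by (rule sets_eq_imp_space_eq[OF setsP])
  have gmle: "(\<lambda>\<omega>. g (mle i (fst \<omega>))) \<in> borel_measurable (?S i)" for i
    by (rule measurable_compose[OF measurable_compose[OF measurable_fst mle_measurable] gm])
  \<comment> \<open>An event that small excess excludes is negligible: atypical labels and the
    exceptional set account for \<open>e / 4\<close> each.\<close>
  have zero: "(\<lambda>i. measure (P i) (G i)) \<longlonglongrightarrow> 0"
    if G: "\<And>i. G i \<in> sets (?S i)" and \<epsilon>: "\<epsilon> > 0"
      and good: "\<And>i x y v. N i > 0 \<Longrightarrow> D i > 0 \<Longrightarrow> excess 1 (N i) (D i) (g (mle i x))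
          (prop_hat (N i) y, prop_hat (D i) v, alpha_hat \<nu> b (N i) (D i) x y v) \<le> \<epsilon>\<^sup>2 \<Longrightarrow> (x, y, v) \<notin> G i"
    for G \<epsilon>
  proof (rule tendstoI)
    fix e :: real assume e: "e > 0"
    have pos: "eventually (\<lambda>i. N i > 0) sequentially" "eventually (\<lambda>i. D i > 0) sequentially"
      using eventually_compose_filterlim[OF eventually_gt_at_top sizes(1)]
        eventually_compose_filterlim[OF eventually_gt_at_top sizes(2)] by auto
    have e4: "e / 4 > 0" using e by simp
    show "eventually (\<lambda>i. dist (measure (P i) (G i)) 0 < e) sequentially"
      using close[OF \<epsilon> e4] pos
    proof eventually_elim
      case (elim i)
      then obtain T where T: "measure_pmf.prob (pair_pmf (label_pmf (N i) p0) (label_pmf (D i) r0)) (- T) \<le> e / 4"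
        and TB: "\<forall>(y, v)\<in>T. \<exists>B\<in>sets (data_space (N i) (D i)).
          measure (data_law_given \<nu> b (N i) (D i) A y v) B \<le> e / 4 \<and>
          (\<forall>x\<in>space (data_space (N i) (D i)) - B. mle_near \<Theta> (p0, r0, A) \<eta> \<epsilon> (N i) (D i) x y v)"
        by blast
      have "measure (lbm_law \<nu> b (N i) (D i) (p0, r0, A)) (G i)
        \<le> e / 4 + measure_pmf.prob (pair_pmf (label_pmf (N i) p0) (label_pmf (D i) r0)) (- T)"
      proof (rule lbm_measure_le[OF AK G])
        show "0 \<le> e / 4" using e by simp
        fix y v assume yv: "(y, v) \<in> T" and supp: "(y, v) \<in> set_pmf (pair_pmf (label_pmf (N i) p0) (label_pmf (D i) r0))"
        let ?M = "data_law_given \<nu> b (N i) (D i) A y v"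
        interpret M: prob_space ?M by (rule prob_space_data_law[OF AK])
        obtain B where B: "B \<in> sets (data_space (N i) (D i))" "measure ?M B \<le> e / 4"
          and Bc: "\<And>x. x \<in> space (data_space (N i) (D i)) - B \<Longrightarrow> mle_near \<Theta> (p0, r0, A) \<eta> \<epsilon> (N i) (D i) x y v"
          using bspec[OF TB yv] by auto
        \<comment> \<open>The estimator maximises only almost surely under the observed law; as
          \<open>(y, v)\<close> has positive probability, this carries over to the conditional
          law.\<close>
        have ae: "AE x in ?M. is_mle \<nu> b \<Theta> (N i) (D i) x (mle i x)"
          by (rule observed_AE_section[OF AK mle[unfolded star] supp])
        have "measure ?M {x \<in> space (data_space (N i) (D i)). (x, y, v) \<in> G i} \<le> measure ?M B"
        proof (rule M.finite_measure_mono_AE)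
          show "AE x in ?M. x \<in> {x \<in> space (data_space (N i) (D i)). (x, y, v) \<in> G i} \<longrightarrow> x \<in> B"
            using ae AE_base_pos[OF AK]
          proof eventually_elim
            case (elim x)
            show ?case
            proof (rule impI, rule ccontr)
              assume x: "x \<in> {x \<in> space (data_space (N i) (D i)). (x, y, v) \<in> G i}" "x \<notin> B"
              then have xB: "x \<in> space (data_space (N i) (D i)) - B" by simp
              have cl: "(\<exists>s t. bij s \<and> bij t \<and> dist (perm_param s t (mle i x)) (p0, r0, A) < \<eta>) \<and>
                (\<forall>s t. bij s \<longrightarrow> bij t \<longrightarrow> dist (perm_param s t (mle i x)) (p0, r0, A) < \<eta> \<longrightarrow>
                excess 1 (N i) (D i) (perm_param s t (mle i x))
                  (prop_hat (N i) y, prop_hat (D i) v, alpha_hat \<nu> b (N i) (D i) x y v) \<le> \<epsilon>\<^sup>2)"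
                using Bc[OF xB] elim unfolding mle_near_def by blast
              note ac = align_close[OF conjunct1[OF cl]]
              have "excess 1 (N i) (D i) (g (mle i x))
                (prop_hat (N i) y, prop_hat (D i) v, alpha_hat \<nu> b (N i) (D i) x y v) \<le> \<epsilon>\<^sup>2"
                unfolding g_def al_def
                by (rule conjunct2[OF cl, rule_format]) (use ac in simp_all)
              then have "(x, y, v) \<notin> G i" using good \<open>N i > 0\<close> \<open>D i > 0\<close> by blast
              then show False using x by simp
            qed
          qed
          show "B \<in> sets ?M" using B(1) by (simp add: sets_data_law[OF AK])
        qed
        then show "measure ?M {x \<in> space (data_space (N i) (D i)). (x, y, v) \<in> G i} \<le> e / 4" using B(2) by simp
      qed
      then have "measure (P i) (G i) \<le> e / 2" using T unfolding P_def star by linarith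
      then show ?case using e by (simp add: measure_nonneg)
    qed
  qed
  \<comment> \<open>The common form of the three claims: a measurable error whose norm is bounded as
    soon as the excess is small.\<close>
  have oP: "small_o_P P (\<lambda>i \<omega>. X i \<omega>) rate"
    if meas: "\<And>i. X i \<in> borel_measurable (?S i)"
      and bound: "\<And>i x y v \<epsilon>. N i > 0 \<Longrightarrow> D i > 0 \<Longrightarrow> \<epsilon> > 0 \<Longrightarrow> excess 1 (N i) (D i) (g (mle i x))
          (prop_hat (N i) y, prop_hat (D i) v, alpha_hat \<nu> b (N i) (D i) x y v) \<le> \<epsilon>\<^sup>2 \<Longrightarrow> norm (X i (x, y, v)) \<le> \<epsilon> * rate i"
    for X :: "nat \<Rightarrow> (nat \<times> nat \<Rightarrow> real) \<times> (nat \<Rightarrow> 'g) \<times> (nat \<Rightarrow> 'm) \<Rightarrow> 'e::euclidean_space" and rate :: "nat \<Rightarrow> real"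
    unfolding small_o_P_def
  proof (intro conjI allI impI)
    show "X i \<in> borel_measurable (P i)" for i
      using meas[of i] unfolding measurable_cong_sets[OF setsP refl] .
    fix \<epsilon> :: real assume \<epsilon>: "\<epsilon> > 0"
    show "(\<lambda>i. measure (P i) {\<omega> \<in> space (P i). \<epsilon> * rate i < norm (X i \<omega>)}) \<longlonglongrightarrow> 0"
    proof (rule zero[OF _ \<epsilon>])
      show "{\<omega> \<in> space (P i). \<epsilon> * rate i < norm (X i \<omega>)} \<in> sets (?S i)" for i
        unfolding spaceP using meas[of i] by measurable
      show "(x, y, v) \<notin> {\<omega> \<in> space (P i). \<epsilon> * rate i < norm (X i \<omega>)}"
        if "N i > 0" "D i > 0" "excess 1 (N i) (D i) (g (mle i x))
          (prop_hat (N i) y, prop_hat (D i) v, alpha_hat \<nu> b (N i) (D i) x y v) \<le> \<epsilon>\<^sup>2" for i x y v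
        using bound[OF that(1,2) \<epsilon> that(3)] by (simp add: not_less)
    qed
  qed
  have zm: "(\<lambda>\<omega>. prop_hat n (fst (snd \<omega>))) \<in> borel_measurable (?S i)"
    and wm: "(\<lambda>\<omega>. prop_hat n (snd (snd \<omega>))) \<in> borel_measurable (?S i)" for n i
    by (rule measurable_compose[where N = "count_space UNIV" and g = "prop_hat n"]; measurable)+
  have proj: "(\<lambda>\<theta> :: ('g, 'm) param. fst \<theta>) \<in> borel_measurable borel"
    "(\<lambda>\<theta> :: ('g, 'm) param. fst (snd \<theta>)) \<in> borel_measurable borel"
    "(\<lambda>\<theta> :: ('g, 'm) param. snd (snd \<theta>)) \<in> borel_measurable borel"
    by (intro borel_measurable_continuous_onI continuous_intros)+
  show ?thesis
  proof (intro exI[of _ "\<lambda>i \<omega>. fst (al (mle i (fst \<omega>)))"] exI[of _ "\<lambda>i \<omega>. snd (al (mle i (fst \<omega>)))"] conjI allI)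
    show "bij (fst (al (mle i (fst \<omega>))))" "bij (snd (al (mle i (fst \<omega>))))" for i \<omega>
      unfolding al_def by (rule align_bij)+
    show "small_o_P P (\<lambda>i (x, z, w). prop_hat (N i) z - perm_vec (fst (al (mle i (fst (x, z, w))))) (p_mle i x))
      (\<lambda>i. real (N i) powr (- 1 / 2))"
    proof (rule oP)
      show "(\<lambda>(x, z, w). prop_hat (N i) z - perm_vec (fst (al (mle i (fst (x, z, w))))) (p_mle i x)) \<in> borel_measurable (?S i)" for i
        using borel_measurable_diff[OF zm[of "N i" i] measurable_compose[OF gmle[of i] proj(1)]]
        by (simp add: case_prod_beta g_def p_mle_def)
      fix i x y v and \<epsilon> :: real
      assume "N i > 0" "D i > 0" "\<epsilon> > 0" and ex: "excess 1 (N i) (D i) (g (mle i x))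
          (prop_hat (N i) y, prop_hat (D i) v, alpha_hat \<nu> b (N i) (D i) x y v) \<le> \<epsilon>\<^sup>2"
      have "real (N i) * (norm (fst (g (mle i x)) - prop_hat (N i) y))\<^sup>2 \<le> \<epsilon>\<^sup>2"
        using excess_1_partD(1)[OF ex] by simp
      then show "norm (case (x, y, v) of (x, z, w) \<Rightarrow> prop_hat (N i) z - perm_vec (fst (al (mle i (fst (x, z, w))))) (p_mle i x))
          \<le> \<epsilon> * real (N i) powr (- 1 / 2)"
        using le_times_powr_minus_half[of "real (N i)"] \<open>N i > 0\<close> \<open>\<epsilon> > 0\<close>
        by (simp add: g_def p_mle_def norm_minus_commute)
    qed
    show "small_o_P P (\<lambda>i (x, z, w). prop_hat (D i) w - perm_vec (snd (al (mle i (fst (x, z, w))))) (r_mle i x))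
      (\<lambda>i. real (D i) powr (- 1 / 2))"
    proof (rule oP)
      show "(\<lambda>(x, z, w). prop_hat (D i) w - perm_vec (snd (al (mle i (fst (x, z, w))))) (r_mle i x)) \<in> borel_measurable (?S i)" for i
        using borel_measurable_diff[OF wm[of "D i" i] measurable_compose[OF gmle[of i] proj(2)]]
        by (simp add: case_prod_beta g_def r_mle_def)
      fix i x y v and \<epsilon> :: real
      assume "N i > 0" "D i > 0" "\<epsilon> > 0" and ex: "excess 1 (N i) (D i) (g (mle i x))
          (prop_hat (N i) y, prop_hat (D i) v, alpha_hat \<nu> b (N i) (D i) x y v) \<le> \<epsilon>\<^sup>2"
      have "real (D i) * (norm (fst (snd (g (mle i x))) - prop_hat (D i) v))\<^sup>2 \<le> \<epsilon>\<^sup>2"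
        using excess_1_partD(2)[OF ex] by simp
      then show "norm (case (x, y, v) of (x, z, w) \<Rightarrow> prop_hat (D i) w - perm_vec (snd (al (mle i (fst (x, z, w))))) (r_mle i x))
          \<le> \<epsilon> * real (D i) powr (- 1 / 2)"
        using le_times_powr_minus_half[of "real (D i)"] \<open>D i > 0\<close> \<open>\<epsilon> > 0\<close>
        by (simp add: g_def r_mle_def norm_minus_commute)
    qed
    show "small_o_P P (\<lambda>i (x, z, w). alpha_hat \<nu> b (N i) (D i) x z w
        - perm_mat (fst (al (mle i (fst (x, z, w))))) (snd (al (mle i (fst (x, z, w))))) (a_mle i x))
      (\<lambda>i. (real (N i) * real (D i)) powr (- 1 / 2))"
    proof (rule oP)
      show "(\<lambda>(x, z, w). alpha_hat \<nu> b (N i) (D i) x z w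
        - perm_mat (fst (al (mle i (fst (x, z, w))))) (snd (al (mle i (fst (x, z, w))))) (a_mle i x)) \<in> borel_measurable (?S i)" for i
        using borel_measurable_diff[OF alpha_hat_measurable[of "N i" "D i"] measurable_compose[OF gmle[of i] proj(3)]]
        by (simp add: case_prod_beta g_def a_mle_def)
      fix i x y v and \<epsilon> :: real
      assume "N i > 0" "D i > 0" "\<epsilon> > 0" and ex: "excess 1 (N i) (D i) (g (mle i x))
          (prop_hat (N i) y, prop_hat (D i) v, alpha_hat \<nu> b (N i) (D i) x y v) \<le> \<epsilon>\<^sup>2"
      have "real (N i) * real (D i) * (norm (snd (snd (g (mle i x))) - alpha_hat \<nu> b (N i) (D i) x y v))\<^sup>2 \<le> \<epsilon>\<^sup>2"
        using excess_1_partD(3)[OF ex] by simp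
      then show "norm (case (x, y, v) of (x, z, w) \<Rightarrow> alpha_hat \<nu> b (N i) (D i) x z w
          - perm_mat (fst (al (mle i (fst (x, z, w))))) (snd (al (mle i (fst (x, z, w))))) (a_mle i x))
          \<le> \<epsilon> * (real (N i) * real (D i)) powr (- 1 / 2)"
        using le_times_powr_minus_half[of "real (N i) * real (D i)"] \<open>N i > 0\<close> \<open>D i > 0\<close> \<open>\<epsilon> > 0\<close>
        by (simp add: g_def a_mle_def norm_minus_commute)
    qed
  qed
qed

end
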